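(* Let $Z$ be a set and $\lambda\in\mathbf k$. The free differential algebra $\mathcal D_\lambda(Z)$ of weight $\lambda$ on $Z$ has the polygraphic resolution $\mathrm{Sq}(\widetilde X^D)$, where (i) $\mathrm{Sq}_0(\widetilde X^D)=Z$; (ii) $\mathrm{Sq}_1(\widetilde X^D)=\{\epsilon|D(1)\}\cup\{\epsilon|D(uv)\;:\;u,v\in(D^\theta(Z))^*\setminus\{1\}\}$; (iii) $\mathrm{Sq}_n(\widetilde X^D)$ is empty for every $n\ge2$.
   Context: **Operated algebras.** $\mathbf k$ is a field of characteristic zero, $\Omega$ is a set, algebras are associative and unital over $\mathbf k$. An $\Omega$-algebra is an algebra $A$ with $\mathbf k$-linear maps $\mathcal T_\tau:A\to A$, $\tau\in\Omega$; morphisms are algebra morphisms commuting with the operators. For a set $Z$, the free $\Omega$-monoid $Z^\Omega$ is the union of $Z^\Omega_0=Z^*\subset Z^\Omega_1\subset\cdots$, $Z_n^\Omega=(Z\sqcup\{\lfloor u\rfloor_\tau: u\in Z^\Omega_{n-1},\tau\in\Omega\})^*$, with operators $u\mapsto\lfloor u\rfloor_\tau$; $1=\epsilon$ is the empty monomial. $\mathscr A_\Omega(Z)$ is the $\mathbf k$-linear span of $Z^\Omega$ (free $\Omega$-algebra). $\mathrm{supp}(a)$ is the set of monomials with nonzero coefficient in $a$. $Z^\Omega[\square]$ is the set of elements of $(Z\sqcup\{\square\})^\Omega$ in which $\square$ occurs exactly once; $q|_a$ denotes substitution of $a$ for $\square$, extended linearly in $a$. **Rewriting.** An $\Omega$-$1$-polygraph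 $X=(Z,X_1)$ is a set $Z$ of $0$-generators and a set $X_1$ of $1$-generators $\alpha:s(\alpha)\to t(\alpha)$, $s(\alpha)\in Z^\Omega$, $t(\alpha)\in\mathscr A_\Omega(Z)$, $s(\alpha)\notin\mathrm{supp}(t(\alpha))$. A rewriting step is $\mu q|_{s(\alpha)}+c\to\mu q|_{t(\alpha)}+c$ with $\mu\in\mathbf k\setminus\{0\}$, $q|_{s(\alpha)}\notin\mathrm{supp}(c)$. $X$ is terminating if there is no infinite sequence of rewriting steps, confluent if any two finite sequences of rewriting steps from the same element can be continued to a common element, convergent if both. An element is a normal form if it is not the source of a rewriting step, else reducible; for $X$ convergent $\widehat a$ is the unique normal form of $a$. $\mathrm{Nf}(X)$ is the set of elements of $Z^\Omega$ that are normal forms. $\overline X$ is the quotient of $\mathscr A_\Omega(Z)$ by the $\Omega$-ideal generated by the $s(\alpha)-t(\alpha)$. **Higher algebras and polygraphs.** For $n\in\mathbb N\cup\{\omega\}$, an $n$-algebra is a strict $n$-category internal to $\Omega$-algebras ($a\star_k b$ is defined when $t_k(a)=s_k(b)$; lower cells are identified with their identities). A cellular extension of an $n$-algebra $A$ is a set $Y$ with maps $s,t:Y\to A_n$ such that $s(y),t(y)$ are parallel (same source and target, if $n\ge1$); $A[Y]$ is the $(n+1)$-algebra obtained by freely adjoining each $y$ as an $(n+1)$-cell $s(y)\to t(y)$. An $\Omega$-$\omega$-polygraph is a sequence $S=(S_0,S_1,\ldots)$ with $S_0$ a set, $S_1$ a cellular extension of $\mathscr A_\Omega(S_0)$, and $S_{n+1}$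 a cellular extension of the free $n$-algebra $\mathscr A_\Omega(S_0,\ldots,S_n)=\mathscr A_\Omega(S_0,\ldots,S_{n-1})[S_n]$; $\mathscr A_\Omega(S)$ is the resulting free $\omega$-algebra. $\overline S$ is the $\Omega$-algebra presented by $(S_0,S_1)$, seen as an $\omega$-algebra with only identity $n$-cells for $n\ge1$; $\pi:\mathscr A_\Omega(S)\to\overline S$ is the projection. $S$ is a polygraphic resolution of an $\Omega$-algebra $A$ if $\overline S\cong A$ and, for each $n\ge1$ and each pair $(f,g)$ of parallel $n$-cells of $\mathscr A_\Omega(S_0,\dots,S_n)$, there is an $(n+1)$-cell $f\to g$ in $\mathscr A_\Omega(S_0,\ldots,S_{n+1})$. **Contractions.** A unital section of $S$ is a linear map $\iota:\overline S\to\mathscr A_\Omega(S)$ (compatible with sources, targets, identities) with $\pi\iota=\mathrm{id}$, $\iota(1)=1$; write $\widehat a=\iota\pi(a)$. An $\iota$-contraction $\sigma$ consists of linear maps $a\mapsto\sigma_a$ from $k$-cells to $(k+1)$-cells of $\mathscr A_\Omega(S)$ with $\sigma_a:a\to\widehat a$ for $0$-cells; for each $n$-cell $a$, $n\ge1$, $s(\sigma_a)=a\star_0\sigma_{t_0(a)}\star_1\cdots\star_{n-1}\sigma_{t_{n-1}(a)}$ and $t(\sigma_a)=\sigma_{s_{n-1}(a)}\star_{n-1}\cdots\star_1\sigma_{s_0(a)}\star_0\widehat a$; $\sigma_{1_a}=1_{\sigma_a}$; $\sigma_a=1_a$ for every cell $a$ in the image of $\iota$ or $\sigma$. It is right and bracketed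 if for all $n$-cells $f,g,h$ with $0$-sources $a,b,c$, all $v\in Z^\Omega$, $\tau\in\Omega$: $\sigma_{fg}=a\sigma_g\star_0\sigma_{f\widehat b}$ and $\sigma_{\lfloor h\rfloor_\tau v}=\lfloor\sigma_h\rfloor_\tau v\star_0\sigma_{\lfloor\widehat c\rfloor_\tau v}$. **$\mathrm{Sq}(X)$ for a reduced convergent $X$** (reduced: for each $\alpha\in X_1$, $\alpha$ is the only rewriting step with source $s(\alpha)$, and $t(\alpha)$ is a normal form). $\mathrm{Sq}_0(X)=Z$. $\mathrm{Sq}_1(X)$ is the set of pairs $u_1|u_2$ such that either (a) $u_1\in Z$ or $u_1=\lfloor u_0\rfloor_\tau\in\mathrm{Nf}(X)$ for some $u_0,\tau$, and $u_2\in\mathrm{Nf}(X)$; or (b) $u_1=\epsilon$ and $u_2=\lfloor u_0\rfloor_\tau$ with $u_0\in\mathrm{Nf}(X)$; and in both cases (c) $u_1u_2$ is reducible and every proper left-factor of $u_1u_2$ is a normal form. For $n\ge2$, $\mathrm{Sq}_n(X)$ is the set of tuples $u_1|\cdots|u_{n+1}$ such that $(u_1,u_2)$ satisfies (a) and (c), $u_i\in\mathrm{Nf}(X)$ for $i>2$, and for $2\le i<n+1$ the monomial $u_iu_{i+1}$ is reducible with all proper left-factors normal forms. $\mathrm{Sq}(X)$ is equipped with the unique $\Omega$-$\omega$-polygraph structure for which there are a unital section $\iota$ with $\iota\pi(u)=\widehat u$ for $u\in Z^\Omega$ and a right and bracketed $\iota$-contraction $\sigma$ such that, for $n\ge1$,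 $u_1|\cdots|u_n\in\mathrm{Sq}_{n-1}(X)$ (for $n=1$ also $u_1=\lfloor u_0\rfloor_\tau\in\mathrm{Nf}(X)$) and $u_{n+1}\in\mathrm{Nf}(X)$, $\sigma_{(u_1|\cdots|u_n)u_{n+1}}$ equals $u_1|\cdots|u_{n+1}$ if this tuple is in $\mathrm{Sq}_n(X)$, and the identity $1_{(u_1|\cdots|u_n)u_{n+1}}$ if $u_nu_{n+1}\in\mathrm{Nf}(X)$; and $\sigma_{\lfloor u_0\rfloor_\tau}=\epsilon|\lfloor u_0\rfloor_\tau$ for reducible $\lfloor u_0\rfloor_\tau$ with $u_0\in\mathrm{Nf}(X)$, $\sigma_{(\epsilon|\lfloor u_0\rfloor_\tau)u_3}=1_{(\epsilon|\lfloor u_0\rfloor_\tau)u_3}$ for $u_3\in\mathrm{Nf}(X)$. **Differential algebras.** Here $\Omega=\{D\}$ and $D(u)$ denotes $\lfloor u\rfloor_D$. $\mathcal D_\lambda(Z)$ is the free $\Omega$-algebra on $Z$ whose operator satisfies $D(ab)=D(a)b+aD(b)+\lambda D(a)D(b)$ and $D(1)=0$ for all $a,b$ (the quotient of $\mathscr A_\Omega(Z)$ by these relations). $D^\theta(Z)=\{D^i(x):x\in Z,i\ge0\}$, and $(D^\theta(Z))^*\subset Z^\Omega$ is the set of finite products of its elements. $\widetilde X^D$ is the $\Omega$-$1$-polygraph on $Z$ with rule $D(1)\to0$ and, for all $n\ge2$, $u_1,\ldots,u_n\in D^\theta(Z)$, the rule $$D(u_1u_2\cdots u_n)\to\sum_{1\le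 k\le n}\ \sum_{1\le i_1<\cdots<i_k\le n}\lambda^{k-1}D_{i_1,\ldots,i_k}(u_1,\ldots,u_n),$$ where $D_{i_1,\ldots,i_k}(u_1,\ldots,u_n)$ is the product $u_1\cdots u_n$ with $u_{i_j}$ replaced by $D(u_{i_j})$ for $j=1,\ldots,k$. It is reduced, convergent and presents $\mathcal D_\lambda(Z)$. *)

theory Defs
  imports
    "HOL-Library.Poly_Mapping"
    "HOL-Library.FuncSet"
    "HOL-Library.Sublist"
    "HOL-Algebra.Module"
    "HOL-Algebra.QuotRing"
begin

section \<open>Operated algebras\<close>

text \<open>An algebra over the field \<open>'k\<close> with a family of linear operators indexed by the
  (nonempty) type \<open>'w\<close>.  The ring structure is the noncommutative one of HOL-Algebra.\<close>

record ('k, 'c, 'w) opalg = "('k, 'c) module" +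
  oper :: "'w \<Rightarrow> 'c \<Rightarrow> 'c"

definition linear_hom ::
    "('k, 'c, 'm) module_scheme \<Rightarrow> ('k, 'd, 'n) module_scheme \<Rightarrow> ('c \<Rightarrow> 'd) set" where
  "linear_hom M N = {f \<in> carrier M \<rightarrow> carrier N.
     (\<forall>x\<in>carrier M. \<forall>y\<in>carrier M. f (x \<oplus>\<^bsub>M\<^esub> y) = f x \<oplus>\<^bsub>N\<^esub> f y) \<and>
     (\<forall>c. \<forall>x\<in>carrier M. f (c \<odot>\<^bsub>M\<^esub> x) = c \<odot>\<^bsub>N\<^esub> f x)}"

definition operated_algebra :: "('k::field, 'c, 'w) opalg \<Rightarrow> bool" where
  "operated_algebra M \<longleftrightarrow> ring M \<and>
     (\<forall>c. \<forall>x\<in>carrier M. c \<odot>\<^bsub>M\<^esub> x \<in> carrier M) \<and>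
     (\<forall>c. \<forall>x\<in>carrier M. \<forall>y\<in>carrier M. c \<odot>\<^bsub>M\<^esub> (x \<oplus>\<^bsub>M\<^esub> y) = c \<odot>\<^bsub>M\<^esub> x \<oplus>\<^bsub>M\<^esub> c \<odot>\<^bsub>M\<^esub> y) \<and>
     (\<forall>c d. \<forall>x\<in>carrier M. (c + d) \<odot>\<^bsub>M\<^esub> x = c \<odot>\<^bsub>M\<^esub> x \<oplus>\<^bsub>M\<^esub> d \<odot>\<^bsub>M\<^esub> x) \<and>
     (\<forall>c d. \<forall>x\<in>carrier M. (c * d) \<odot>\<^bsub>M\<^esub> x = c \<odot>\<^bsub>M\<^esub> (d \<odot>\<^bsub>M\<^esub> x)) \<and>
     (\<forall>x\<in>carrier M. 1 \<odot>\<^bsub>M\<^esub> x = x) \<and>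
     (\<forall>c. \<forall>x\<in>carrier M. \<forall>y\<in>carrier M. (c \<odot>\<^bsub>M\<^esub> x) \<otimes>\<^bsub>M\<^esub> y = c \<odot>\<^bsub>M\<^esub> (x \<otimes>\<^bsub>M\<^esub> y)) \<and>
     (\<forall>c. \<forall>x\<in>carrier M. \<forall>y\<in>carrier M. x \<otimes>\<^bsub>M\<^esub> (c \<odot>\<^bsub>M\<^esub> y) = c \<odot>\<^bsub>M\<^esub> (x \<otimes>\<^bsub>M\<^esub> y)) \<and>
     (\<forall>\<tau>. oper M \<tau> \<in> linear_hom M M)"

definition op_hom :: "('k, 'c, 'w) opalg \<Rightarrow> ('k, 'd, 'w) opalg \<Rightarrow> ('c \<Rightarrow> 'd) set" where
  "op_hom M N = {f \<in> ring_hom M N \<inter> linear_hom M N.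
     \<forall>\<tau>. \<forall>x\<in>carrier M. f (oper M \<tau> x) = oper N \<tau> (f x)}"

definition op_iso :: "('k, 'c, 'w) opalg \<Rightarrow> ('k, 'd, 'w) opalg \<Rightarrow> bool" where
  "op_iso M N \<longleftrightarrow> (\<exists>f\<in>op_hom M N. bij_betw f (carrier M) (carrier N))"

definition op_ideal :: "'c set \<Rightarrow> ('k, 'c, 'w) opalg \<Rightarrow> bool" where
  "op_ideal I M \<longleftrightarrow> ideal I M \<and>
     (\<forall>c. \<forall>x\<in>I. c \<odot>\<^bsub>M\<^esub> x \<in> I) \<and> (\<forall>\<tau>. \<forall>x\<in>I. oper M \<tau> x \<in> I)"

definition gen_op_ideal :: "('k, 'c, 'w) opalg \<Rightarrow> 'c set \<Rightarrow> 'c set" where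
  "gen_op_ideal M R = \<Inter> {I. op_ideal I M \<and> R \<subseteq> I}"

definition op_quot :: "('k, 'c, 'w) opalg \<Rightarrow> 'c set \<Rightarrow> ('k, 'c set, 'w) opalg" where
  "op_quot M I =
     \<lparr>carrier = carrier (M Quot I), mult = mult (M Quot I), one = one (M Quot I),
      zero = zero (M Quot I), add = add (M Quot I),
      smult = (\<lambda>c A. \<Union>x\<in>A. I +>\<^bsub>M\<^esub> (c \<odot>\<^bsub>M\<^esub> x)),
      oper = (\<lambda>\<tau> A. \<Union>x\<in>A. I +>\<^bsub>M\<^esub> oper M \<tau> x)\<rparr>"


section \<open>Free operated monoids and algebras\<close>

text \<open>Monomials are words of letters, a letter being a generator or a bracketed monomial;
  the set \<open>Z\<^sup>\<Omega>\<close> is \<open>omonoid Z\<close>.  Words are made an additively written monoid under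
  concatenation, so that \<open>mono \<Rightarrow>\<^sub>0 'k\<close> is the monoid algebra with its library product.\<close>

datatype ('z, 'w) letter = Atom 'z | Br 'w "('z, 'w) letter list"

type_synonym ('z, 'w) mono = "('z, 'w) letter list"

instantiation list :: (type) monoid_add
begin
definition "0 = []"
definition "xs + ys = xs @ ys"
instance by standard (simp_all add: zero_list_def plus_list_def)
end

type_synonym ('k, 'z, 'w) opoly = "('z, 'w) mono \<Rightarrow>\<^sub>0 'k"

abbreviation mon :: "('z, 'w) mono \<Rightarrow> ('k::zero_neq_one, 'z, 'w) opoly" where
  "mon u \<equiv> Poly_Mapping.single u 1"

definition omonoid :: "'z set \<Rightarrow> ('z, 'w) mono set" where
  "omonoid Z = {u. \<forall>l\<in>set u. set1_letter l \<subseteq> Z}"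

definition lin_ext :: "('a \<Rightarrow> 'b) \<Rightarrow> ('a \<Rightarrow>\<^sub>0 'k::comm_monoid_add) \<Rightarrow> ('b \<Rightarrow>\<^sub>0 'k)" where
  "lin_ext f p = (\<Sum>u\<in>Poly_Mapping.keys p. Poly_Mapping.single (f u) (Poly_Mapping.lookup p u))"

definition scale :: "'k \<Rightarrow> ('a \<Rightarrow>\<^sub>0 'k) \<Rightarrow> ('a \<Rightarrow>\<^sub>0 'k::mult_zero)" where
  "scale c p = Poly_Mapping.map ((*) c) p"

definition brk :: "'w \<Rightarrow> ('k::comm_monoid_add, 'z, 'w) opoly \<Rightarrow> ('k, 'z, 'w) opoly" where
  "brk \<tau> = lin_ext (\<lambda>u. [Br \<tau> u])"

definition free_opalg :: "'z set \<Rightarrow> ('k::field, ('k, 'z, 'w) opoly, 'w) opalg" where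
  "free_opalg Z =
     \<lparr>carrier = {p. Poly_Mapping.keys p \<subseteq> omonoid Z}, mult = (*), one = 1, zero = 0, add = (+),
      smult = scale, oper = brk\<rparr>"


declare [[typedef_overloaded]]

section \<open>Rewriting\<close>

record ('k, 'z, 'w, 'r) polygraph1 =
  zgens :: "'z set"
  rules :: "'r set"
  lhs :: "'r \<Rightarrow> ('z, 'w) mono"
  rhs :: "'r \<Rightarrow> ('k, 'z, 'w) opoly"

text \<open>In one-hole contexts the hole \<open>\<box>\<close> is the extra generator \<^const>\<open>None\<close>.\<close>

primrec holes_letter :: "('z option, 'w) letter \<Rightarrow> nat" where
  "holes_letter (Atom y) = (if y = None then 1 else 0)"
| "holes_letter (Br \<tau> u) = sum_list (map holes_letter u)"

definition holes :: "('z option, 'w) mono \<Rightarrow> nat" where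
  "holes q = sum_list (map holes_letter q)"

definition contexts :: "'z set \<Rightarrow> ('z option, 'w) mono set" where
  "contexts Z = {q \<in> omonoid (insert None (Some ` Z)). holes q = 1}"

primrec plug_letter :: "('z, 'w) mono \<Rightarrow> ('z option, 'w) letter \<Rightarrow> ('z, 'w) mono" where
  "plug_letter v (Atom y) = (case y of None \<Rightarrow> v | Some x \<Rightarrow> [Atom x])"
| "plug_letter v (Br \<tau> u) = [Br \<tau> (concat (map (plug_letter v) u))]"

definition plug :: "('z option, 'w) mono \<Rightarrow> ('z, 'w) mono \<Rightarrow> ('z, 'w) mono" where
  "plug q v = concat (map (plug_letter v) q)"

definition rstep :: "('k::field, 'z, 'w, 'r) polygraph1 \<Rightarrow> ('k, 'z, 'w) opoly \<Rightarrow> ('k, 'z, 'w) opoly \<Rightarrow> bool" where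
  "rstep X a b \<longleftrightarrow> (\<exists>\<mu> q \<alpha> c. \<mu> \<noteq> 0 \<and> q \<in> contexts (zgens X) \<and> \<alpha> \<in> rules X \<and>
     c \<in> carrier (free_opalg (zgens X)) \<and> plug q (lhs X \<alpha>) \<notin> Poly_Mapping.keys c \<and>
     a = scale \<mu> (mon (plug q (lhs X \<alpha>))) + c \<and>
     b = scale \<mu> (lin_ext (plug q) (rhs X \<alpha>)) + c)"

definition normal_form :: "('k::field, 'z, 'w, 'r) polygraph1 \<Rightarrow> ('k, 'z, 'w) opoly \<Rightarrow> bool" where
  "normal_form X a \<longleftrightarrow> a \<in> carrier (free_opalg (zgens X)) \<and> (\<nexists>b. rstep X a b)"

definition nf :: "('k::field, 'z, 'w, 'r) polygraph1 \<Rightarrow> ('k, 'z, 'w) opoly \<Rightarrow> ('k, 'z, 'w) opoly" where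
  "nf X a = (THE b. (rstep X)\<^sup>*\<^sup>* a b \<and> normal_form X b)"

definition Nf :: "('k::field, 'z, 'w, 'r) polygraph1 \<Rightarrow> ('z, 'w) mono set" where
  "Nf X = {u \<in> omonoid (zgens X). normal_form X (mon u)}"

definition reducible_monos :: "('k::field, 'z, 'w, 'r) polygraph1 \<Rightarrow> ('z, 'w) mono set" where
  "reducible_monos X = omonoid (zgens X) - Nf X"


section \<open>Higher algebras\<close>

text \<open>\<open>cell A n\<close> is the operated algebra of \<open>n\<close>-cells; \<open>src A n\<close> and \<open>tgt A n\<close> go from
  \<open>(n+1)\<close>-cells to \<open>n\<close>-cells, \<open>idc A n\<close> from \<open>n\<close>-cells to \<open>(n+1)\<close>-cells, and \<open>comp A n k a b\<close>
  is \<open>a \<star>\<^sub>k b\<close> for \<open>n\<close>-cells \<open>a\<close>, \<open>b\<close> and \<open>k < n\<close>.\<close>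

record ('k, 'c, 'w) higher_alg =
  cell :: "nat \<Rightarrow> ('k, 'c, 'w) opalg"
  src :: "nat \<Rightarrow> 'c \<Rightarrow> 'c"
  tgt :: "nat \<Rightarrow> 'c \<Rightarrow> 'c"
  idc :: "nat \<Rightarrow> 'c \<Rightarrow> 'c"
  comp :: "nat \<Rightarrow> nat \<Rightarrow> 'c \<Rightarrow> 'c \<Rightarrow> 'c"

text \<open>\<open>down (src A) k n a\<close> is \<open>s\<^sub>k(a)\<close> and \<open>up (idc A) n m a\<close> is \<open>a\<close> regarded as an \<open>m\<close>-cell,
  for \<open>a\<close> an \<open>n\<close>-cell and \<open>k \<le> n \<le> m\<close>.\<close>

primrec down :: "(nat \<Rightarrow> 'a \<Rightarrow> 'a) \<Rightarrow> nat \<Rightarrow> nat \<Rightarrow> 'a \<Rightarrow> 'a" where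
  "down f k 0 a = a"
| "down f k (Suc n) a = (if k \<le> n then down f k n (f n a) else a)"

primrec up :: "(nat \<Rightarrow> 'a \<Rightarrow> 'a) \<Rightarrow> nat \<Rightarrow> nat \<Rightarrow> 'a \<Rightarrow> 'a" where
  "up f n 0 a = a"
| "up f n (Suc m) a = (if n \<le> m then f m (up f n m a) else a)"

abbreviation composable :: "('k, 'c, 'w) higher_alg \<Rightarrow> nat \<Rightarrow> nat \<Rightarrow> 'c \<Rightarrow> 'c \<Rightarrow> bool" where
  "composable A n k a b \<equiv> a \<in> carrier (cell A n) \<and> b \<in> carrier (cell A n) \<and>
     down (tgt A) k n a = down (src A) k n b"

definition composables :: "('k, 'c, 'w) higher_alg \<Rightarrow> nat \<Rightarrow> nat \<Rightarrow> ('k, 'c \<times> 'c, 'w) opalg" where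
  "composables A n k = (let M = cell A n in
     \<lparr>carrier = {(a, b). composable A n k a b},
      mult = (\<lambda>(a, b) (a', b'). (a \<otimes>\<^bsub>M\<^esub> a', b \<otimes>\<^bsub>M\<^esub> b')), one = (\<one>\<^bsub>M\<^esub>, \<one>\<^bsub>M\<^esub>),
      zero = (\<zero>\<^bsub>M\<^esub>, \<zero>\<^bsub>M\<^esub>), add = (\<lambda>(a, b) (a', b'). (a \<oplus>\<^bsub>M\<^esub> a', b \<oplus>\<^bsub>M\<^esub> b')),
      smult = (\<lambda>c (a, b). (c \<odot>\<^bsub>M\<^esub> a, c \<odot>\<^bsub>M\<^esub> b)),
      oper = (\<lambda>\<tau> (a, b). (oper M \<tau> a, oper M \<tau> b))\<rparr>)"

text \<open>Strict \<open>\<omega>\<close>-categories internal to operated algebras.  The free ones constructed below are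
  instances by theorem \<open>free_higher_algebra\<close>.\<close>

locale higher_algebra =
  fixes A :: "('k::field, 'c, 'w) higher_alg"
  assumes cells: "operated_algebra (cell A n)"
    and src_hom: "src A n \<in> op_hom (cell A (Suc n)) (cell A n)"
    and tgt_hom: "tgt A n \<in> op_hom (cell A (Suc n)) (cell A n)"
    and idc_hom: "idc A n \<in> op_hom (cell A n) (cell A (Suc n))"
    and comp_hom: "k < n \<Longrightarrow> (\<lambda>(a, b). comp A n k a b) \<in> op_hom (composables A n k) (cell A n)"
    and glob_src: "a \<in> carrier (cell A (Suc (Suc n))) \<Longrightarrow>
      src A n (src A (Suc n) a) = src A n (tgt A (Suc n) a)"
    and glob_tgt: "a \<in> carrier (cell A (Suc (Suc n))) \<Longrightarrow>
      tgt A n (src A (Suc n) a) = tgt A n (tgt A (Suc n) a)"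
    and src_idc: "a \<in> carrier (cell A n) \<Longrightarrow> src A n (idc A n a) = a"
    and tgt_idc: "a \<in> carrier (cell A n) \<Longrightarrow> tgt A n (idc A n a) = a"
    and src_comp_top: "composable A (Suc n) n a b \<Longrightarrow> src A n (comp A (Suc n) n a b) = src A n a"
    and tgt_comp_top: "composable A (Suc n) n a b \<Longrightarrow> tgt A n (comp A (Suc n) n a b) = tgt A n b"
    and src_comp: "k < n \<Longrightarrow> composable A (Suc n) k a b \<Longrightarrow>
      src A n (comp A (Suc n) k a b) = comp A n k (src A n a) (src A n b)"
    and tgt_comp: "k < n \<Longrightarrow> composable A (Suc n) k a b \<Longrightarrow>
      tgt A n (comp A (Suc n) k a b) = comp A n k (tgt A n a) (tgt A n b)"
    and comp_assoc: "k < n \<Longrightarrow> composable A n k a b \<Longrightarrow> composable A n k b c \<Longrightarrow>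
      comp A n k (comp A n k a b) c = comp A n k a (comp A n k b c)"
    and comp_idl: "k < n \<Longrightarrow> a \<in> carrier (cell A n) \<Longrightarrow>
      comp A n k (up (idc A) k n (down (src A) k n a)) a = a"
    and comp_idr: "k < n \<Longrightarrow> a \<in> carrier (cell A n) \<Longrightarrow>
      comp A n k a (up (idc A) k n (down (tgt A) k n a)) = a"
    and idc_comp: "k < n \<Longrightarrow> composable A n k a b \<Longrightarrow>
      idc A n (comp A n k a b) = comp A (Suc n) k (idc A n a) (idc A n b)"
    and interchange: "j < k \<Longrightarrow> k < n \<Longrightarrow> composable A n k a b \<Longrightarrow> composable A n k c d \<Longrightarrow>
      composable A n j a c \<Longrightarrow> composable A n j b d \<Longrightarrow>
      comp A n j (comp A n k a b) (comp A n k c d) = comp A n k (comp A n j a c) (comp A n j b d)"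

definition parallel :: "('k, 'c, 'w) higher_alg \<Rightarrow> nat \<Rightarrow> 'c \<Rightarrow> 'c \<Rightarrow> bool" where
  "parallel A n f g \<longleftrightarrow> f \<in> carrier (cell A n) \<and> g \<in> carrier (cell A n) \<and>
     (\<forall>m. n = Suc m \<longrightarrow> src A m f = src A m g \<and> tgt A m f = tgt A m g)"


section \<open>Polygraphs and free higher algebras\<close>

text \<open>Cells of the free higher algebra are classes of expressions.  A \<open>0\<close>-cell expression
  is built from the elements \<open>Base p\<close> of the free operated algebra on \<open>S\<^sub>0\<close>, and \<open>Gen n g\<close> is
  an \<open>n\<close>-generator, \<open>n \<ge> 1\<close>.\<close>

datatype ('k::zero, 'z, 'w, 'g) cexp =
    Base "('z, 'w) mono \<Rightarrow>\<^sub>0 'k"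
  | Gen nat 'g
  | Idt "('k, 'z, 'w, 'g) cexp"
  | Sum "('k, 'z, 'w, 'g) cexp" "('k, 'z, 'w, 'g) cexp"
  | Scal 'k "('k, 'z, 'w, 'g) cexp"
  | Prod "('k, 'z, 'w, 'g) cexp" "('k, 'z, 'w, 'g) cexp"
  | Oper 'w "('k, 'z, 'w, 'g) cexp"
  | Comp nat "('k, 'z, 'w, 'g) cexp" "('k, 'z, 'w, 'g) cexp"

text \<open>\<open>gens0 S\<close> is \<open>S\<^sub>0\<close> and \<open>gens S n\<close> is \<open>S\<^sub>n\<close> for \<open>n \<ge> 1\<close>; \<open>bsrc S n\<close> and \<open>btgt S n\<close> are the
  source and target maps of \<open>S\<^sub>n\<close>, with values in \<open>(n-1)\<close>-cells, that is, classes of expressions.\<close>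

record ('k, 'z, 'w, 'g) polygraph =
  gens0 :: "'z set"
  gens :: "nat \<Rightarrow> 'g set"
  bsrc :: "nat \<Rightarrow> 'g \<Rightarrow> ('k, 'z, 'w, 'g) cexp set"
  btgt :: "nat \<Rightarrow> 'g \<Rightarrow> ('k, 'z, 'w, 'g) cexp set"

text \<open>Source and target of an \<open>(n+1)\<close>-cell expression; the representative chosen for the boundary
  of a generator does not matter, as expressions are only compared up to \<open>ceq\<close> below.\<close>

primrec esrc :: "('k::zero, 'z, 'w, 'g) polygraph \<Rightarrow> nat \<Rightarrow> ('k, 'z, 'w, 'g) cexp \<Rightarrow> ('k, 'z, 'w, 'g) cexp" where
  "esrc S n (Base p) = Base p"
| "esrc S n (Gen m g) = (SOME e. e \<in> bsrc S m g)"
| "esrc S n (Idt a) = a"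
| "esrc S n (Sum a b) = Sum (esrc S n a) (esrc S n b)"
| "esrc S n (Scal c a) = Scal c (esrc S n a)"
| "esrc S n (Prod a b) = Prod (esrc S n a) (esrc S n b)"
| "esrc S n (Oper \<tau> a) = Oper \<tau> (esrc S n a)"
| "esrc S n (Comp k a b) = (if k = n then esrc S n a else Comp k (esrc S n a) (esrc S n b))"

primrec etgt :: "('k::zero, 'z, 'w, 'g) polygraph \<Rightarrow> nat \<Rightarrow> ('k, 'z, 'w, 'g) cexp \<Rightarrow> ('k, 'z, 'w, 'g) cexp" where
  "etgt S n (Base p) = Base p"
| "etgt S n (Gen m g) = (SOME e. e \<in> btgt S m g)"
| "etgt S n (Idt a) = a"
| "etgt S n (Sum a b) = Sum (etgt S n a) (etgt S n b)"
| "etgt S n (Scal c a) = Scal c (etgt S n a)"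
| "etgt S n (Prod a b) = Prod (etgt S n a) (etgt S n b)"
| "etgt S n (Oper \<tau> a) = Oper \<tau> (etgt S n a)"
| "etgt S n (Comp k a b) = (if k = n then etgt S n b else Comp k (etgt S n a) (etgt S n b))"

abbreviation eid :: "nat \<Rightarrow> nat \<Rightarrow> ('k::zero, 'z, 'w, 'g) cexp \<Rightarrow> ('k, 'z, 'w, 'g) cexp" where
  "eid \<equiv> up (\<lambda>_. Idt)"

text \<open>The equations of higher algebras between \<open>n\<close>-cell expressions, without regard to
  whether both sides are well formed.\<close>

inductive eq_axiom ::
    "('k::field, 'z, 'w, 'g) polygraph \<Rightarrow> nat \<Rightarrow> ('k, 'z, 'w, 'g) cexp \<Rightarrow> ('k, 'z, 'w, 'g) cexp \<Rightarrow> bool"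
  for S n where
  add_assoc: "eq_axiom S n (Sum (Sum a b) c) (Sum a (Sum b c))"
| add_comm: "eq_axiom S n (Sum a b) (Sum b a)"
| add_zero: "eq_axiom S n (Sum a (eid 0 n (Base 0))) a"
| add_neg: "eq_axiom S n (Sum a (Scal (-1) a)) (eid 0 n (Base 0))"
| scal_add: "eq_axiom S n (Scal c (Sum a b)) (Sum (Scal c a) (Scal c b))"
| add_scal: "eq_axiom S n (Scal (c + d) a) (Sum (Scal c a) (Scal d a))"
| scal_scal: "eq_axiom S n (Scal (c * d) a) (Scal c (Scal d a))"
| scal_one: "eq_axiom S n (Scal 1 a) a"
| mult_assoc: "eq_axiom S n (Prod (Prod a b) c) (Prod a (Prod b c))"
| mult_onel: "eq_axiom S n (Prod (eid 0 n (Base 1)) a) a"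
| mult_oner: "eq_axiom S n (Prod a (eid 0 n (Base 1))) a"
| distl: "eq_axiom S n (Prod a (Sum b c)) (Sum (Prod a b) (Prod a c))"
| distr: "eq_axiom S n (Prod (Sum a b) c) (Sum (Prod a c) (Prod b c))"
| mult_scall: "eq_axiom S n (Prod (Scal c a) b) (Scal c (Prod a b))"
| mult_scalr: "eq_axiom S n (Prod a (Scal c b)) (Scal c (Prod a b))"
| oper_add: "eq_axiom S n (Oper \<tau> (Sum a b)) (Sum (Oper \<tau> a) (Oper \<tau> b))"
| oper_scal: "eq_axiom S n (Oper \<tau> (Scal c a)) (Scal c (Oper \<tau> a))"
| base_add: "eq_axiom S n (Sum (Base p) (Base q)) (Base (p + q))"
| base_scal: "eq_axiom S n (Scal c (Base p)) (Base (scale c p))"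
| base_mult: "eq_axiom S n (Prod (Base p) (Base q)) (Base (p * q))"
| base_oper: "eq_axiom S n (Oper \<tau> (Base p)) (Base (brk \<tau> p))"
| idt_add: "eq_axiom S n (Idt (Sum a b)) (Sum (Idt a) (Idt b))"
| idt_scal: "eq_axiom S n (Idt (Scal c a)) (Scal c (Idt a))"
| idt_mult: "eq_axiom S n (Idt (Prod a b)) (Prod (Idt a) (Idt b))"
| idt_oper: "eq_axiom S n (Idt (Oper \<tau> a)) (Oper \<tau> (Idt a))"
| idt_comp: "eq_axiom S n (Idt (Comp k a b)) (Comp k (Idt a) (Idt b))"
| comp_add: "eq_axiom S n (Comp k (Sum a a') (Sum b b')) (Sum (Comp k a b) (Comp k a' b'))"
| comp_scal: "eq_axiom S n (Comp k (Scal c a) (Scal c b)) (Scal c (Comp k a b))"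
| comp_mult: "eq_axiom S n (Comp k (Prod a a') (Prod b b')) (Prod (Comp k a b) (Comp k a' b'))"
| comp_oper: "eq_axiom S n (Comp k (Oper \<tau> a) (Oper \<tau> b)) (Oper \<tau> (Comp k a b))"
| comp_assoc: "eq_axiom S n (Comp k (Comp k a b) c) (Comp k a (Comp k b c))"
| comp_idl: "eq_axiom S n (Comp k (eid k n (down (esrc S) k n a)) a) a"
| comp_idr: "eq_axiom S n (Comp k a (eid k n (down (etgt S) k n a))) a"
| interchange: "j < k \<Longrightarrow>
    eq_axiom S n (Comp j (Comp k a b) (Comp k c d)) (Comp k (Comp j a c) (Comp j b d))"

text \<open>\<open>ceq S n a b\<close>: both expressions are well-formed \<open>n\<close>-cells and denote the same one.  It is
  the least family of partial equivalence relations compatible with the operations and containing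
  the equations above; \<open>ceq S n a a\<close> says that \<open>a\<close> is a well-formed \<open>n\<close>-cell.  Relations in
  dimension \<open>n\<close> involve generators of dimension at most \<open>n\<close> only, so the \<open>n\<close>-cells obtained are
  those of the free \<open>n\<close>-algebra on \<open>S\<^sub>0, \<dots>, S\<^sub>n\<close>.\<close>

inductive ceq ::
    "('k::field, 'z, 'w, 'g) polygraph \<Rightarrow> nat \<Rightarrow> ('k, 'z, 'w, 'g) cexp \<Rightarrow> ('k, 'z, 'w, 'g) cexp \<Rightarrow> bool"
  for S where
  base: "p \<in> carrier (free_opalg (gens0 S)) \<Longrightarrow> ceq S 0 (Base p) (Base p)"
| gen: "g \<in> gens S n \<Longrightarrow> ceq S n (Gen n g) (Gen n g)"
| idt: "ceq S n a a' \<Longrightarrow> ceq S (Suc n) (Idt a) (Idt a')"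
| sum: "ceq S n a a' \<Longrightarrow> ceq S n b b' \<Longrightarrow> ceq S n (Sum a b) (Sum a' b')"
| scal: "ceq S n a a' \<Longrightarrow> ceq S n (Scal c a) (Scal c a')"
| prod: "ceq S n a a' \<Longrightarrow> ceq S n b b' \<Longrightarrow> ceq S n (Prod a b) (Prod a' b')"
| oper: "ceq S n a a' \<Longrightarrow> ceq S n (Oper \<tau> a) (Oper \<tau> a')"
| comp: "k < n \<Longrightarrow> ceq S n a a' \<Longrightarrow> ceq S n b b' \<Longrightarrow>
    ceq S k (down (etgt S) k n a) (down (esrc S) k n b) \<Longrightarrow> ceq S n (Comp k a b) (Comp k a' b')"
| sym: "ceq S n a b \<Longrightarrow> ceq S n b a"
| trans: "ceq S n a b \<Longrightarrow> ceq S n b c \<Longrightarrow> ceq S n a c"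
| ax: "eq_axiom S n a b \<Longrightarrow> ceq S n a a \<Longrightarrow> ceq S n b b \<Longrightarrow> ceq S n a b"

definition ecls :: "('k::field, 'z, 'w, 'g) polygraph \<Rightarrow> nat \<Rightarrow> ('k, 'z, 'w, 'g) cexp \<Rightarrow> ('k, 'z, 'w, 'g) cexp set" where
  "ecls S n a = {b. ceq S n a b}"

definition free_cells ::
    "('k::field, 'z, 'w, 'g) polygraph \<Rightarrow> nat \<Rightarrow> ('k, ('k, 'z, 'w, 'g) cexp set, 'w) opalg" where
  "free_cells S n =
     \<lparr>carrier = {ecls S n a | a. ceq S n a a},
      mult = (\<lambda>A B. \<Union>a\<in>A. \<Union>b\<in>B. ecls S n (Prod a b)),
      one = ecls S n (eid 0 n (Base 1)),
      zero = ecls S n (eid 0 n (Base 0)),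
      add = (\<lambda>A B. \<Union>a\<in>A. \<Union>b\<in>B. ecls S n (Sum a b)),
      smult = (\<lambda>c A. \<Union>a\<in>A. ecls S n (Scal c a)),
      oper = (\<lambda>\<tau> A. \<Union>a\<in>A. ecls S n (Oper \<tau> a))\<rparr>"

text \<open>The free \<open>\<omega>\<close>-algebra on \<open>S\<close>.  The composite of cells that are not composable is the empty
  set, which is not a cell.\<close>

definition free_alg ::
    "('k::field, 'z, 'w, 'g) polygraph \<Rightarrow> ('k, ('k, 'z, 'w, 'g) cexp set, 'w) higher_alg" where
  "free_alg S =
     \<lparr>cell = free_cells S,
      src = (\<lambda>n A. \<Union>a\<in>A. ecls S n (esrc S n a)),
      tgt = (\<lambda>n A. \<Union>a\<in>A. ecls S n (etgt S n a)),
      idc = (\<lambda>n A. \<Union>a\<in>A. ecls S (Suc n) (Idt a)),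
      comp = (\<lambda>n k A B. \<Union>a\<in>A. \<Union>b\<in>B. ecls S n (Comp k a b))\<rparr>"

text \<open>Sources and targets are required to be \<open>undefined\<close> outside the generators, so that
  equality of polygraphs is equality of generators, sources and targets.\<close>

definition polygraph :: "('k::field, 'z, 'w, 'g) polygraph \<Rightarrow> bool" where
  "polygraph S \<longleftrightarrow> gens S 0 = {} \<and>
     (\<forall>n. bsrc S n \<in> extensional (gens S n) \<and> btgt S n \<in> extensional (gens S n) \<and>
        (\<forall>g\<in>gens S n. parallel (free_alg S) (n - 1) (bsrc S n g) (btgt S n g)))"

text \<open>\<open>pcell S p\<close> is the \<open>0\<close>-cell given by an element of the free operated algebra on \<open>S\<^sub>0\<close>,
  and \<open>gcell S n g\<close> the \<open>n\<close>-cell given by an \<open>n\<close>-generator.\<close>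

definition pcell :: "('k::field, 'z, 'w, 'g) polygraph \<Rightarrow> ('k, 'z, 'w) opoly \<Rightarrow> ('k, 'z, 'w, 'g) cexp set" where
  "pcell S p = ecls S 0 (Base p)"

definition gcell :: "('k::field, 'z, 'w, 'g) polygraph \<Rightarrow> nat \<Rightarrow> 'g \<Rightarrow> ('k, 'z, 'w, 'g) cexp set" where
  "gcell S n g = ecls S n (Gen n g)"

definition pres_ideal :: "('k::field, 'z, 'w, 'g) polygraph \<Rightarrow> ('k, 'z, 'w, 'g) cexp set set" where
  "pres_ideal S = gen_op_ideal (free_cells S 0)
     {bsrc S 1 g \<ominus>\<^bsub>free_cells S 0\<^esub> btgt S 1 g | g. g \<in> gens S 1}"

definition presented ::
    "('k::field, 'z, 'w, 'g) polygraph \<Rightarrow> ('k, ('k, 'z, 'w, 'g) cexp set set, 'w) opalg" where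
  "presented S = op_quot (free_cells S 0) (pres_ideal S)"

text \<open>The projection of an \<open>n\<close>-cell; all cells of \<open>presented S\<close> of positive dimension are
  identities and are identified with \<open>0\<close>-cells.\<close>

definition proj ::
    "('k::field, 'z, 'w, 'g) polygraph \<Rightarrow> nat \<Rightarrow> ('k, 'z, 'w, 'g) cexp set \<Rightarrow> ('k, 'z, 'w, 'g) cexp set set" where
  "proj S n a = pres_ideal S +>\<^bsub>free_cells S 0\<^esub> down (src (free_alg S)) 0 n a"

definition polygraphic_resolution ::
    "('k::field, 'z, 'w, 'g) polygraph \<Rightarrow> ('k, 'c, 'w) opalg \<Rightarrow> bool" where
  "polygraphic_resolution S B \<longleftrightarrow> polygraph S \<and> op_iso (presented S) B \<and>
     (\<forall>n\<ge>1. \<forall>f g. parallel (free_alg S) n f g \<longrightarrow>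
        (\<exists>h\<in>carrier (cell (free_alg S) (Suc n)).
           src (free_alg S) n h = f \<and> tgt (free_alg S) n h = g))"


section \<open>Contractions\<close>

text \<open>\<open>\<iota> n\<close> is the component of the section on \<open>n\<close>-cells.\<close>

definition unital_section ::
    "('k::field, 'z, 'w, 'g) polygraph \<Rightarrow> (nat \<Rightarrow> ('k, 'z, 'w, 'g) cexp set set \<Rightarrow> ('k, 'z, 'w, 'g) cexp set) \<Rightarrow> bool" where
  "unital_section S \<iota> \<longleftrightarrow> (let A = free_alg S; Q = presented S in
     (\<forall>n. \<iota> n \<in> linear_hom Q (cell A n) \<and> \<iota> n \<one>\<^bsub>Q\<^esub> = \<one>\<^bsub>cell A n\<^esub>) \<and>
     (\<forall>n. \<forall>x\<in>carrier Q. proj S n (\<iota> n x) = x \<and> src A n (\<iota> (Suc n) x) = \<iota> n x \<and>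
        tgt A n (\<iota> (Suc n) x) = \<iota> n x \<and> \<iota> (Suc n) x = idc A n (\<iota> n x)))"

text \<open>For an \<open>n\<close>-cell \<open>a\<close>, with \<open>\<sigma>\<close> written as a family of maps from \<open>n\<close>-cells to \<open>(n+1)\<close>-cells,
  \<open>contr_src A \<sigma> n j a\<close> is \<open>a \<star>\<^sub>0 \<sigma>\<^bsub>t\<^sub>0(a)\<^esub> \<star>\<^sub>1 \<dots> \<star>\<^bsub>j-1\<^esub> \<sigma>\<^bsub>t\<^bsub>j-1\<^esub>(a)\<^esub>\<close>, bracketed to the left, and
  \<open>contr_tgt A \<sigma> n j a r\<close> is \<open>\<sigma>\<^bsub>s\<^bsub>j-1\<^esub>(a)\<^esub> \<star>\<^bsub>j-1\<^esub> \<dots> \<star>\<^sub>1 \<sigma>\<^bsub>s\<^sub>0(a)\<^esub> \<star>\<^sub>0 r\<close>, bracketed to the right.\<close>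

primrec contr_src :: "('k, 'c, 'w) higher_alg \<Rightarrow> (nat \<Rightarrow> 'c \<Rightarrow> 'c) \<Rightarrow> nat \<Rightarrow> nat \<Rightarrow> 'c \<Rightarrow> 'c" where
  "contr_src A \<sigma> n 0 a = a"
| "contr_src A \<sigma> n (Suc j) a = comp A n j (contr_src A \<sigma> n j a)
     (up (idc A) (Suc j) n (\<sigma> j (down (tgt A) j n a)))"

primrec contr_tgt :: "('k, 'c, 'w) higher_alg \<Rightarrow> (nat \<Rightarrow> 'c \<Rightarrow> 'c) \<Rightarrow> nat \<Rightarrow> nat \<Rightarrow> 'c \<Rightarrow> 'c \<Rightarrow> 'c" where
  "contr_tgt A \<sigma> n 0 a r = r"
| "contr_tgt A \<sigma> n (Suc j) a r = comp A n j
     (up (idc A) (Suc j) n (\<sigma> j (down (src A) j n a))) (contr_tgt A \<sigma> n j a r)"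

definition contraction ::
    "('k::field, 'z, 'w, 'g) polygraph \<Rightarrow> (nat \<Rightarrow> ('k, 'z, 'w, 'g) cexp set set \<Rightarrow> ('k, 'z, 'w, 'g) cexp set) \<Rightarrow>
     (nat \<Rightarrow> ('k, 'z, 'w, 'g) cexp set \<Rightarrow> ('k, 'z, 'w, 'g) cexp set) \<Rightarrow> bool" where
  "contraction S \<iota> \<sigma> \<longleftrightarrow> (let A = free_alg S in
     (\<forall>n. \<sigma> n \<in> linear_hom (cell A n) (cell A (Suc n))) \<and>
     (\<forall>n. \<forall>a\<in>carrier (cell A n).
        src A n (\<sigma> n a) = contr_src A \<sigma> n n a \<and>
        tgt A n (\<sigma> n a) = contr_tgt A \<sigma> n n a (\<iota> n (proj S n a)) \<and>
        \<sigma> (Suc n) (idc A n a) = idc A (Suc n) (\<sigma> n a) \<and>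
        \<sigma> (Suc n) (\<sigma> n a) = idc A (Suc n) (\<sigma> n a)) \<and>
     (\<forall>n. \<forall>x\<in>carrier (presented S). \<sigma> n (\<iota> n x) = idc A n (\<iota> n x)))"

definition right_bracketed ::
    "('k::field, 'z, 'w, 'g) polygraph \<Rightarrow> (nat \<Rightarrow> ('k, 'z, 'w, 'g) cexp set set \<Rightarrow> ('k, 'z, 'w, 'g) cexp set) \<Rightarrow>
     (nat \<Rightarrow> ('k, 'z, 'w, 'g) cexp set \<Rightarrow> ('k, 'z, 'w, 'g) cexp set) \<Rightarrow> bool" where
  "right_bracketed S \<iota> \<sigma> \<longleftrightarrow> (let A = free_alg S; lift = up (idc A) in
     (\<forall>n. \<forall>f\<in>carrier (cell A n). \<forall>g\<in>carrier (cell A n).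
        let a = down (src A) 0 n f; b = down (src A) 0 n g; b' = \<iota> 0 (proj S 0 b) in
        \<sigma> n (f \<otimes>\<^bsub>cell A n\<^esub> g) =
          comp A (Suc n) 0 (lift 0 (Suc n) a \<otimes>\<^bsub>cell A (Suc n)\<^esub> \<sigma> n g)
                           (\<sigma> n (f \<otimes>\<^bsub>cell A n\<^esub> lift 0 n b'))) \<and>
     (\<forall>n \<tau>. \<forall>h\<in>carrier (cell A n). \<forall>v\<in>omonoid (gens0 S).
        let c = down (src A) 0 n h; c' = \<iota> 0 (proj S 0 c); v' = pcell S (mon v) in
        \<sigma> n (oper (cell A n) \<tau> h \<otimes>\<^bsub>cell A n\<^esub> lift 0 n v') =
          comp A (Suc n) 0 (oper (cell A (Suc n)) \<tau> (\<sigma> n h) \<otimes>\<^bsub>cell A (Suc n)\<^esub> lift 0 (Suc n) v')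
                           (lift 1 (Suc n) (\<sigma> 0 (oper (cell A 0) \<tau> c' \<otimes>\<^bsub>cell A 0\<^esub> v')))))"


section \<open>The polygraph of a reduced convergent 1-polygraph\<close>

text \<open>The tuple \<open>u\<^sub>1|\<dots>|u\<^sub>n\<close> is the list \<open>[u\<^sub>1, \<dots>, u\<^sub>n]\<close>.  The definitions below are meaningful
  for reduced convergent \<open>X\<close> only.\<close>

definition min_reducible :: "('k::field, 'z, 'w, 'r) polygraph1 \<Rightarrow> ('z, 'w) mono \<Rightarrow> bool" where
  "min_reducible X u \<longleftrightarrow> u \<in> reducible_monos X \<and> (\<forall>v. strict_prefix v u \<longrightarrow> v \<in> Nf X)"

definition sq_heads :: "('k::field, 'z, 'w, 'r) polygraph1 \<Rightarrow> ('z, 'w) mono set" where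
  "sq_heads X = {[Atom x] | x. x \<in> zgens X} \<union> {[Br \<tau> u] | \<tau> u. [Br \<tau> u] \<in> Nf X}"

definition sq_gens :: "('k::field, 'z, 'w, 'r) polygraph1 \<Rightarrow> nat \<Rightarrow> ('z, 'w) mono list set" where
  "sq_gens X n =
     (if n = 0 then {}
      else if n = 1 then
        {[u1, u2] | u1 u2. u1 \<in> sq_heads X \<and> u2 \<in> Nf X \<and> min_reducible X (u1 @ u2)} \<union>
        {[[], [Br \<tau> u]] | \<tau> u. u \<in> Nf X \<and> min_reducible X [Br \<tau> u]}
      else
        {us. length us = n + 1 \<and> us ! 0 \<in> sq_heads X \<and> (\<forall>i. 1 \<le> i \<and> i \<le> n \<longrightarrow> us ! i \<in> Nf X) \<and>
             (\<forall>i<n. min_reducible X (us ! i @ us ! (i + 1)))})"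

text \<open>A \<open>1\<close>-tuple \<open>[u]\<close> stands for the monomial \<open>u\<close>, a longer tuple for a generator.\<close>

definition sq_cell ::
    "('k::field, 'z, 'w, ('z, 'w) mono list) polygraph \<Rightarrow> ('z, 'w) mono list \<Rightarrow>
     ('k, 'z, 'w, ('z, 'w) mono list) cexp set" where
  "sq_cell S us = (if length us = 1 then pcell S (mon (hd us)) else gcell S (length us - 1) us)"

definition rmult ::
    "('k::field, 'z, 'w, 'g) polygraph \<Rightarrow> nat \<Rightarrow> ('k, 'z, 'w, 'g) cexp set \<Rightarrow> ('z, 'w) mono \<Rightarrow>
     ('k, 'z, 'w, 'g) cexp set" where
  "rmult S n f v = f \<otimes>\<^bsub>free_cells S n\<^esub> up (idc (free_alg S)) 0 n (pcell S (mon v))"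

definition sq_structure ::
    "('k::field, 'z, 'w, 'r) polygraph1 \<Rightarrow> ('k, 'z, 'w, ('z, 'w) mono list) polygraph \<Rightarrow> bool" where
  "sq_structure X S \<longleftrightarrow> polygraph S \<and> gens0 S = zgens X \<and> gens S = sq_gens X \<and>
     (\<exists>\<iota> \<sigma>. unital_section S \<iota> \<and>
        (\<forall>u\<in>omonoid (zgens X). \<iota> 0 (proj S 0 (pcell S (mon u))) = pcell S (nf X (mon u))) \<and>
        contraction S \<iota> \<sigma> \<and> right_bracketed S \<iota> \<sigma> \<and>
        (\<forall>n us. \<forall>v\<in>Nf X.
           (if n = 0 then \<exists>u\<in>sq_heads X. us = [u] else us \<in> sq_gens X n) \<longrightarrow>
             (us @ [v] \<in> sq_gens X (Suc n) \<longrightarrow>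
                \<sigma> n (rmult S n (sq_cell S us) v) = gcell S (Suc n) (us @ [v])) \<and>
             (last us @ v \<in> Nf X \<longrightarrow>
                \<sigma> n (rmult S n (sq_cell S us) v) =
                  idc (free_alg S) n (rmult S n (sq_cell S us) v))) \<and>
        (\<forall>\<tau>. \<forall>u\<in>Nf X. [Br \<tau> u] \<in> reducible_monos X \<longrightarrow>
             \<sigma> 0 (pcell S (mon [Br \<tau> u])) = gcell S 1 [[], [Br \<tau> u]] \<and>
             (\<forall>v\<in>Nf X. \<sigma> 1 (rmult S 1 (gcell S 1 [[], [Br \<tau> u]]) v) =
                idc (free_alg S) 1 (rmult S 1 (gcell S 1 [[], [Br \<tau> u]]) v))))"

text \<open>As the unique structure is meant, nothing can be derived about \<open>Sq X\<close> without proving that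
  \<open>sq_structure X\<close> has exactly one solution.\<close>

definition Sq ::
    "('k::field, 'z, 'w, 'r) polygraph1 \<Rightarrow> ('k, 'z, 'w, ('z, 'w) mono list) polygraph" where
  "Sq X = (THE S. sq_structure X S)"


section \<open>Differential algebras\<close>

datatype diff_op = Diff

abbreviation dop :: "('z, diff_op) mono \<Rightarrow> ('z, diff_op) mono" where
  "dop u \<equiv> [Br Diff u]"

definition Dtheta :: "'z set \<Rightarrow> ('z, diff_op) mono set" where
  "Dtheta Z = {(dop ^^ i) [Atom x] | i x. x \<in> Z}"

definition Dtheta_star :: "'z set \<Rightarrow> ('z, diff_op) mono set" where
  "Dtheta_star Z = concat ` lists (Dtheta Z)"

definition diff_rels :: "'z set \<Rightarrow> 'k::field \<Rightarrow> ('k, 'z, diff_op) opoly set" where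
  "diff_rels Z lam = (let D = brk Diff; A = carrier (free_opalg Z) in
     {D (a * b) - (D a * b + a * D b + scale lam (D a * D b)) | a b. a \<in> A \<and> b \<in> A} \<union> {D 1})"

definition free_diff_alg ::
    "'z set \<Rightarrow> 'k::field \<Rightarrow> ('k, ('k, 'z, diff_op) opoly set, diff_op) opalg" where
  "free_diff_alg Z lam = op_quot (free_opalg Z) (gen_op_ideal (free_opalg Z) (diff_rels Z lam))"

text \<open>The rules are indexed by the lists \<open>[u\<^sub>1, \<dots>, u\<^sub>n]\<close> with \<open>n \<noteq> 1\<close>; the empty list gives
  the rule \<open>D(1) \<rightarrow> 0\<close>.\<close>

definition diff_polygraph ::
    "'z set \<Rightarrow> 'k::field \<Rightarrow> ('k, 'z, diff_op, ('z, diff_op) mono list) polygraph1" where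
  "diff_polygraph Z lam =
     \<lparr>zgens = Z,
      rules = insert [] {us \<in> lists (Dtheta Z). length us \<ge> 2},
      lhs = (\<lambda>us. dop (concat us)),
      rhs = (\<lambda>us. \<Sum>k = 1..length us. \<Sum>I | I \<subseteq> {..<length us} \<and> card I = k.
        Poly_Mapping.single
          (concat (map (\<lambda>i. if i \<in> I then dop (us ! i) else us ! i) [0..<length us]))
          (lam ^ (k - 1)))\<rparr>"

section \<open>The free higher algebra is a higher algebra\<close>

lemma ceq_reflL: "ceq S n a b \<Longrightarrow> ceq S n a a"
  by (meson ceq.sym ceq.trans)

lemma ceq_reflR: "ceq S n a b \<Longrightarrow> ceq S n b b"
  by (meson ceq.sym ceq.trans)

lemma esrc_eid [simp]: "esrc S n (eid 0 (Suc n) (Base p)) = eid 0 n (Base p)"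
  and etgt_eid [simp]: "etgt S n (eid 0 (Suc n) (Base p)) = eid 0 n (Base p)"
  by simp_all

lemma down_top [simp]: "down f n n a = a"
  by (cases n) auto

lemma up_bot [simp]: "up f n n a = a"
  by (cases n) auto

definition bcong :: "('k::field, 'z, 'w, 'g) polygraph \<Rightarrow> nat \<Rightarrow> ('k, 'z, 'w, 'g) cexp \<Rightarrow> ('k, 'z, 'w, 'g) cexp \<Rightarrow> bool" where
  "bcong S n a b \<longleftrightarrow> (case n of 0 \<Rightarrow> True | Suc m \<Rightarrow>
     ceq S m (esrc S m a) (esrc S m b) \<and> ceq S m (etgt S m a) (etgt S m b))"

definition glob :: "('k::field, 'z, 'w, 'g) polygraph \<Rightarrow> nat \<Rightarrow> ('k, 'z, 'w, 'g) cexp \<Rightarrow> bool" where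
  "glob S n a \<longleftrightarrow> (case n of 0 \<Rightarrow> True | Suc 0 \<Rightarrow> True | Suc (Suc m) \<Rightarrow>
     ceq S m (esrc S m (esrc S (Suc m) a)) (esrc S m (etgt S (Suc m) a)) \<and>
     ceq S m (etgt S m (esrc S (Suc m) a)) (etgt S m (etgt S (Suc m) a)))"

lemma bcong_simps [simp]: "bcong S 0 a b"
  "bcong S (Suc m) a b \<longleftrightarrow> ceq S m (esrc S m a) (esrc S m b) \<and> ceq S m (etgt S m a) (etgt S m b)"
  by (auto simp: bcong_def)

lemma glob_simps [simp]: "glob S 0 a" "glob S (Suc 0) a"
  "glob S (Suc (Suc m)) a \<longleftrightarrow> 
     ceq S m (esrc S m (esrc S (Suc m) a)) (esrc S m (etgt S (Suc m) a)) \<and>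
     ceq S m (etgt S m (esrc S (Suc m) a)) (etgt S m (etgt S (Suc m) a))"
  by (auto simp: glob_def)

lemma down_cong_aux:
  assumes "\<And>m a b. m \<le> n \<Longrightarrow> ceq S m a b \<Longrightarrow> bcong S m a b" and "ceq S n a b" and "k \<le> n"
  shows "ceq S k (down (esrc S) k n a) (down (esrc S) k n b) \<and>
         ceq S k (down (etgt S) k n a) (down (etgt S) k n b)"
  using assms
proof (induction n arbitrary: a b)
  case (Suc n)
  show ?case
  proof (cases "k = Suc n")
    case False
    with Suc.prems have kn: "k \<le> n" by simp
    have "bcong S (Suc n) a b" using Suc.prems by blast
    then show ?thesis using Suc.IH[of "esrc S n a" "esrc S n b"] Suc.IH[of "etgt S n a" "etgt S n b"] kn Suc.prems(1)
      by simp
  qed (use Suc.prems in simp)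
qed simp

lemma down_glob_aux:
  assumes "\<And>m a b. m < Suc n \<Longrightarrow> ceq S m a b \<Longrightarrow> bcong S m a b"
    and "glob S (Suc n) a" and "k < n"
  shows "ceq S k (down (esrc S) k n (esrc S n a)) (down (esrc S) k n (etgt S n a)) \<and>
         ceq S k (down (etgt S) k n (esrc S n a)) (down (etgt S) k n (etgt S n a))"
proof -
  obtain l where n: "n = Suc l" using assms(3) by (cases n) auto
  have kl: "k \<le> l" using assms(3) n by simp
  have g: "glob S (Suc (Suc l)) a" using assms(2) n by simp
  have 1: "ceq S k (down (esrc S) k l (esrc S l (esrc S n a))) (down (esrc S) k l (esrc S l (etgt S n a)))"
    using down_cong_aux[of l S _ _ k] assms(1) g kl n by auto
  have 2: "ceq S k (down (etgt S) k l (etgt S l (esrc S n a))) (down (etgt S) k l (etgt S l (etgt S n a)))"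
    using down_cong_aux[of l S _ _ k] assms(1) g kl n by auto
  show ?thesis using 1 2 kl n by simp
qed

lemma SOME_cell:
  assumes "X \<in> carrier (free_cells S n)"
  shows "ceq S n (SOME e. e \<in> X) (SOME e. e \<in> X) \<and> ecls S n (SOME e. e \<in> X) = X"
proof -
  obtain e where e: "ceq S n e e" "X = ecls S n e" using assms by (auto simp: free_cells_def)
  then have "e \<in> X" by (simp add: ecls_def)
  then have "(SOME e. e \<in> X) \<in> X" by (rule someI)
  then have "ceq S n e (SOME e. e \<in> X)" using e by (simp add: ecls_def)
  then show ?thesis using e(2) unfolding ecls_def by (auto intro: ceq.sym ceq.trans ceq_reflR)
qed

lemma ecls_eq: "ceq S n a b \<Longrightarrow> ecls S n a = ecls S n b"
  unfolding ecls_def by (auto intro: ceq.sym ceq.trans)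

lemma ecls_eqD: "ceq S n a a \<Longrightarrow> ecls S n a = ecls S n b \<Longrightarrow> ceq S n a b"
  unfolding ecls_def by (metis ceq.sym mem_Collect_eq)


lemma src_cls:
  assumes "\<And>a b. ceq S (Suc n) a b \<Longrightarrow> bcong S (Suc n) a b" and "ceq S (Suc n) a a"
  shows "src (free_alg S) n (ecls S (Suc n) a) = ecls S n (esrc S n a)"
    and "tgt (free_alg S) n (ecls S (Suc n) a) = ecls S n (etgt S n a)"
proof -
  have *: "ecls S n (esrc S n b) = ecls S n (esrc S n a)" "ecls S n (etgt S n b) = ecls S n (etgt S n a)"
    if "b \<in> ecls S (Suc n) a" for b
    using assms(1)[of a b] that by (auto simp: ecls_def[of S "Suc n"] ecls_eq)
  have a: "a \<in> ecls S (Suc n) a" using assms(2) by (simp add: ecls_def)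
  have "(\<Union>b\<in>ecls S (Suc n) a. ecls S n (esrc S n b)) = ecls S n (esrc S n a)"
    "(\<Union>b\<in>ecls S (Suc n) a. ecls S n (etgt S n b)) = ecls S n (etgt S n a)"
    using * a by blast+
  then show "src (free_alg S) n (ecls S (Suc n) a) = ecls S n (esrc S n a)"
    and "tgt (free_alg S) n (ecls S (Suc n) a) = ecls S n (etgt S n a)"
    by (simp_all add: free_alg_def)
qed

primrec okc :: "('k::zero, 'z, 'w, 'g) cexp \<Rightarrow> nat \<Rightarrow> bool" where
  "okc (Base p) n \<longleftrightarrow> True"
| "okc (Gen m g) n \<longleftrightarrow> True"
| "okc (Idt a) n \<longleftrightarrow> 0 < n \<and> okc a (n - 1)"
| "okc (Sum a b) n \<longleftrightarrow> okc a n \<and> okc b n"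
| "okc (Scal c a) n \<longleftrightarrow> okc a n"
| "okc (Prod a b) n \<longleftrightarrow> okc a n \<and> okc b n"
| "okc (Oper \<tau> a) n \<longleftrightarrow> okc a n"
| "okc (Comp k a b) n \<longleftrightarrow> k < n \<and> okc a n \<and> okc b n"

lemma ceq_okc: "ceq S n a b \<Longrightarrow> okc a n \<and> okc b n"
  by (induction rule: ceq.induct) auto

lemma down_etgt_eid: "k \<le> n \<Longrightarrow> down (etgt S) k n (eid k n d) = d"
  by (induction n) (auto simp: le_Suc_eq)

lemma down_esrc_eid: "k \<le> n \<Longrightarrow> down (esrc S) k n (eid k n d) = d"
  by (induction n) (auto simp: le_Suc_eq)

lemma eid_cong: "k \<le> n \<Longrightarrow> ceq S k d d' \<Longrightarrow> ceq S n (eid k n d) (eid k n d')"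
  by (induction n) (auto simp: le_Suc_eq intro: ceq.idt)


lemma ax_esrc:
  assumes "eq_axiom S (Suc m) a b" "okc a (Suc m)" "okc b (Suc m)"
  shows "esrc S m a = esrc S m b \<or> eq_axiom S m (esrc S m a) (esrc S m b) \<or> 
    (\<exists>k<m. a = Comp k b (eid k (Suc m) (down (etgt S) k (Suc m) b)))"
  using assms(1)
proof cases
  case (comp_idl k)
  then have "k \<le> m" using assms by simp
  then show ?thesis unfolding comp_idl by (cases "k = m") (simp_all add: eq_axiom.comp_idl)
next
  case (comp_idr k)
  then have "k \<le> m" using assms by simp
  then show ?thesis unfolding comp_idr by (cases "k = m") (simp_all)
next
  case idt_comp
  then show ?thesis using assms by simp
qed (use assms(2,3) in \<open>simp add: eq_axiom.intros; fail\<close>)+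

lemma ax_etgt:
  assumes "eq_axiom S (Suc m) a b" "okc a (Suc m)" "okc b (Suc m)"
  shows "etgt S m a = etgt S m b \<or> eq_axiom S m (etgt S m a) (etgt S m b) \<or> 
    (\<exists>k<m. a = Comp k (eid k (Suc m) (down (esrc S) k (Suc m) b)) b)"
  using assms(1)
proof cases
  case (comp_idl k)
  then have "k \<le> m" using assms by simp
  then show ?thesis unfolding comp_idl by (cases "k = m") (simp_all)
next
  case (comp_idr k)
  then have "k \<le> m" using assms by simp
  then show ?thesis unfolding comp_idr by (cases "k = m") (simp_all add: eq_axiom.comp_idr)
next
  case idt_comp
  then show ?thesis using assms by simp
qed (use assms(2,3) in \<open>simp add: eq_axiom.intros; fail\<close>)+

lemma ax_bcong:
  assumes "eq_axiom S (Suc m) a b" "ceq S (Suc m) a a" "ceq S (Suc m) b b"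
    "bcong S (Suc m) a a" "bcong S (Suc m) b b" "glob S (Suc m) b"
    "\<And>n a b. n < Suc m \<Longrightarrow> ceq S n a b \<Longrightarrow> bcong S n a b"
  shows "bcong S (Suc m) a b"
proof -
  have ok: "okc a (Suc m)" "okc b (Suc m)" using assms ceq_okc by blast+
  have ws: "ceq S m (esrc S m a) (esrc S m a)" "ceq S m (esrc S m b) (esrc S m b)"
    and wt: "ceq S m (etgt S m a) (etgt S m a)" "ceq S m (etgt S m b) (etgt S m b)"
    using assms(4,5) by simp_all
  have "ceq S m (esrc S m a) (esrc S m b)" using ax_esrc[OF assms(1) ok]
  proof (elim disjE exE conjE)
    fix k assume k: "k < m" and a: "a = Comp k b (eid k (Suc m) (down (etgt S) k (Suc m) b))"
    let ?d = "down (etgt S) k m (etgt S m b)" and ?d' = "down (etgt S) k m (esrc S m b)"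
    have d: "ceq S k ?d' ?d" using down_glob_aux[OF assms(7) assms(6) k] by simp
    have *: "ceq S m (Comp k (esrc S m b) (eid k m ?d')) (Comp k (esrc S m b) (eid k m ?d))"
      using k d ws(2) by (intro ceq.comp eid_cong) (simp_all add: down_esrc_eid ceq_reflL[OF d])
    have "ceq S m (Comp k (esrc S m b) (eid k m ?d')) (esrc S m b)"
      by (rule ceq.ax[OF eq_axiom.comp_idr ceq_reflL[OF *] ws(2)])
    with * have "ceq S m (Comp k (esrc S m b) (eid k m ?d)) (esrc S m b)"
      by (meson ceq.sym ceq.trans)
    then show ?thesis using k a by simp
  qed (use ws ceq.ax in \<open>simp_all\<close>)
  moreover have "ceq S m (etgt S m a) (etgt S m b)" using ax_etgt[OF assms(1) ok]
  proof (elim disjE exE conjE)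
    fix k assume k: "k < m" and a: "a = Comp k (eid k (Suc m) (down (esrc S) k (Suc m) b)) b"
    let ?d = "down (esrc S) k m (esrc S m b)" and ?d' = "down (esrc S) k m (etgt S m b)"
    have d: "ceq S k ?d ?d'" using down_glob_aux[OF assms(7) assms(6) k] by simp
    have *: "ceq S m (Comp k (eid k m ?d) (etgt S m b)) (Comp k (eid k m ?d') (etgt S m b))"
      using k d wt(2) by (intro ceq.comp eid_cong) (simp_all add: down_etgt_eid)
    have "ceq S m (Comp k (eid k m ?d') (etgt S m b)) (etgt S m b)"
      by (rule ceq.ax[OF eq_axiom.comp_idl ceq_reflR[OF *] wt(2)])
    with * have "ceq S m (Comp k (eid k m ?d) (etgt S m b)) (etgt S m b)"
      by (meson ceq.trans)
    then show ?thesis using k a by simp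
  qed (use wt ceq.ax in \<open>simp_all\<close>)
  ultimately show ?thesis by simp
qed


lemma parallelD:
  assumes "polygraph S" "g \<in> gens S (Suc m)"
    and "\<And>n a b. n < Suc m \<Longrightarrow> ceq S n a b \<Longrightarrow> bcong S n a b"
  shows "ceq S m (esrc S m (Gen (Suc m) g)) (esrc S m (Gen (Suc m) g))"
    and "ceq S m (etgt S m (Gen (Suc m) g)) (etgt S m (Gen (Suc m) g))"
    and "glob S (Suc m) (Gen (Suc m) g)"
proof -
  let ?s = "bsrc S (Suc m) g" and ?t = "btgt S (Suc m) g"
  have p: "parallel (free_alg S) m ?s ?t" 
  proof -
    have "\<forall>g\<in>gens S (Suc m). parallel (free_alg S) (Suc m - 1) (bsrc S (Suc m) g) (btgt S (Suc m) g)"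
      using assms(1) unfolding polygraph_def by blast
    then show ?thesis using assms(2) by simp
  qed
  then have c: "?s \<in> carrier (free_cells S m)" "?t \<in> carrier (free_cells S m)"
    by (auto simp: parallel_def free_alg_def)
  let ?a = "SOME e. e \<in> ?s" and ?b = "SOME e. e \<in> ?t"
  have ab: "ceq S m ?a ?a" "ecls S m ?a = ?s" "ceq S m ?b ?b" "ecls S m ?b = ?t"
    using SOME_cell c by blast+
  show "ceq S m (esrc S m (Gen (Suc m) g)) (esrc S m (Gen (Suc m) g))"
    "ceq S m (etgt S m (Gen (Suc m) g)) (etgt S m (Gen (Suc m) g))" using ab by simp_all
  show "glob S (Suc m) (Gen (Suc m) g)"
  proof (cases m)
    case (Suc l)
    have w: "ceq S l (esrc S l ?a) (esrc S l ?a)" "ceq S l (etgt S l ?a) (etgt S l ?a)"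
      using assms(3)[OF _ ab(1)] unfolding Suc by simp_all
    have bc: "\<And>a b. ceq S (Suc l) a b \<Longrightarrow> bcong S (Suc l) a b" using assms(3) Suc by blast
    have "src (free_alg S) l ?s = src (free_alg S) l ?t" "tgt (free_alg S) l ?s = tgt (free_alg S) l ?t"
      using p Suc unfolding parallel_def by blast+
    then have "ecls S l (esrc S l ?a) = ecls S l (esrc S l ?b)" "ecls S l (etgt S l ?a) = ecls S l (etgt S l ?b)"
      using src_cls[OF bc, of ?a] src_cls[OF bc, of ?b] ab unfolding Suc by simp_all
    then have "ceq S l (esrc S l ?a) (esrc S l ?b)" "ceq S l (etgt S l ?a) (etgt S l ?b)"
      using ecls_eqD w by blast+
    then show ?thesis using Suc by simp
  qed simp
qed

lemma nat_cases3: "(n = 0 \<Longrightarrow> P) \<Longrightarrow> (n = Suc 0 \<Longrightarrow> P) \<Longrightarrow> (\<And>m. n = Suc (Suc m) \<Longrightarrow> P) \<Longrightarrow> P"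
  by (metis not0_implies_Suc)

lemma comp_glob_step:
  assumes IHm: "\<And>n a b. n \<le> m \<Longrightarrow> ceq S n a b \<Longrightarrow> bcong S n a b \<and> glob S n a" and km: "k \<le> m"
    and x: "bcong S (Suc m) x x" "glob S (Suc m) x" and y: "bcong S (Suc m) y y" "glob S (Suc m) y"
    and C: "ceq S k (down (etgt S) k m (etgt S m x)) (down (esrc S) k m (esrc S m y))"
  shows "glob S (Suc m) (Comp k x y)"
    and "k < m \<Longrightarrow> ceq S k (down (etgt S) k m (esrc S m x)) (down (esrc S) k m (esrc S m y)) \<and>
      ceq S k (down (etgt S) k m (etgt S m x)) (down (esrc S) k m (etgt S m y))"
proof -
  note tr = ceq.trans and sy = ceq.sym
  have bm: "\<And>n a b. n < Suc m \<Longrightarrow> ceq S n a b \<Longrightarrow> bcong S n a b" using IHm by simp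
  show 2: "ceq S k (down (etgt S) k m (esrc S m x)) (down (esrc S) k m (esrc S m y)) \<and>
    ceq S k (down (etgt S) k m (etgt S m x)) (down (esrc S) k m (etgt S m y))" if "k < m"
  proof
    note gx = down_glob_aux[OF bm x(2) that] and gy = down_glob_aux[OF bm y(2) that]
    show "ceq S k (down (etgt S) k m (esrc S m x)) (down (esrc S) k m (esrc S m y))"
      by (rule tr[OF gx[THEN conjunct2] C])
    show "ceq S k (down (etgt S) k m (etgt S m x)) (down (esrc S) k m (etgt S m y))"
      by (rule tr[OF C gy[THEN conjunct1]])
  qed
  show "glob S (Suc m) (Comp k x y)"
  proof (cases m)
    case (Suc l)
    have wx: "ceq S m (esrc S m x) (esrc S m x)" "ceq S m (etgt S m x) (etgt S m x)" 
      and wy: "ceq S m (esrc S m y) (esrc S m y)" "ceq S m (etgt S m y) (etgt S m y)" using x y by auto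
    have gx: "ceq S l (esrc S l (esrc S m x)) (esrc S l (etgt S m x))"
      "ceq S l (etgt S l (esrc S m x)) (etgt S l (etgt S m x))"
      and gy: "ceq S l (esrc S l (esrc S m y)) (esrc S l (etgt S m y))"
      "ceq S l (etgt S l (esrc S m y)) (etgt S l (etgt S m y))" using x y Suc by auto
    consider "k = m" | "k = l" | "k < l" using km Suc by linarith
    then show ?thesis
    proof cases
      case 1
      then have "ceq S m (etgt S m x) (esrc S m y)" using C by simp
      then have "bcong S m (etgt S m x) (esrc S m y)" using IHm[of m] by blast
      then have "ceq S l (esrc S l (etgt S m x)) (esrc S l (esrc S m y))"
        "ceq S l (etgt S l (etgt S m x)) (etgt S l (esrc S m y))" using Suc by simp_all
      then have "ceq S l (esrc S l (esrc S m x)) (esrc S l (etgt S m y))"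
        "ceq S l (etgt S l (esrc S m x)) (etgt S l (etgt S m y))"
        using tr[OF tr[OF gx(1)] gy(1)] tr[OF tr[OF gx(2)] gy(2)] by blast+
      then show ?thesis using 1 Suc by simp
    next
      case 2
      then show ?thesis using gx gy Suc by simp
    next
      case 3
      then have k: "k < m" and kl: "k \<le> l" using Suc by simp_all
      have IHl: "\<And>n a b. n < Suc l \<Longrightarrow> ceq S n a b \<Longrightarrow> bcong S n a b" using IHm Suc by simp
      have gg: "glob S (Suc l) (esrc S m x)" "glob S (Suc l) (esrc S m y)" using IHm wx wy Suc by blast+
      have CC: "ceq S k (down (etgt S) k l (etgt S l (esrc S m x))) (down (esrc S) k l (esrc S l (esrc S m y)))"
        using 2[OF k] kl Suc by simp
      have "ceq S k (down (etgt S) k l (etgt S l (esrc S m x))) (down (etgt S) k l (esrc S l (esrc S m x)))"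
        "ceq S k (down (esrc S) k l (esrc S l (esrc S m y))) (down (esrc S) k l (etgt S l (esrc S m y)))"
        using down_glob_aux[OF IHl gg(1) 3] down_glob_aux[OF IHl gg(2) 3] sy by blast+
      then have "ceq S k (down (etgt S) k l (esrc S l (esrc S m x))) (down (esrc S) k l (esrc S l (esrc S m y)))"
        "ceq S k (down (etgt S) k l (etgt S l (esrc S m x))) (down (esrc S) k l (etgt S l (esrc S m y)))"
        using tr[OF sy CC] tr[OF CC] by blast+
      then show ?thesis using 3 gx gy Suc by (simp add: ceq.comp)
    qed
  qed simp
qed

lemma bcong_glob_step:
  assumes P: "polygraph S" and IH: "\<And>n a b. n < N \<Longrightarrow> ceq S n a b \<Longrightarrow> bcong S n a b \<and> glob S n a"
  shows "ceq S n a b \<Longrightarrow> n = N \<Longrightarrow> bcong S N a b \<and> glob S N a \<and> glob S N b"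
proof (induction rule: ceq.induct)
  case (gen g n)
  then obtain m where N: "N = Suc m" "n = Suc m" "g \<in> gens S (Suc m)" using P by (cases n) (auto simp: polygraph_def)
  have "\<And>n a b. n < Suc m \<Longrightarrow> ceq S n a b \<Longrightarrow> bcong S n a b" using IH N by blast
  from parallelD[OF P N(3) this] show ?case unfolding N by simp
next
  case (idt n a a')
  then have N: "N = Suc n" by simp
  have "bcong S n a a" "bcong S n a' a'" using IH N idt ceq_reflL ceq_reflR by blast+
  then show ?case using N idt by (cases n) auto
next
  case (sum n a a' b b')
  then show ?case by (cases N rule: nat_cases3) (simp_all add: ceq.sum)
next
  case (scal n a a' c)
  then show ?case by (cases N rule: nat_cases3) (simp_all add: ceq.scal)
next
  case (prod n a a' b b')
  then show ?case by (cases N rule: nat_cases3) (simp_all add: ceq.prod)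
next
  case (oper n a a' \<tau>)
  then show ?case by (cases N rule: nat_cases3) (simp_all add: ceq.oper)
next
  case (comp k n a a' b b')
  then obtain m where N: "N = Suc m" by (cases N) auto
  have n: "n = Suc m" using N comp by simp
  have ba: "bcong S (Suc m) a a'" "glob S (Suc m) a" "glob S (Suc m) a'"
    and bb: "bcong S (Suc m) b b'" "glob S (Suc m) b" "glob S (Suc m) b'"
    using comp N by blast+
  have IHm: "\<And>n a b. n \<le> m \<Longrightarrow> ceq S n a b \<Longrightarrow> bcong S n a b \<and> glob S n a"
    and IHm': "\<And>n a b. n \<le> m \<Longrightarrow> ceq S n a b \<Longrightarrow> bcong S n a b" using IH N by simp_all
  have km: "k \<le> m" using comp n by simp
  have C: "ceq S k (down (etgt S) k m (etgt S m a)) (down (esrc S) k m (esrc S m b))"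
    using comp(4) n km by simp
  have C': "ceq S k (down (etgt S) k m (etgt S m a')) (down (esrc S) k m (esrc S m b'))"
  proof -
    have "ceq S m (etgt S m a) (etgt S m a')" "ceq S m (esrc S m b) (esrc S m b')" using ba(1) bb(1) by simp_all
    then have "ceq S k (down (etgt S) k m (etgt S m a)) (down (etgt S) k m (etgt S m a'))"
      "ceq S k (down (esrc S) k m (esrc S m b)) (down (esrc S) k m (esrc S m b'))"
      using down_cong_aux[OF IHm' _ km] by blast+
    with C show ?thesis by (meson ceq.sym ceq.trans)
  qed
  have r: "bcong S (Suc m) a a" "bcong S (Suc m) b b" "bcong S (Suc m) a' a'" "bcong S (Suc m) b' b'"
    using ba(1) bb(1) by (auto intro: ceq_reflL ceq_reflR)
  note g = comp_glob_step[OF IHm km r(1) ba(2) r(2) bb(2) C] comp_glob_step[OF IHm km r(3) ba(3) r(4) bb(3) C']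
  have "bcong S (Suc m) (Comp k a b) (Comp k a' b')"
  proof (cases "k = m")
    case False
    then have "k < m" using km by simp
    with g(2) ba bb False show ?thesis by (auto intro: ceq.comp)
  qed (use ba bb in simp)
  then show ?case using g N by blast
next
  case (sym n a b)
  then show ?case by (cases N) (auto intro: ceq.sym)
next
  case (trans n a b c)
  then have "bcong S N a b" "bcong S N b c" by blast+
  then have "bcong S N a c" by (cases N) (auto intro: ceq.trans)
  then show ?case using trans by blast
next
  case (ax n a b)
  then have h: "bcong S N a a" "glob S N a" "bcong S N b b" "glob S N b" by blast+
  have "bcong S N a b"
  proof (cases N)
    case (Suc m)
    have "\<And>n a b. n < Suc m \<Longrightarrow> ceq S n a b \<Longrightarrow> bcong S n a b" using IH Suc by blast
    from ax_bcong[OF _ _ _ _ _ _ this] show ?thesis using ax h Suc by simp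
  qed simp
  then show ?case using h by blast
qed auto

lemma bcong_glob: "polygraph S \<Longrightarrow> ceq S n a b \<Longrightarrow> bcong S n a b \<and> glob S n a"
proof (induction n arbitrary: a b rule: less_induct)
  case (less n)
  then show ?case using bcong_glob_step[of S n n a b] by blast
qed


lemma ecls_UN:
  assumes "ceq S n a a" "\<And>b. ceq S n a b \<Longrightarrow> F a = F b"
  shows "(\<Union>b\<in>ecls S n a. F b) = F a"
  using assms unfolding ecls_def by blast

lemma ecls_UN2:
  assumes "ceq S n a a" "ceq S m b b" "\<And>a' b'. ceq S n a a' \<Longrightarrow> ceq S m b b' \<Longrightarrow> F a b = F a' b'"
  shows "(\<Union>a\<in>ecls S n a. \<Union>b\<in>ecls S m b. F a b) = F a b"
  using assms unfolding ecls_def by blast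

lemma free_cells_simps:
  "carrier (free_cells S n) = {ecls S n a | a. ceq S n a a}"
  "one (free_cells S n) = ecls S n (eid 0 n (Base 1))"
  "zero (free_cells S n) = ecls S n (eid 0 n (Base 0))"
  by (simp_all add: free_cells_def)

lemma free_cells_ops2:
  assumes "ceq S n a a" "ceq S n b b"
  shows "add (free_cells S n) (ecls S n a) (ecls S n b) = ecls S n (Sum a b)"
    "mult (free_cells S n) (ecls S n a) (ecls S n b) = ecls S n (Prod a b)"
  unfolding free_cells_def opalg.simps module.simps ring.simps monoid.simps
  by (rule ecls_UN2[OF assms], rule ecls_eq, simp add: ceq.sum ceq.prod)+

lemma free_cells_ops1:
  assumes "ceq S n a a"
  shows "smult (free_cells S n) c (ecls S n a) = ecls S n (Scal c a)"
    "oper (free_cells S n) \<tau> (ecls S n a) = ecls S n (Oper \<tau> a)"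
  unfolding free_cells_def opalg.simps module.simps ring.simps monoid.simps
  by (rule ecls_UN[OF assms(1)], rule ecls_eq, simp add: ceq.scal ceq.oper)+

lemmas free_cells_ops = free_cells_ops1 free_cells_ops2

lemma idc_cls: "ceq S n a a \<Longrightarrow> idc (free_alg S) n (ecls S n a) = ecls S (Suc n) (Idt a)"
  unfolding free_alg_def higher_alg.simps by (rule ecls_UN, assumption, rule ecls_eq, rule ceq.idt)

lemma comp_cls:
  assumes "k < n" "ceq S n a a" "ceq S n b b" "ceq S k (down (etgt S) k n a) (down (esrc S) k n b)"
  shows "comp (free_alg S) n k (ecls S n a) (ecls S n b) = ecls S n (Comp k a b)"
  unfolding free_alg_def higher_alg.simps
  by (rule ecls_UN2[OF assms(2,3)], rule ecls_eq, rule ceq.comp[OF assms(1) _ _ assms(4)])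

lemma cell_free [simp]: "cell (free_alg S) = free_cells S"
  by (simp add: free_alg_def)

lemma free_obtain:
  assumes "X \<in> carrier (free_cells S n)"
  obtains a where "ceq S n a a" "X = ecls S n a"
  using assms by (auto simp: free_cells_simps)

lemma eid_Base:
  assumes "p \<in> carrier (free_opalg (gens0 S))"
  shows "ceq S n (eid 0 n (Base p)) (eid 0 n (Base p))"
  by (induction n) (auto intro: ceq.base ceq.idt assms)

lemma zero_in: "(0::('k::field,'z,'w) opoly) \<in> carrier (free_opalg Z)"
  and one_in: "(1::('k::field,'z,'w) opoly) \<in> carrier (free_opalg Z)"
  by (auto simp: free_opalg_def zero_list_def omonoid_def simp flip: single_one)

lemma free_laws:
  fixes S :: "('k::field, 'z, 'w, 'g) polygraph" and n
  defines "M \<equiv> free_cells S n"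
  assumes A: "A \<in> carrier M" and B: "B \<in> carrier M" and C: "C \<in> carrier M"
  shows "(A \<oplus>\<^bsub>M\<^esub> B) \<oplus>\<^bsub>M\<^esub> C = A \<oplus>\<^bsub>M\<^esub> (B \<oplus>\<^bsub>M\<^esub> C)" "A \<oplus>\<^bsub>M\<^esub> B = B \<oplus>\<^bsub>M\<^esub> A"
    "A \<oplus>\<^bsub>M\<^esub> \<zero>\<^bsub>M\<^esub> = A" "A \<oplus>\<^bsub>M\<^esub> ((-1) \<odot>\<^bsub>M\<^esub> A) = \<zero>\<^bsub>M\<^esub>"
    "r \<odot>\<^bsub>M\<^esub> (A \<oplus>\<^bsub>M\<^esub> B) = r \<odot>\<^bsub>M\<^esub> A \<oplus>\<^bsub>M\<^esub> r \<odot>\<^bsub>M\<^esub> B" "(r + s) \<odot>\<^bsub>M\<^esub> A = r \<odot>\<^bsub>M\<^esub> A \<oplus>\<^bsub>M\<^esub> s \<odot>\<^bsub>M\<^esub> A"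
    "(r * s) \<odot>\<^bsub>M\<^esub> A = r \<odot>\<^bsub>M\<^esub> (s \<odot>\<^bsub>M\<^esub> A)" "1 \<odot>\<^bsub>M\<^esub> A = A"
    "(A \<otimes>\<^bsub>M\<^esub> B) \<otimes>\<^bsub>M\<^esub> C = A \<otimes>\<^bsub>M\<^esub> (B \<otimes>\<^bsub>M\<^esub> C)" "\<one>\<^bsub>M\<^esub> \<otimes>\<^bsub>M\<^esub> A = A" "A \<otimes>\<^bsub>M\<^esub> \<one>\<^bsub>M\<^esub> = A"
    "A \<otimes>\<^bsub>M\<^esub> (B \<oplus>\<^bsub>M\<^esub> C) = A \<otimes>\<^bsub>M\<^esub> B \<oplus>\<^bsub>M\<^esub> A \<otimes>\<^bsub>M\<^esub> C"
    "(A \<oplus>\<^bsub>M\<^esub> B) \<otimes>\<^bsub>M\<^esub> C = A \<otimes>\<^bsub>M\<^esub> C \<oplus>\<^bsub>M\<^esub> B \<otimes>\<^bsub>M\<^esub> C"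
    "(r \<odot>\<^bsub>M\<^esub> A) \<otimes>\<^bsub>M\<^esub> B = r \<odot>\<^bsub>M\<^esub> (A \<otimes>\<^bsub>M\<^esub> B)" "A \<otimes>\<^bsub>M\<^esub> (r \<odot>\<^bsub>M\<^esub> B) = r \<odot>\<^bsub>M\<^esub> (A \<otimes>\<^bsub>M\<^esub> B)"
    "oper M \<tau> (A \<oplus>\<^bsub>M\<^esub> B) = oper M \<tau> A \<oplus>\<^bsub>M\<^esub> oper M \<tau> B" "oper M \<tau> (r \<odot>\<^bsub>M\<^esub> A) = r \<odot>\<^bsub>M\<^esub> oper M \<tau> A"
proof -
  obtain a b c where w: "ceq S n a a" "ceq S n b b" "ceq S n c c"
    and e: "A = ecls S n a" "B = ecls S n b" "C = ecls S n c"
    using A B C unfolding M_def by (metis free_obtain)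
  note z = eid_Base[OF zero_in, of S n] eid_Base[OF one_in, of S n]
  note i = ceq.sum ceq.prod ceq.scal ceq.oper w z
  note ops = M_def e free_cells_ops free_cells_simps i
  show "(A \<oplus>\<^bsub>M\<^esub> B) \<oplus>\<^bsub>M\<^esub> C = A \<oplus>\<^bsub>M\<^esub> (B \<oplus>\<^bsub>M\<^esub> C)" 
    by (simp only: ops) (rule ecls_eq, rule ceq.ax, rule eq_axiom.add_assoc, (intro i)+)
  show "A \<oplus>\<^bsub>M\<^esub> B = B \<oplus>\<^bsub>M\<^esub> A"
    by (simp only: ops) (rule ecls_eq, rule ceq.ax, rule eq_axiom.add_comm, (intro i)+)
  show "A \<oplus>\<^bsub>M\<^esub> \<zero>\<^bsub>M\<^esub> = A"
    by (simp only: ops) (rule ecls_eq, rule ceq.ax, rule eq_axiom.add_zero, (intro i)+)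
  show "A \<oplus>\<^bsub>M\<^esub> ((-1) \<odot>\<^bsub>M\<^esub> A) = \<zero>\<^bsub>M\<^esub>"
    by (simp only: ops) (rule ecls_eq, rule ceq.ax, rule eq_axiom.add_neg, (intro i)+)
  show "r \<odot>\<^bsub>M\<^esub> (A \<oplus>\<^bsub>M\<^esub> B) = r \<odot>\<^bsub>M\<^esub> A \<oplus>\<^bsub>M\<^esub> r \<odot>\<^bsub>M\<^esub> B"
    by (simp only: ops) (rule ecls_eq, rule ceq.ax, rule eq_axiom.scal_add, (intro i)+)
  show "(r + s) \<odot>\<^bsub>M\<^esub> A = r \<odot>\<^bsub>M\<^esub> A \<oplus>\<^bsub>M\<^esub> s \<odot>\<^bsub>M\<^esub> A"
    by (simp only: ops) (rule ecls_eq, rule ceq.ax, rule eq_axiom.add_scal, (intro i)+)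
  show "(r * s) \<odot>\<^bsub>M\<^esub> A = r \<odot>\<^bsub>M\<^esub> (s \<odot>\<^bsub>M\<^esub> A)"
    by (simp only: ops) (rule ecls_eq, rule ceq.ax, rule eq_axiom.scal_scal, (intro i)+)
  show "1 \<odot>\<^bsub>M\<^esub> A = A"
    by (simp only: ops) (rule ecls_eq, rule ceq.ax, rule eq_axiom.scal_one, (intro i)+)
  show "(A \<otimes>\<^bsub>M\<^esub> B) \<otimes>\<^bsub>M\<^esub> C = A \<otimes>\<^bsub>M\<^esub> (B \<otimes>\<^bsub>M\<^esub> C)"
    by (simp only: ops) (rule ecls_eq, rule ceq.ax, rule eq_axiom.mult_assoc, (intro i)+)
  show "\<one>\<^bsub>M\<^esub> \<otimes>\<^bsub>M\<^esub> A = A"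
    by (simp only: ops) (rule ecls_eq, rule ceq.ax, rule eq_axiom.mult_onel, (intro i)+)
  show "A \<otimes>\<^bsub>M\<^esub> \<one>\<^bsub>M\<^esub> = A"
    by (simp only: ops) (rule ecls_eq, rule ceq.ax, rule eq_axiom.mult_oner, (intro i)+)
  show "A \<otimes>\<^bsub>M\<^esub> (B \<oplus>\<^bsub>M\<^esub> C) = A \<otimes>\<^bsub>M\<^esub> B \<oplus>\<^bsub>M\<^esub> A \<otimes>\<^bsub>M\<^esub> C"
    by (simp only: ops) (rule ecls_eq, rule ceq.ax, rule eq_axiom.distl, (intro i)+)
  show "(A \<oplus>\<^bsub>M\<^esub> B) \<otimes>\<^bsub>M\<^esub> C = A \<otimes>\<^bsub>M\<^esub> C \<oplus>\<^bsub>M\<^esub> B \<otimes>\<^bsub>M\<^esub> C"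
    by (simp only: ops) (rule ecls_eq, rule ceq.ax, rule eq_axiom.distr, (intro i)+)
  show "(r \<odot>\<^bsub>M\<^esub> A) \<otimes>\<^bsub>M\<^esub> B = r \<odot>\<^bsub>M\<^esub> (A \<otimes>\<^bsub>M\<^esub> B)"
    by (simp only: ops) (rule ecls_eq, rule ceq.ax, rule eq_axiom.mult_scall, (intro i)+)
  show "A \<otimes>\<^bsub>M\<^esub> (r \<odot>\<^bsub>M\<^esub> B) = r \<odot>\<^bsub>M\<^esub> (A \<otimes>\<^bsub>M\<^esub> B)"
    by (simp only: ops) (rule ecls_eq, rule ceq.ax, rule eq_axiom.mult_scalr, (intro i)+)
  show "oper M \<tau> (A \<oplus>\<^bsub>M\<^esub> B) = oper M \<tau> A \<oplus>\<^bsub>M\<^esub> oper M \<tau> B"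
    by (simp only: ops) (rule ecls_eq, rule ceq.ax, rule eq_axiom.oper_add, (intro i)+)
  show "oper M \<tau> (r \<odot>\<^bsub>M\<^esub> A) = r \<odot>\<^bsub>M\<^esub> oper M \<tau> A"
    by (simp only: ops) (rule ecls_eq, rule ceq.ax, rule eq_axiom.oper_scal, (intro i)+)
qed

lemma ecls_in [simp]: "ecls S n a \<in> carrier (free_cells S n)" if "ceq S n a a"
  using that by (auto simp: free_cells_simps)

lemma free_closed:
  fixes S :: "('k::field, 'z, 'w, 'g) polygraph" and n
  defines "M \<equiv> free_cells S n"
  shows "\<one>\<^bsub>M\<^esub> \<in> carrier M" "\<zero>\<^bsub>M\<^esub> \<in> carrier M"
    "x \<in> carrier M \<Longrightarrow> y \<in> carrier M \<Longrightarrow> x \<oplus>\<^bsub>M\<^esub> y \<in> carrier M"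
    "x \<in> carrier M \<Longrightarrow> y \<in> carrier M \<Longrightarrow> x \<otimes>\<^bsub>M\<^esub> y \<in> carrier M"
    "x \<in> carrier M \<Longrightarrow> r \<odot>\<^bsub>M\<^esub> x \<in> carrier M"
    "x \<in> carrier M \<Longrightarrow> oper M \<tau> x \<in> carrier M"
proof -
  note z = eid_Base[OF zero_in, of S n] eid_Base[OF one_in, of S n]
  show "\<one>\<^bsub>M\<^esub> \<in> carrier M" "\<zero>\<^bsub>M\<^esub> \<in> carrier M" 
    unfolding M_def free_cells_simps(2,3) using z by (blast intro: ecls_in)+
  show "x \<in> carrier M \<Longrightarrow> y \<in> carrier M \<Longrightarrow> x \<oplus>\<^bsub>M\<^esub> y \<in> carrier M"
    "x \<in> carrier M \<Longrightarrow> y \<in> carrier M \<Longrightarrow> x \<otimes>\<^bsub>M\<^esub> y \<in> carrier M"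
    "x \<in> carrier M \<Longrightarrow> r \<odot>\<^bsub>M\<^esub> x \<in> carrier M"
    "x \<in> carrier M \<Longrightarrow> oper M \<tau> x \<in> carrier M"
    unfolding M_def
    by (elim free_obtain; simp add: free_cells_ops ceq.sum ceq.prod ceq.scal ceq.oper)+
qed

lemma free_operated: "operated_algebra (free_cells S n)"
proof -
  note c = free_closed
  note l = free_laws
  have r: "ring (free_cells S n)"
  proof (intro ringI abelian_groupI monoidI)
    fix x assume x: "x \<in> carrier (free_cells S n)"
    have m: "(-1) \<odot>\<^bsub>free_cells S n\<^esub> x \<in> carrier (free_cells S n)" using c(5) x by blast
    have "((-1) \<odot>\<^bsub>free_cells S n\<^esub> x) \<oplus>\<^bsub>free_cells S n\<^esub> x = \<zero>\<^bsub>free_cells S n\<^esub>"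
      using l(4)[OF x x x] l(2)[OF m x x] by simp
    with m show "\<exists>y\<in>carrier (free_cells S n). y \<oplus>\<^bsub>free_cells S n\<^esub> x = \<zero>\<^bsub>free_cells S n\<^esub>" by blast
    show "\<zero>\<^bsub>free_cells S n\<^esub> \<oplus>\<^bsub>free_cells S n\<^esub> x = x"
      using l(2)[OF c(2) x x] l(3)[OF x x x] by simp
  qed (fact c l | erule (1) c, (assumption)? | (rule l; assumption))+
  show ?thesis unfolding operated_algebra_def linear_hom_def
    by (intro conjI allI ballI CollectI funcsetI r) ((erule c | (rule l; assumption))+)
qed


lemma down_cls:
  assumes P: "polygraph S" and "ceq S n a a" "k \<le> n"
  shows "down (src (free_alg S)) k n (ecls S n a) = ecls S k (down (esrc S) k n a)"
    "down (tgt (free_alg S)) k n (ecls S n a) = ecls S k (down (etgt S) k n a)"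
    "ceq S k (down (esrc S) k n a) (down (esrc S) k n a)"
    "ceq S k (down (etgt S) k n a) (down (etgt S) k n a)"
proof -
  have bc: "\<And>n a b. ceq S n a b \<Longrightarrow> bcong S n a b" using bcong_glob[OF P] by blast
  show "ceq S k (down (esrc S) k n a) (down (esrc S) k n a)"
    "ceq S k (down (etgt S) k n a) (down (etgt S) k n a)"
    using down_cong_aux[OF bc assms(2,3)] by blast+
  have "down (src (free_alg S)) k n (ecls S n a) = ecls S k (down (esrc S) k n a) \<and>
    down (tgt (free_alg S)) k n (ecls S n a) = ecls S k (down (etgt S) k n a)"
    using assms(2,3)
  proof (induction n arbitrary: a)
    case (Suc n)
    have "bcong S (Suc n) a a" using bc Suc by blast
    then show ?case using Suc by (cases "k = Suc n") (simp_all add: src_cls[OF bc])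
  qed simp
  then show "down (src (free_alg S)) k n (ecls S n a) = ecls S k (down (esrc S) k n a)"
    "down (tgt (free_alg S)) k n (ecls S n a) = ecls S k (down (etgt S) k n a)" by blast+
qed

lemma up_cls:
  assumes "ceq S k a a" "k \<le> n"
  shows "up (idc (free_alg S)) k n (ecls S k a) = ecls S n (eid k n a)"
  using assms(2)
proof (induction n)
  case (Suc n)
  then show ?case using eid_cong[OF _ assms(1)] by (cases "k = Suc n") (simp_all add: idc_cls)
qed simp

lemma composable_cls:
  assumes P: "polygraph S" and "k < n" "ceq S n a a" "ceq S n b b"
  shows "composable (free_alg S) n k (ecls S n a) (ecls S n b) \<longleftrightarrow> 
    ceq S k (down (etgt S) k n a) (down (esrc S) k n b)"
proof -
  have kn: "k \<le> n" using assms(2) by simp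
  note a = down_cls[OF P assms(3) kn] and b = down_cls[OF P assms(4) kn]
  have "composable (free_alg S) n k (ecls S n a) (ecls S n b) \<longleftrightarrow>
      ecls S k (down (etgt S) k n a) = ecls S k (down (esrc S) k n b)"
    using a(2) b(1) ecls_in[OF assms(3)] ecls_in[OF assms(4)] by simp
  then show ?thesis using ecls_eqD[OF a(4)] by (auto dest: ecls_eq)
qed

lemma composable_obtain:
  assumes P: "polygraph S" and c: "composable (free_alg S) n k A B" and k: "k < n"
  obtains a b where "ceq S n a a" "A = ecls S n a" "ceq S n b b" "B = ecls S n b"
    "ceq S k (down (etgt S) k n a) (down (esrc S) k n b)" "ceq S n (Comp k a b) (Comp k a b)"
    "comp (free_alg S) n k A B = ecls S n (Comp k a b)"
proof -
  have AB: "A \<in> carrier (free_cells S n)" "B \<in> carrier (free_cells S n)" using c by simp_all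
  obtain a where a: "ceq S n a a" "A = ecls S n a" by (rule free_obtain[OF AB(1)])
  obtain b where b: "ceq S n b b" "B = ecls S n b" by (rule free_obtain[OF AB(2)])
  have d: "ceq S k (down (etgt S) k n a) (down (esrc S) k n b)"
    using c unfolding a(2) b(2) by (simp only: composable_cls[OF P k a(1) b(1)])
  show thesis
    by (rule that[OF a b d ceq.comp[OF k a(1) b(1) d]])
      (simp only: a(2) b(2) comp_cls[OF k a(1) b(1) d])
qed

lemma ecls_ax: "eq_axiom S n a b \<Longrightarrow> ceq S n a a \<Longrightarrow> ceq S n b b \<Longrightarrow> ecls S n a = ecls S n b"
  by (rule ecls_eq, rule ceq.ax)

lemma op_homI:
  assumes "\<And>x. x \<in> carrier M \<Longrightarrow> f x \<in> carrier N"
    "\<And>x y. x \<in> carrier M \<Longrightarrow> y \<in> carrier M \<Longrightarrow> f (x \<otimes>\<^bsub>M\<^esub> y) = f x \<otimes>\<^bsub>N\<^esub> f y"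
    "\<And>x y. x \<in> carrier M \<Longrightarrow> y \<in> carrier M \<Longrightarrow> f (x \<oplus>\<^bsub>M\<^esub> y) = f x \<oplus>\<^bsub>N\<^esub> f y"
    "f \<one>\<^bsub>M\<^esub> = \<one>\<^bsub>N\<^esub>" "\<And>c x. x \<in> carrier M \<Longrightarrow> f (c \<odot>\<^bsub>M\<^esub> x) = c \<odot>\<^bsub>N\<^esub> f x"
    "\<And>\<tau> x. x \<in> carrier M \<Longrightarrow> f (oper M \<tau> x) = oper N \<tau> (f x)"
  shows "f \<in> op_hom M N"
  unfolding op_hom_def linear_hom_def using assms by (auto intro!: ring_hom_memI)


lemma down_exp:
  "down (esrc S) k n (Sum a b) = Sum (down (esrc S) k n a) (down (esrc S) k n b)"
  "down (esrc S) k n (Prod a b) = Prod (down (esrc S) k n a) (down (esrc S) k n b)"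
  "down (esrc S) k n (Scal c a) = Scal c (down (esrc S) k n a)"
  "down (esrc S) k n (Oper \<tau> a) = Oper \<tau> (down (esrc S) k n a)"
  "down (etgt S) k n (Sum a b) = Sum (down (etgt S) k n a) (down (etgt S) k n b)"
  "down (etgt S) k n (Prod a b) = Prod (down (etgt S) k n a) (down (etgt S) k n b)"
  "down (etgt S) k n (Scal c a) = Scal c (down (etgt S) k n a)"
  "down (etgt S) k n (Oper \<tau> a) = Oper \<tau> (down (etgt S) k n a)"
  by (induction n arbitrary: a b) auto

lemma down_eid0:
  assumes "k \<le> n"
  shows "down (esrc S) k n (eid 0 n x) = eid 0 k x" "down (etgt S) k n (eid 0 n x) = eid 0 k x"
  using assms by (induction n) (auto simp: le_Suc_eq)

lemma eid_eid: "k \<le> n \<Longrightarrow> eid k n (eid 0 k x) = eid 0 n x"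
  by (induction n) (auto simp: le_Suc_eq)

lemma down_Comp:
  assumes "k < n"
  shows "down (esrc S) k n (Comp k a b) = down (esrc S) k n a"
    "down (etgt S) k n (Comp k a b) = down (etgt S) k n b"
  using assms by (induction n arbitrary: a b) (auto simp: less_Suc_eq)

lemma down_Comp':
  assumes "j < k" "k \<le> n"
  shows "down (esrc S) k n (Comp j a b) = Comp j (down (esrc S) k n a) (down (esrc S) k n b)"
    "down (etgt S) k n (Comp j a b) = Comp j (down (etgt S) k n a) (down (etgt S) k n b)"
  using assms by (induction n arbitrary: a b) (auto simp: le_Suc_eq)

lemma free_comp_hom:
  assumes P: "polygraph S" and k: "k < n"
  shows "(\<lambda>(a, b). comp (free_alg S) n k a b) \<in> op_hom (composables (free_alg S) n k) (free_cells S n)"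
proof -
  let ?A = "free_alg S" and ?M = "free_cells S n"
  have cs: "mult (composables ?A n k) (A, B) (A', B') = (A \<otimes>\<^bsub>?M\<^esub> A', B \<otimes>\<^bsub>?M\<^esub> B')"
    "add (composables ?A n k) (A, B) (A', B') = (A \<oplus>\<^bsub>?M\<^esub> A', B \<oplus>\<^bsub>?M\<^esub> B')"
    "smult (composables ?A n k) c (A, B) = (c \<odot>\<^bsub>?M\<^esub> A, c \<odot>\<^bsub>?M\<^esub> B)"
    "oper (composables ?A n k) \<tau> (A, B) = (oper ?M \<tau> A, oper ?M \<tau> B)"
    "one (composables ?A n k) = (\<one>\<^bsub>?M\<^esub>, \<one>\<^bsub>?M\<^esub>)" for A B A' B' c \<tau>
    by (simp_all add: composables_def Let_def)
  have ob: "\<exists>a b. x = (ecls S n a, ecls S n b) \<and> ceq S n a a \<and> ceq S n b b \<and>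
      ceq S k (down (etgt S) k n a) (down (esrc S) k n b) \<and> ceq S n (Comp k a b) (Comp k a b) \<and>
      comp ?A n k (ecls S n a) (ecls S n b) = ecls S n (Comp k a b)"
    if "x \<in> carrier (composables ?A n k)" for x
  proof -
    obtain A B where x: "x = (A, B)" by (cases x)
    then have "composable ?A n k A B" using that by (simp add: composables_def Let_def)
    then obtain a b where "ceq S n a a" "A = ecls S n a" "ceq S n b b" "B = ecls S n b"
      "ceq S k (down (etgt S) k n a) (down (esrc S) k n b)" "ceq S n (Comp k a b) (Comp k a b)"
      "comp ?A n k A B = ecls S n (Comp k a b)"
      by (rule composable_obtain[OF P _ k])
    then show ?thesis using x by blast
  qed
  note ops = free_cells_ops ceq.sum ceq.prod ceq.scal ceq.oper
  show ?thesis
  proof (rule op_homI)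
    fix x assume "x \<in> carrier (composables ?A n k)"
    then obtain a b where x: "x = (ecls S n a, ecls S n b)" and w: "ceq S n a a" "ceq S n b b"
      and c: "ceq S k (down (etgt S) k n a) (down (esrc S) k n b)" and wc: "ceq S n (Comp k a b) (Comp k a b)"
      and e: "comp ?A n k (ecls S n a) (ecls S n b) = ecls S n (Comp k a b)" using ob by blast
    show "(case x of (a, b) \<Rightarrow> comp ?A n k a b) \<in> carrier ?M" using x e wc by simp
    {
      fix y assume "y \<in> carrier (composables ?A n k)"
      then obtain a' b' where y: "y = (ecls S n a', ecls S n b')" and w': "ceq S n a' a'" "ceq S n b' b'"
        and c': "ceq S k (down (etgt S) k n a') (down (esrc S) k n b')" and wc': "ceq S n (Comp k a' b') (Comp k a' b')"
        and e': "comp ?A n k (ecls S n a') (ecls S n b') = ecls S n (Comp k a' b')" using ob by blast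
      have 1: "ceq S k (down (etgt S) k n (Prod a a')) (down (esrc S) k n (Prod b b'))"
        and 2: "ceq S k (down (etgt S) k n (Sum a a')) (down (esrc S) k n (Sum b b'))"
        unfolding down_exp by (rule ceq.prod[OF c c'], rule ceq.sum[OF c c'])
      have p: "ceq S n (Prod a a') (Prod a a')" "ceq S n (Prod b b') (Prod b b')"
        "ceq S n (Sum a a') (Sum a a')" "ceq S n (Sum b b') (Sum b b')" using w w' by (auto intro: ceq.prod ceq.sum)
      have "comp ?A n k (ecls S n (Prod a a')) (ecls S n (Prod b b')) = ecls S n (Prod (Comp k a b) (Comp k a' b'))"
        unfolding comp_cls[OF k p(1,2) 1]
        by (rule ecls_ax[OF eq_axiom.comp_mult ceq.comp[OF k p(1,2) 1] ceq.prod[OF wc wc']])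
      then show "(case x \<otimes>\<^bsub>composables ?A n k\<^esub> y of (a, b) \<Rightarrow> comp ?A n k a b) =
          (case x of (a, b) \<Rightarrow> comp ?A n k a b) \<otimes>\<^bsub>?M\<^esub> (case y of (a, b) \<Rightarrow> comp ?A n k a b)"
        using x y e e' w w' wc wc' by (simp add: cs ops)
      have "comp ?A n k (ecls S n (Sum a a')) (ecls S n (Sum b b')) = ecls S n (Sum (Comp k a b) (Comp k a' b'))"
        unfolding comp_cls[OF k p(3,4) 2]
        by (rule ecls_ax[OF eq_axiom.comp_add ceq.comp[OF k p(3,4) 2] ceq.sum[OF wc wc']])
      then show "(case x \<oplus>\<^bsub>composables ?A n k\<^esub> y of (a, b) \<Rightarrow> comp ?A n k a b) =
          (case x of (a, b) \<Rightarrow> comp ?A n k a b) \<oplus>\<^bsub>?M\<^esub> (case y of (a, b) \<Rightarrow> comp ?A n k a b)"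
        using x y e e' w w' wc wc' by (simp add: cs ops)
    }
    fix r \<tau>
    have 1: "ceq S k (down (etgt S) k n (Scal r a)) (down (esrc S) k n (Scal r b))"
      and 2: "ceq S k (down (etgt S) k n (Oper \<tau> a)) (down (esrc S) k n (Oper \<tau> b))"
      unfolding down_exp by (rule ceq.scal[OF c], rule ceq.oper[OF c])
    have p: "ceq S n (Scal r a) (Scal r a)" "ceq S n (Scal r b) (Scal r b)"
      "ceq S n (Oper \<tau> a) (Oper \<tau> a)" "ceq S n (Oper \<tau> b) (Oper \<tau> b)" using w by (auto intro: ceq.scal ceq.oper)
    have "comp ?A n k (ecls S n (Scal r a)) (ecls S n (Scal r b)) = ecls S n (Scal r (Comp k a b))"
      unfolding comp_cls[OF k p(1,2) 1]
      by (rule ecls_ax[OF eq_axiom.comp_scal ceq.comp[OF k p(1,2) 1] ceq.scal[OF wc]])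
    then show "(case r \<odot>\<^bsub>composables ?A n k\<^esub> x of (a, b) \<Rightarrow> comp ?A n k a b) =
        r \<odot>\<^bsub>?M\<^esub> (case x of (a, b) \<Rightarrow> comp ?A n k a b)"
      using x e w wc by (simp add: cs ops)
    have "comp ?A n k (ecls S n (Oper \<tau> a)) (ecls S n (Oper \<tau> b)) = ecls S n (Oper \<tau> (Comp k a b))"
      unfolding comp_cls[OF k p(3,4) 2]
      by (rule ecls_ax[OF eq_axiom.comp_oper ceq.comp[OF k p(3,4) 2] ceq.oper[OF wc]])
    then show "(case oper (composables ?A n k) \<tau> x of (a, b) \<Rightarrow> comp ?A n k a b) =
        oper ?M \<tau> (case x of (a, b) \<Rightarrow> comp ?A n k a b)"
      using x e w wc by (simp add: cs ops)
  next
    let ?o = "eid 0 n (Base 1)"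
    have kn: "k \<le> n" using k by simp
    have o: "ceq S n ?o ?o" by (rule eid_Base[OF one_in])
    have c: "ceq S k (down (etgt S) k n ?o) (down (esrc S) k n ?o)"
      unfolding down_eid0[OF kn] by (rule eid_Base[OF one_in])
    have "eq_axiom S n (Comp k ?o ?o) ?o"
      using eq_axiom.comp_idl[of S n k ?o] unfolding down_eid0[OF kn] eid_eid[OF kn] .
    then have "ecls S n (Comp k ?o ?o) = ecls S n ?o" by (rule ecls_ax[OF _ ceq.comp[OF k o o c] o])
    then show "(case \<one>\<^bsub>composables ?A n k\<^esub> of (a, b) \<Rightarrow> comp ?A n k a b) = \<one>\<^bsub>?M\<^esub>"
      by (simp add: cs free_cells_simps comp_cls[OF k o o c])
  qed
qed

lemma down_down: "j \<le> k \<Longrightarrow> k \<le> n \<Longrightarrow> down f j k (down f k n a) = down f j n a"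
  by (induction n arbitrary: a) (auto simp: le_Suc_eq)

lemma down_mixed:
  assumes P: "polygraph S" and "j < k" "k \<le> n" "ceq S n a a"
  shows "ceq S j (down (esrc S) j k (down (etgt S) k n a)) (down (esrc S) j n a) \<and>
    ceq S j (down (etgt S) j k (down (esrc S) k n a)) (down (etgt S) j n a)"
  using assms(2-)
proof (induction n arbitrary: a)
  case (Suc n)
  have bc: "\<And>n a b. ceq S n a b \<Longrightarrow> bcong S n a b" using bcong_glob[OF P] by blast
  have gl: "glob S (Suc n) a" using bcong_glob[OF P] Suc by blast
  show ?case
  proof (cases "k = Suc n")
    case True
    then show ?thesis using down_cls(3,4)[OF P Suc.prems(3), of j] Suc.prems by simp
  next
    case False
    then have kn: "k \<le> n" "j < n" using Suc.prems by simp_all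
    have w: "ceq S n (esrc S n a) (esrc S n a)" "ceq S n (etgt S n a) (etgt S n a)" 
      using bc[OF Suc.prems(3)] by simp_all
    note g = down_glob_aux[OF bc gl kn(2)]
    note i = Suc.IH[OF Suc.prems(1) kn(1) w(1)] Suc.IH[OF Suc.prems(1) kn(1) w(2)]
    have "ceq S j (down (esrc S) j k (down (etgt S) k n (etgt S n a))) (down (esrc S) j n (esrc S n a))"
      using ceq.trans[OF i(2)[THEN conjunct1] ceq.sym[OF g[THEN conjunct1]]] .
    moreover have "ceq S j (down (etgt S) j k (down (esrc S) k n (esrc S n a))) (down (etgt S) j n (etgt S n a))"
      using ceq.trans[OF i(1)[THEN conjunct2] g[THEN conjunct2]] .
    ultimately show ?thesis using kn Suc.prems by simp
  qed
qed simp

theorem free_higher_algebra: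
  assumes P: "polygraph S"
  shows "higher_algebra (free_alg S)"
proof -
  let ?A = "free_alg S"
  have bc: "\<And>n a b. ceq S n a b \<Longrightarrow> bcong S n a b" and gl: "\<And>n a. ceq S n a a \<Longrightarrow> glob S n a"
    using bcong_glob[OF P] by blast+
  have sc: "src ?A n (ecls S (Suc n) a) = ecls S n (esrc S n a)"
    "tgt ?A n (ecls S (Suc n) a) = ecls S n (etgt S n a)" if "ceq S (Suc n) a a" for n a
    by (rule src_cls(1)[OF _ that], erule bc, rule src_cls(2)[OF _ that], erule bc)
  have w: "ceq S n (esrc S n a) (esrc S n a)" "ceq S n (etgt S n a) (etgt S n a)"
    if "ceq S (Suc n) a a" for n a using bc[OF that] by simp_all
  note cong = ceq.sum ceq.prod ceq.scal ceq.oper ceq.idt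
  note z = eid_Base[OF zero_in, of S] eid_Base[OF one_in, of S]
  have ei: "eid 0 (Suc n) a = Idt (eid 0 n a)" for n and a :: "('a, 'b, 'c, 'd) cexp" by simp
  note ops = free_cells_ops free_cells_simps(2,3)
  note cl = comp_cls
  show ?thesis
  proof
    fix n show "operated_algebra (cell ?A n)" by (simp add: free_operated)
  next
    fix n show "src ?A n \<in> op_hom (cell ?A (Suc n)) (cell ?A n)" unfolding cell_free
      by (rule op_homI; (elim free_obtain)?; simp add: ops sc cong w z)
  next
    fix n show "tgt ?A n \<in> op_hom (cell ?A (Suc n)) (cell ?A n)" unfolding cell_free
      by (rule op_homI; (elim free_obtain)?; simp add: ops sc cong w z)
  next
    fix n show "idc ?A n \<in> op_hom (cell ?A n) (cell ?A (Suc n))" unfolding cell_free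
      by (rule op_homI; (elim free_obtain)?; simp del: up.simps add: ops idc_cls cong z)
        (simp_all add: ei cong ecls_ax eq_axiom.intros)
  next
    fix k n :: nat assume k: "k < n"
    show "(\<lambda>(a, b). comp ?A n k a b) \<in> op_hom (composables ?A n k) (cell ?A n)"
      using free_comp_hom[OF P k] by simp
  next
    fix a n assume "a \<in> carrier (cell ?A (Suc (Suc n)))"
    then have m: "a \<in> carrier (free_cells S (Suc (Suc n)))" by simp
    obtain x where x: "ceq S (Suc (Suc n)) x x" "a = ecls S (Suc (Suc n)) x" 
      by (rule free_obtain[OF m])
    have g: "ceq S n (esrc S n (esrc S (Suc n) x)) (esrc S n (etgt S (Suc n) x))"
      "ceq S n (etgt S n (esrc S (Suc n) x)) (etgt S n (etgt S (Suc n) x))"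
      using gl[OF x(1)] by simp_all
    show "src ?A n (src ?A (Suc n) a) = src ?A n (tgt ?A (Suc n) a)"
      "tgt ?A n (src ?A (Suc n) a) = tgt ?A n (tgt ?A (Suc n) a)"
      unfolding x(2) sc[OF x(1)] sc[OF w(1)[OF x(1)]] sc[OF w(2)[OF x(1)]]
      by (rule ecls_eq[OF g(1)], rule ecls_eq[OF g(2)])
  next
    fix a n assume "a \<in> carrier (cell ?A n)"
    then have m: "a \<in> carrier (free_cells S n)" by simp
    obtain x where x: "ceq S n x x" "a = ecls S n x" by (rule free_obtain[OF m])
    show "src ?A n (idc ?A n a) = a" "tgt ?A n (idc ?A n a) = a"
      unfolding x(2) idc_cls[OF x(1)] sc[OF ceq.idt[OF x(1)]] by simp_all
  next
    fix n a b assume c: "composable ?A (Suc n) n a b"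
    from c obtain x y where x: "ceq S (Suc n) x x" "a = ecls S (Suc n) x" "ceq S (Suc n) y y" "b = ecls S (Suc n) y"
      "ceq S n (down (etgt S) n (Suc n) x) (down (esrc S) n (Suc n) y)"
      "ceq S (Suc n) (Comp n x y) (Comp n x y)" "comp ?A (Suc n) n a b = ecls S (Suc n) (Comp n x y)"
      by (rule composable_obtain[OF P _ lessI])
    show "src ?A n (comp ?A (Suc n) n a b) = src ?A n a" 
       "tgt ?A n (comp ?A (Suc n) n a b) = tgt ?A n b"
      unfolding x(7) unfolding x(2,4) sc[OF x(6)] sc[OF x(1)] sc[OF x(3)] by simp_all
  next
    fix k n a b assume k: "k < n" and c: "composable ?A (Suc n) k a b"
    have kS: "k < Suc n" using k by simp
    from c obtain x y where x: "ceq S (Suc n) x x" "a = ecls S (Suc n) x" "ceq S (Suc n) y y" "b = ecls S (Suc n) y"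
      and cc: "ceq S k (down (etgt S) k (Suc n) x) (down (esrc S) k (Suc n) y)"
      and x': "ceq S (Suc n) (Comp k x y) (Comp k x y)" "comp ?A (Suc n) k a b = ecls S (Suc n) (Comp k x y)"
      by (rule composable_obtain[OF P _ kS])
    have g: "ceq S k (down (etgt S) k n (esrc S n x)) (down (esrc S) k n (esrc S n y)) \<and>
      ceq S k (down (etgt S) k n (etgt S n x)) (down (esrc S) k n (etgt S n y))"
    proof -
      have "ceq S k (down (etgt S) k n (etgt S n x)) (down (esrc S) k n (esrc S n y))" using cc k by simp
      moreover have "bcong S (Suc n) x x" "glob S (Suc n) x" "bcong S (Suc n) y y" "glob S (Suc n) y"
        using bcong_glob[OF P] x(1,3) by blast+
      ultimately show ?thesis using comp_glob_step(2)[OF bcong_glob[OF P] less_imp_le[OF k]] k by blast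
    qed
    show "src ?A n (comp ?A (Suc n) k a b) = comp ?A n k (src ?A n a) (src ?A n b)"
      "tgt ?A n (comp ?A (Suc n) k a b) = comp ?A n k (tgt ?A n a) (tgt ?A n b)"
      unfolding x'(2) unfolding x(2,4) sc[OF x'(1)] sc[OF x(1)] sc[OF x(3)] 
      using g k cl[OF k w(1)[OF x(1)] w(1)[OF x(3)]] cl[OF k w(2)[OF x(1)] w(2)[OF x(3)]] by simp_all
  next
    fix k n a b c assume k: "k < n" and ab: "composable ?A n k a b" and bc: "composable ?A n k b c"
    have m: "a \<in> carrier (free_cells S n)" "b \<in> carrier (free_cells S n)" "c \<in> carrier (free_cells S n)"
      using ab bc by simp_all
    obtain x where x1: "ceq S n x x" "a = ecls S n x" by (rule free_obtain[OF m(1)])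
    obtain y where x2: "ceq S n y y" "b = ecls S n y" by (rule free_obtain[OF m(2)])
    obtain z where x3: "ceq S n z z" "c = ecls S n z" by (rule free_obtain[OF m(3)])
    note x = x1 x2 x3
    have c: "ceq S k (down (etgt S) k n x) (down (esrc S) k n y)" "ceq S k (down (etgt S) k n y) (down (esrc S) k n z)"
      using ab[unfolded x, unfolded composable_cls[OF P k x(1,3)]]
        bc[unfolded x, unfolded composable_cls[OF P k x(3,5)]] .
    have u: "ceq S n (Comp k x y) (Comp k x y)" "ceq S n (Comp k y z) (Comp k y z)"
      by (rule ceq.comp[OF k x(1,3) c(1)], rule ceq.comp[OF k x(3,5) c(2)])
    have c2: "ceq S k (down (etgt S) k n (Comp k x y)) (down (esrc S) k n z)"
      "ceq S k (down (etgt S) k n x) (down (esrc S) k n (Comp k y z))"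
      using c k by (simp_all add: down_Comp)
    show "comp ?A n k (comp ?A n k a b) c = comp ?A n k a (comp ?A n k b c)"
      unfolding x cl[OF k x(1,3) c(1)] cl[OF k x(3,5) c(2)] cl[OF k u(1) x(5) c2(1)] cl[OF k x(1) u(2) c2(2)]
      by (rule ecls_ax[OF eq_axiom.comp_assoc ceq.comp[OF k u(1) x(5) c2(1)] ceq.comp[OF k x(1) u(2) c2(2)]])
  next
    fix k n a assume k: "k < n" and "a \<in> carrier (cell ?A n)"
    then have m: "a \<in> carrier (free_cells S n)" by simp
    obtain x where x: "ceq S n x x" "a = ecls S n x" by (rule free_obtain[OF m])
    have kn: "k \<le> n" using k by simp
    note d = down_cls[OF P x(1) kn]
    have e: "ceq S n (eid k n (down (esrc S) k n x)) (eid k n (down (esrc S) k n x))"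
      "ceq S n (eid k n (down (etgt S) k n x)) (eid k n (down (etgt S) k n x))"
      using d kn by (auto intro: eid_cong)
    have c: "ceq S k (down (etgt S) k n (eid k n (down (esrc S) k n x))) (down (esrc S) k n x)"
      "ceq S k (down (etgt S) k n x) (down (esrc S) k n (eid k n (down (etgt S) k n x)))"
      using d kn by (simp_all add: down_etgt_eid down_esrc_eid)
    show "comp ?A n k (up (idc ?A) k n (down (src ?A) k n a)) a = a"
      unfolding x(2) d up_cls[OF d(3) kn] cl[OF k e(1) x(1) c(1)]
      by (rule ecls_ax[OF eq_axiom.comp_idl ceq.comp[OF k e(1) x(1) c(1)] x(1)])
    show "comp ?A n k a (up (idc ?A) k n (down (tgt ?A) k n a)) = a"
      unfolding x(2) d up_cls[OF d(4) kn] cl[OF k x(1) e(2) c(2)]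
      by (rule ecls_ax[OF eq_axiom.comp_idr ceq.comp[OF k x(1) e(2) c(2)] x(1)])
  next
    fix k n a b assume k: "k < n" and c: "composable ?A n k a b"
    from c obtain x y where x: "ceq S n x x" "a = ecls S n x" "ceq S n y y" "b = ecls S n y"
      and cc: "ceq S k (down (etgt S) k n x) (down (esrc S) k n y)"
      and x': "ceq S n (Comp k x y) (Comp k x y)" "comp ?A n k a b = ecls S n (Comp k x y)"
      by (rule composable_obtain[OF P _ k])
    have kS: "k < Suc n" using k by simp
    have i: "ceq S (Suc n) (Idt x) (Idt x)" "ceq S (Suc n) (Idt y) (Idt y)" using x by (auto intro: ceq.idt)
    have c: "ceq S k (down (etgt S) k (Suc n) (Idt x)) (down (esrc S) k (Suc n) (Idt y))" using cc k by simp
    show "idc ?A n (comp ?A n k a b) = comp ?A (Suc n) k (idc ?A n a) (idc ?A n b)"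
      unfolding x'(2) unfolding x(2,4) idc_cls[OF x'(1)] idc_cls[OF x(1)] idc_cls[OF x(3)] cl[OF kS i c]
      by (rule ecls_ax[OF eq_axiom.idt_comp ceq.idt[OF x'(1)] ceq.comp[OF kS i c]])
  next
    fix j k n a b c d assume j: "j < k" and k: "k < n"
      and ab: "composable ?A n k a b" and cd: "composable ?A n k c d"
      and ac: "composable ?A n j a c" and bd: "composable ?A n j b d"
    have jn: "j < n" and jk: "j \<le> k" and kn: "k \<le> n" using j k by simp_all
    have m: "a \<in> carrier (free_cells S n)" "b \<in> carrier (free_cells S n)"
      "c \<in> carrier (free_cells S n)" "d \<in> carrier (free_cells S n)"
      using ab cd by simp_all
    obtain x where x1: "ceq S n x x" "a = ecls S n x" by (rule free_obtain[OF m(1)])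
    obtain y where x2: "ceq S n y y" "b = ecls S n y" by (rule free_obtain[OF m(2)])
    obtain z where x3: "ceq S n z z" "c = ecls S n z" by (rule free_obtain[OF m(3)])
    obtain t where x4: "ceq S n t t" "d = ecls S n t" by (rule free_obtain[OF m(4)])
    note x = x1 x2 x3 x4
    have u: "ceq S k (down (etgt S) k n x) (down (esrc S) k n y)" "ceq S k (down (etgt S) k n z) (down (esrc S) k n t)"
      "ceq S j (down (etgt S) j n x) (down (esrc S) j n z)" "ceq S j (down (etgt S) j n y) (down (esrc S) j n t)"
      using ab[unfolded x, unfolded composable_cls[OF P k x(1,3)]]
        cd[unfolded x, unfolded composable_cls[OF P k x(5,7)]]
        ac[unfolded x, unfolded composable_cls[OF P jn x(1,5)]]
        bd[unfolded x, unfolded composable_cls[OF P jn x(3,7)]] .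
    note v = ceq.comp[OF k x(1,3) u(1)] ceq.comp[OF k x(5,7) u(2)]
      ceq.comp[OF jn x(1,5) u(3)] ceq.comp[OF jn x(3,7) u(4)]
    have dc: "ceq S j (down (esrc S) j k p) (down (esrc S) j k q)"
      "ceq S j (down (etgt S) j k p) (down (etgt S) j k q)" if "ceq S k p q" for p q
      using down_cong_aux[OF _ that jk] bcong_glob[OF P] by blast+
    note dd = down_down[OF jk kn] and mx = down_mixed[OF P j kn]
    have "ceq S j (down (esrc S) j n t) (down (esrc S) j n z)"
      using ceq.trans[OF ceq.sym[OF dc(1)[OF u(2)]] mx[OF x(5), THEN conjunct1]] unfolding dd .
    from ceq.trans[OF u(4) this]
    have L': "ceq S j (down (etgt S) j n (Comp k x y)) (down (esrc S) j n (Comp k z t))"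
      unfolding dd[symmetric] down_Comp[OF k] .
    have "ceq S j (down (etgt S) j k (down (etgt S) k n x)) (down (esrc S) j k (down (etgt S) k n z))"
      using ceq.trans[OF u(3) ceq.sym[OF mx[OF x(5), THEN conjunct1]]] unfolding dd .
    from ceq.comp[OF j u(1,2) this]
    have R': "ceq S k (down (etgt S) k n (Comp j x z)) (down (esrc S) k n (Comp j y t))"
      unfolding down_Comp'[OF j kn] .
    show "comp ?A n j (comp ?A n k a b) (comp ?A n k c d) = comp ?A n k (comp ?A n j a c) (comp ?A n j b d)"
      unfolding x cl[OF k x(1,3) u(1)] cl[OF k x(5,7) u(2)] cl[OF jn x(1,5) u(3)] cl[OF jn x(3,7) u(4)]
        cl[OF jn v(1,2) L'] cl[OF k v(3,4) R']
      by (rule ecls_ax[OF eq_axiom.interchange[OF j] ceq.comp[OF jn v(1,2) L'] ceq.comp[OF k v(3,4) R']])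
  qed
qed


end

theory Submission
  imports Defs "HOL-Library.Multiset_Order"
begin

text \<open>
  A monomial is normal for the rules if and only if every bracket in it contains exactly one
  letter, that is, if it is a product of letters \<open>D\<^sup>i(x)\<close> (\<open>Nf_diff\<close>).  Normal monomials are
  therefore closed under products.  A generator \<open>u\<^sub>1|u\<^sub>2\<close> with \<open>u\<^sub>1\<close> nonempty, or one of higher
  dimension, would need a reducible product of two normal monomials; so the only generators are
  \<open>\<epsilon>|D(w)\<close> with \<open>w\<close> normal and not a single letter, all in dimension one.

  Hence every cell of dimension at least two is an identity (\<open>cells_identities\<close>), and acyclicity
  means that parallel \<open>1\<close>-cells are equal.  To see this, let \<open>\<rho>\<^sub>p\<close> be the cell from \<open>p\<close> to its
  normal form that reduces every monomial from the inside out.  It is multiplicative in \<open>p\<close>,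
  because reductions of two factors never interact, and
  \<open>\<rho>\<^bsub>D(p)\<^esub> = D(\<rho>\<^sub>p) \<star>\<^sub>0 \<rho>\<^bsub>D(p')\<^esub>\<close> for the normal form \<open>p'\<close> of \<open>p\<close>.  By induction over the
  construction of \<open>1\<close>-cells, \<open>f \<star>\<^sub>0 \<rho>\<^sub>q = \<rho>\<^sub>p\<close> for every \<open>f : p \<rightarrow> q\<close> (\<open>star_rho\<close>).  As
  \<open>f \<star>\<^sub>0 g = f + g - 1\<^sub>q\<close>, composition with \<open>\<rho>\<^sub>q\<close> is injective and \<open>f\<close> is determined by its
  boundary (\<open>arr_parallel_eq\<close>).  The contraction sends a cell \<open>a\<close> to \<open>\<rho>\<close> of its \<open>0\<close>-source,
  regarded as a cell of the right dimension.

  Normal forms are computed by a recursive map \<open>nrm\<close> on polynomials.  It is constant along rewriting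
  steps and the identity on normal polynomials, so an element has at most one normal form, namely
  its image under \<open>nrm\<close>; that it has one follows from termination, proved with a weight that turns
  \<open>D\<close> into squaring (\<open>nf_diff\<close>).  The same map shows that the polygraph presents the free
  differential algebra: the ideal of the differential relations and the ideal generated by the
  boundaries of the generators are both its kernel (\<open>diff_ideal_eq\<close>, \<open>pres_ideal_eq\<close>).

  Finally the structure on \<open>Sq\<close> is unique because the values of \<open>\<sigma>\<close> on the reducible \<open>D(w)\<close> force
  the source and the target of each generator (\<open>sq_structure_unique\<close>).
\<close>

section \<open>Linear extension\<close>

abbreviation "keys \<equiv> Poly_Mapping.keys"
abbreviation "lookup \<equiv> Poly_Mapping.lookup"
abbreviation "single \<equiv> Poly_Mapping.single"

lemma lookup_scale: "lookup (scale c p) u = c * lookup p u"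
  for c :: "'k::field"
  by (simp add: scale_def Poly_Mapping.map.rep_eq when_def)

lemma scale_simps [simp]:
  fixes c d :: "'k::field"
  shows "scale c (p + q) = scale c p + scale c q" "scale c 0 = 0" "scale 0 p = 0" "scale 1 p = p"
    "scale c (scale d p) = scale (c * d) p" "scale c (single u d) = single u (c * d)"
  by (rule poly_mapping_eqI; simp add: lookup_scale lookup_add algebra_simps lookup_single when_def)+

lemma scale_add_left: "scale (c + d) p = scale c p + scale d p" for c d :: "'k::field"
  by (rule poly_mapping_eqI) (simp add: lookup_scale lookup_add algebra_simps)

lemma scale_neg: "scale (-1) p = - p" for p :: "'a \<Rightarrow>\<^sub>0 'k::field"
  by (rule poly_mapping_eqI) (simp add: lookup_scale)

lemma scale_diff: "scale c (p - q) = scale c p - scale c q" for c :: "'k::field"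
  by (rule poly_mapping_eqI) (simp add: lookup_scale lookup_minus right_diff_distrib)

lemma scale_sum: "scale c (sum f I) = (\<Sum>i\<in>I. scale c (f i))" for c :: "'k::field"
  by (induction I rule: infinite_finite_induct) auto

lemma keys_scale: "keys (scale c p) \<subseteq> keys p" for c :: "'k::field"
  by (auto simp: in_keys_iff lookup_scale)

lemma poly_mapping_support_induct [consumes 1, case_names zero single add]:
  fixes p :: "'a \<Rightarrow>\<^sub>0 'k::comm_monoid_add"
  assumes "keys p \<subseteq> U" and "P 0" and "\<And>u c. u \<in> U \<Longrightarrow> P (single u c)"
    and "\<And>p q. keys p \<subseteq> U \<Longrightarrow> keys q \<subseteq> U \<Longrightarrow> P p \<Longrightarrow> P q \<Longrightarrow> P (p + q)"
  shows "P p"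
proof -
  have "P (\<Sum>u\<in>I. single u (lookup p u)) \<and> keys (\<Sum>u\<in>I. single u (lookup p u)) \<subseteq> U"
    if "finite I" "I \<subseteq> U" for I using that
  proof (induction I)
    case (insert v I)
    let ?s = "single v (lookup p v)" and ?r = "\<Sum>u\<in>I. single u (lookup p u)"
    have k: "keys ?s \<subseteq> U" "keys ?r \<subseteq> U" using insert by auto
    then have "keys (?s + ?r) \<subseteq> U" using Poly_Mapping.keys_add[of ?s ?r] by blast
    moreover have "P (?s + ?r)" by (rule assms(4)) (use k insert assms(3) in auto)
    ultimately show ?case using insert by simp
  qed (use assms(2) in simp)
  moreover have "(\<Sum>u\<in>keys p. single u (lookup p u)) = p"
    by (rule poly_mapping_eqI) (simp add: lookup_sum lookup_single when_def in_keys_iff)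
  ultimately show ?thesis using assms(1) by (metis finite_keys)
qed

lemma poly_mapping_induct [case_names zero single add]:
  fixes p :: "'a \<Rightarrow>\<^sub>0 'k::comm_monoid_add"
  assumes "P 0" and "\<And>u c. P (single u c)" and "\<And>p q. P p \<Longrightarrow> P q \<Longrightarrow> P (p + q)"
  shows "P p"
  using subset_UNIV[of "keys p"] by (induction rule: poly_mapping_support_induct) (use assms in auto)

text \<open>In contrast to \<open>lin_ext\<close>, the values on monomials may be arbitrary polynomials.\<close>

definition linx :: "('a \<Rightarrow> 'b \<Rightarrow>\<^sub>0 'k) \<Rightarrow> ('a \<Rightarrow>\<^sub>0 'k) \<Rightarrow> ('b \<Rightarrow>\<^sub>0 'k::field)" where
  "linx h p = (\<Sum>u\<in>keys p. scale (lookup p u) (h u))"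

lemma linx_superset:
  assumes "finite I" "keys p \<subseteq> I"
  shows "linx h p = (\<Sum>u\<in>I. scale (lookup p u) (h u))"
  unfolding linx_def by (rule sum.mono_neutral_left) (use assms in \<open>auto simp: in_keys_iff\<close>)

lemma linx_add [simp]: "linx h (p + q) = linx h p + linx h q"
  using linx_superset[of "keys p \<union> keys q" p h] linx_superset[of "keys p \<union> keys q" q h]
    linx_superset[of "keys p \<union> keys q" "p + q" h] Poly_Mapping.keys_add[of p q]
  by (auto simp: lookup_add scale_add_left sum.distrib)

lemma linx_single [simp]: "linx h (single u c) = scale c (h u)"
  by (simp add: linx_superset[of "{u}"] lookup_single)

lemma linx_zero [simp]: "linx h 0 = 0"
  by (simp add: linx_def)

lemma linx_scale [simp]: "linx h (scale c p) = scale c (linx h p)"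
  by (induction p rule: poly_mapping_induct) auto

lemma linx_minus: "linx h (p - q) = linx h p - linx h q"
  using linx_add[of h "p - q" q] by simp

lemma keys_linx: "keys (linx h p) \<subseteq> (\<Union>u\<in>keys p. keys (h u))"
  unfolding linx_def using keys_scale by (fastforce dest!: subsetD[OF keys_sum])

lemma linx_cong: "(\<And>u. u \<in> keys p \<Longrightarrow> h u = h' u) \<Longrightarrow> linx h p = linx h' p"
  by (simp add: linx_def)

lemma linx_mon [simp]: "linx mon p = p"
  by (induction p rule: poly_mapping_induct) auto

lemma lin_ext_linx: "lin_ext f = linx (\<lambda>u. mon (f u))"
  by (rule ext) (simp add: lin_ext_def linx_def)

lemma scale_mult [simp]:
  fixes p q :: "('k::field, 'z, 'w) opoly"
  shows "scale c p * q = scale c (p * q)" "p * scale c q = scale c (p * q)"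
proof -
  have "scale c (single u d) * q = scale c (single u d * q) \<and> q * scale c (single u d) = scale c (q * single u d)"
    for u d and q :: "('k::field, 'z, 'w) opoly"
    by (induction q rule: poly_mapping_induct) (auto simp: mult_single algebra_simps)
  then have s: "scale c (single u d) * q = scale c (single u d * q)"
    "q * scale c (single u d) = scale c (q * single u d)" for u d and q :: "('k::field, 'z, 'w) opoly"
    by blast+
  show "scale c p * q = scale c (p * q)"
    by (induction p rule: poly_mapping_induct) (simp_all only: s scale_simps(1,2) mult_zero_left distrib_right)
  show "p * scale c q = scale c (p * q)"
    by (induction q rule: poly_mapping_induct) (simp_all only: s scale_simps(1,2) mult_zero_right distrib_left)
qed

lemma mon_mult: "mon u * mon v = (mon (u @ v) :: ('k::field, 'z, 'w) opoly)"
  by (simp add: mult_single plus_list_def)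

lemma mon_Nil: "mon [] = (1 :: ('k::field, 'z, 'w) opoly)"
  by (simp flip: zero_list_def)

lemma single_as_scale: "single u c = scale c (mon u)" for c :: "'k::field"
  by simp

lemma linx_mult:
  fixes h :: "('z, 'w) mono \<Rightarrow> ('k::field, 'z, 'w) opoly"
  assumes "\<And>u v. h (u @ v) = h u * h v"
  shows "linx h (p * q) = linx h p * linx h q"
proof (induction p rule: poly_mapping_induct)
  case (single u c)
  show ?case
    by (induction q rule: poly_mapping_induct) (simp_all add: mult_single plus_list_def assms mult.commute distrib_left)
qed (simp_all add: distrib_right)

lemma brk_linx: "brk \<tau> = linx (\<lambda>u. mon [Br \<tau> u])"
  by (simp add: brk_def lin_ext_linx)

section \<open>Normal monomials and the derivation\<close>

text \<open>The elements of \<open>D\<^sup>\<theta>(Z)\<close> are words of length one; it is convenient to speak of their letters, so that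
  \<open>(D\<^sup>\<theta>(Z))\<^sup>*\<close> consists of the words in these letters.\<close>

definition Dletters :: "'z set \<Rightarrow> ('z, diff_op) letter set" where
  "Dletters Z = {l. [l] \<in> Dtheta Z}"

lemma Dtheta_singleton:
  fixes u :: "('z, diff_op) mono"
  shows "u \<in> Dtheta Z \<Longrightarrow> \<exists>l. u = [l]"
proof -
  have "\<exists>l. (dop ^^ i) [Atom x] = [l]" for i and x :: 'z by (induction i) auto
  then show "u \<in> Dtheta Z \<Longrightarrow> \<exists>l. u = [l]" by (auto simp: Dtheta_def)
qed

lemma Dtheta_eq: "Dtheta Z = (\<lambda>l. [l]) ` Dletters Z"
  using Dtheta_singleton by (fastforce simp: Dletters_def)

lemma Dtheta_star_iff: "u \<in> Dtheta_star Z \<longleftrightarrow> set u \<subseteq> Dletters Z"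
proof
  assume "u \<in> Dtheta_star Z"
  then show "set u \<subseteq> Dletters Z" by (fastforce simp: Dtheta_star_def Dtheta_eq)
next
  assume "set u \<subseteq> Dletters Z"
  then have "map (\<lambda>l. [l]) u \<in> lists (Dtheta Z)" unfolding Dtheta_eq by (auto intro!: imageI)
  moreover have "u = concat (map (\<lambda>l. [l]) u)" by simp
  ultimately show "u \<in> Dtheta_star Z" unfolding Dtheta_star_def by (metis image_eqI)
qed

lemma Atom_Dletters [simp]: "Atom x \<in> Dletters Z \<longleftrightarrow> x \<in> Z"
proof
  assume "Atom x \<in> Dletters Z"
  then obtain i y where y: "y \<in> Z" "[Atom x] = (dop ^^ i) [Atom y]"
    unfolding Dletters_def Dtheta_def by blast
  then show "x \<in> Z" by (cases i) simp_all
next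
  assume "x \<in> Z"
  moreover have "[Atom x] = (dop ^^ 0) [Atom x]" by simp
  ultimately show "Atom x \<in> Dletters Z" unfolding Dletters_def Dtheta_def by blast
qed

lemma Br_Dletters [simp]: "Br \<tau> u \<in> Dletters Z \<longleftrightarrow> (\<exists>l\<in>Dletters Z. u = [l])"
proof
  assume "Br \<tau> u \<in> Dletters Z"
  then obtain i x where x: "x \<in> Z" "[Br \<tau> u] = (dop ^^ i) [Atom x]"
    unfolding Dletters_def Dtheta_def by blast
  then obtain j where "i = Suc j" by (cases i) auto
  then have "u = (dop ^^ j) [Atom x]" using x by simp
  then have "u \<in> Dtheta Z" using x unfolding Dtheta_def by blast
  then show "\<exists>l\<in>Dletters Z. u = [l]" by (auto simp: Dtheta_eq)
next
  assume "\<exists>l\<in>Dletters Z. u = [l]"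
  then obtain i x where "x \<in> Z" "u = (dop ^^ i) [Atom x]" unfolding Dletters_def Dtheta_def by blast
  moreover have "\<tau> = Diff" by (cases \<tau>)
  ultimately have "x \<in> Z" "[Br \<tau> u] = (dop ^^ Suc i) [Atom x]" by simp_all
  then show "Br \<tau> u \<in> Dletters Z" unfolding Dletters_def Dtheta_def by blast
qed

lemma Dletters_gens: "l \<in> Dletters Z \<Longrightarrow> set1_letter l \<subseteq> Z"
  by (induction l) auto

lemma omonoid_simps [simp]:
  "[] \<in> omonoid Z" "u @ v \<in> omonoid Z \<longleftrightarrow> u \<in> omonoid Z \<and> v \<in> omonoid Z"
  "l # v \<in> omonoid Z \<longleftrightarrow> set1_letter l \<subseteq> Z \<and> v \<in> omonoid Z"
  by (auto simp: omonoid_def)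

lemma set1_Br [simp]: "set1_letter (Br \<tau> u) \<subseteq> Z \<longleftrightarrow> u \<in> omonoid Z"
  by (auto simp: omonoid_def)

lemma Dtheta_star_omonoid: "Dtheta_star Z \<subseteq> omonoid Z"
  using Dletters_gens by (fastforce simp: Dtheta_star_iff omonoid_def)

text \<open>The normal form of \<open>D(w)\<close> for a normal word \<open>w\<close>, obtained by splitting off one letter at a time with
  \<open>D(lv) = D(l)v + lD(v) + \<lambda>D(l)D(v)\<close>.  It agrees with the right-hand side of the rule for \<open>D(w)\<close>
  by \<open>rhs_der\<close>.\<close>

primrec der :: "'k \<Rightarrow> ('z, diff_op) mono \<Rightarrow> ('k::field, 'z, diff_op) opoly" where
  "der lam [] = 0"
| "der lam (l # v) = mon (dop [l]) * mon v + mon [l] * der lam v + scale lam (mon (dop [l]) * der lam v)"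

lemma der_append:
  fixes lam :: "'k::field" and u v :: "('z, diff_op) mono"
  shows "der lam (u @ v) = der lam u * mon v + mon u * der lam v + scale lam (der lam u * der lam v)"
proof (induction u)
  case Nil
  then show ?case by (simp add: mon_Nil)
next
  case (Cons l u)
  have ring: "P * (U * V) + Q * (dU * V + U * dV + scale lam (dU * dV))
      + scale lam (P * (dU * V + U * dV + scale lam (dU * dV)))
    = (P * U + Q * dU + scale lam (P * dU)) * V + (Q * U) * dV
      + scale lam ((P * U + Q * dU + scale lam (P * dU)) * dV)"
    for P Q U V dU dV :: "('k, 'z, diff_op) opoly"
    by (simp only: distrib_left distrib_right mult.assoc scale_simps scale_mult) (simp only: add_ac)
  have "mon (u @ v) = (mon u * mon v :: ('k, 'z, diff_op) opoly)"
    "mon (l # u) = (mon [l] * mon u :: ('k, 'z, diff_op) opoly)" by (simp_all add: mon_mult)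
  then show ?case unfolding append_Cons der.simps Cons.IH by (simp only: ring)
qed

text \<open>The differential identity holds for \<open>der\<close> on all polynomials, and not only modulo the relations,
  because \<open>der\<close> treats every letter alike.\<close>

lemma linx_der_mult:
  fixes lam :: "'k::field" and p q :: "('k, 'z, diff_op) opoly"
  shows "linx (der lam) (p * q) = linx (der lam) p * q + p * linx (der lam) q +
     scale lam (linx (der lam) p * linx (der lam) q)"
proof (induction p rule: poly_mapping_induct)
  case (single u c)
  show ?case
  proof (induction q rule: poly_mapping_induct)
    case (single v d)
    let ?U = "mon u :: ('k, 'z, diff_op) opoly" and ?V = "mon v :: ('k, 'z, diff_op) opoly"
    have "linx (der lam) (scale c ?U * scale d ?V) = scale (c * d) (der lam (u @ v))"
      unfolding scale_mult mon_mult linx_scale linx_single by (simp add: mult.commute)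
    then show ?case
      unfolding single_as_scale[of u c] single_as_scale[of v d] linx_scale linx_single der_append scale_mult
      by (simp add: mult.commute)
  qed (simp_all only: linx_zero linx_add distrib_left scale_simps mult_zero_right add_0_right add_ac)
qed (simp_all only: linx_zero linx_add distrib_right scale_simps mult_zero_left add_0_right add_ac)

lemma der_letter: "der lam [l] = mon (dop [l])"
  by (simp add: mon_mult)

lemma keys_mult_append:
  fixes p q :: "('k::field, 'z, 'w) opoly"
  shows "keys (p * q) \<subseteq> {u @ v | u v. u \<in> keys p \<and> v \<in> keys q}"
  using keys_mult[of p q] by (auto simp: plus_list_def)

lemma keys_der:
  fixes lam :: "'k::field"
  assumes "v \<in> keys (der lam w)" "w \<in> Dtheta_star (Z :: 'z set)"
  shows "v \<in> Dtheta_star Z \<and> length v = length w"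
  using assms
proof (induction w arbitrary: v)
  case (Cons l w)
  let ?A = "mon (dop [l]) * mon w :: ('k, 'z, diff_op) opoly" and ?B = "mon [l] * der lam w" and ?C = "scale lam (mon (dop [l]) * der lam w)"
  have l: "l \<in> Dletters Z" and w: "w \<in> Dtheta_star Z" using Cons.prems by (auto simp: Dtheta_star_iff)
  have "v \<in> keys ((?A + ?B) + ?C)" using Cons.prems(1) by simp
  then have "v \<in> keys (?A + ?B) \<union> keys ?C" by (rule subsetD[OF Poly_Mapping.keys_add])
  moreover have "keys (?A + ?B) \<subseteq> keys ?A \<union> keys ?B" by (rule Poly_Mapping.keys_add)
  moreover have "keys ?C \<subseteq> keys (mon (dop [l]) * der lam w)" by (rule keys_scale)
  ultimately have "v \<in> keys ?A \<or> v \<in> keys ?B \<or> v \<in> keys (mon (dop [l]) * der lam w)"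
    by (meson UnE subsetD)
  then obtain m v' where "v = m @ v'" "m = dop [l] \<or> m = [l]" "v' = w \<or> v' \<in> keys (der lam w)"
  proof (elim disjE)
    assume "v \<in> keys ?A"
    then have "v = dop [l] @ w" by (simp add: mon_mult)
    then show thesis using that by blast
  next
    assume "v \<in> keys ?B"
    from subsetD[OF keys_mult_append this] show thesis using that[of "[l]"] that[of "dop [l]"] by auto
  next
    assume "v \<in> keys (mon (dop [l]) * der lam w)"
    from subsetD[OF keys_mult_append this] show thesis using that[of "[l]"] that[of "dop [l]"] by auto
  qed
  then show ?case using Cons.IH[OF _ w] l w by (auto simp: Dtheta_star_iff)
qed simp

section \<open>The normal form of a monomial\<close>

text \<open>Brackets are reduced from the inside out: the content of a bracket is normalised before \<open>der\<close> is applied.\<close>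

primrec nrm_letter :: "'k \<Rightarrow> ('z, diff_op) letter \<Rightarrow> ('k::field, 'z, diff_op) opoly" where
  "nrm_letter lam (Atom x) = mon [Atom x]"
| "nrm_letter lam (Br \<tau> u) = linx (der lam) (prod_list (map (nrm_letter lam) u))"

definition nrm_mono :: "'k \<Rightarrow> ('z, diff_op) mono \<Rightarrow> ('k::field, 'z, diff_op) opoly" where
  "nrm_mono lam u = prod_list (map (nrm_letter lam) u)"

abbreviation nrm :: "'k \<Rightarrow> ('k, 'z, diff_op) opoly \<Rightarrow> ('k::field, 'z, diff_op) opoly" where
  "nrm lam \<equiv> linx (nrm_mono lam)"

lemma nrm_mono_simps [simp]:
  "nrm_mono lam [] = 1" "nrm_mono lam (u @ v) = nrm_mono lam u * nrm_mono lam v"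
  "nrm_mono lam [Br \<tau> u] = linx (der lam) (nrm_mono lam u)" "nrm_mono lam [Atom x] = mon [Atom x]"
  by (simp_all add: nrm_mono_def)

lemma nrm_mono_Cons: "nrm_mono lam (l # u) = nrm_letter lam l * nrm_mono lam u"
  by (simp add: nrm_mono_def)

lemma nrm_mult [simp]: "nrm lam (p * q) = nrm lam p * nrm lam q"
  by (rule linx_mult) simp

lemma nrm_brk [simp]: "nrm lam (brk \<tau> p) = linx (der lam) (nrm lam p)"
  by (induction p rule: poly_mapping_induct) (simp_all add: brk_linx)

lemma nrm_letter_Dletters: "l \<in> Dletters Z \<Longrightarrow> nrm_letter lam l = mon [l]"
proof (induction l)
  case (Br \<tau> u)
  then obtain l where u: "u = [l]" "l \<in> Dletters Z" by auto
  have "dop u = [Br \<tau> u]" by (cases \<tau>) simp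
  then show ?case using Br.IH[of l] u by (simp add: der_letter mon_mult)
qed simp

lemma nrm_mono_normal: "u \<in> Dtheta_star Z \<Longrightarrow> nrm_mono lam u = mon u"
  by (induction u) (auto simp: Dtheta_star_iff nrm_mono_Cons nrm_letter_Dletters mon_mult mon_Nil)

lemma nrm_normal: "keys p \<subseteq> Dtheta_star Z \<Longrightarrow> nrm lam p = p"
  using linx_cong[of p "nrm_mono lam" mon] nrm_mono_normal by fastforce

lemma keys_linx_der: "keys p \<subseteq> Dtheta_star Z \<Longrightarrow> keys (linx (der lam) p) \<subseteq> Dtheta_star Z"
  using keys_linx[of "der lam" p] keys_der by blast

lemma keys_mult_subset:
  fixes p q :: "('k::field, 'z, diff_op) opoly"
  assumes "keys p \<subseteq> Dtheta_star Z" "keys q \<subseteq> Dtheta_star Z"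
  shows "keys (p * q) \<subseteq> Dtheta_star Z"
  using keys_mult_append[of p q] assms by (fastforce simp: Dtheta_star_iff)

lemma Nil_normal: "0 \<in> Dtheta_star Z"
  by (simp add: Dtheta_star_iff zero_list_def)

lemma keys_nrm_letter: "set1_letter l \<subseteq> Z \<Longrightarrow> keys (nrm_letter lam l) \<subseteq> Dtheta_star Z"
proof (induction l)
  case (Br \<tau> u)
  have "keys (prod_list (map (nrm_letter lam) u)) \<subseteq> Dtheta_star Z"
    using Br by (induction u) (simp_all add: keys_mult_subset Nil_normal)
  then show ?case by (simp add: keys_linx_der)
qed (simp add: Dtheta_star_iff)

lemma keys_nrm_mono: "u \<in> omonoid Z \<Longrightarrow> keys (nrm_mono lam u) \<subseteq> Dtheta_star Z"
  by (induction u) (simp_all add: nrm_mono_Cons keys_mult_subset keys_nrm_letter Nil_normal)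

lemma keys_nrm: "keys p \<subseteq> omonoid Z \<Longrightarrow> keys (nrm lam p) \<subseteq> Dtheta_star Z"
  using keys_linx[of "nrm_mono lam" p] keys_nrm_mono by blast

lemma nrm_nrm: "keys p \<subseteq> omonoid Z \<Longrightarrow> nrm lam (nrm lam p) = nrm lam p"
  by (rule nrm_normal, rule keys_nrm)

section \<open>The right-hand sides of the rules\<close>

text \<open>The sum over \<open>k\<close> and over the sets of size \<open>k\<close> is a sum over all nonempty sets \<open>I\<close> of positions.
  For a word \<open>wl\<close> these are the nonempty sets of positions of \<open>w\<close>, the last position alone, and the
  nonempty sets of positions of \<open>w\<close> together with the last one; they give the three terms of the
  differential identity for \<open>D(wl)\<close>.\<close>

lemma rhs_der:
  fixes lam :: "'k::field" and w :: "('z, diff_op) mono"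
  shows "rhs (diff_polygraph Z lam) (map (\<lambda>l. [l]) w) = der lam w"
proof -
  \<comment> \<open>\<open>T w I\<close> is \<open>w\<close> with \<open>D\<close> applied at the positions in \<open>I\<close>, and \<open>G w\<close> sums over all nonempty \<open>I\<close>.\<close>
  define T where "T = (\<lambda>w I. concat (map (\<lambda>i. if i \<in> I then dop [w ! i] else [w ! i]) [0..<length w]) :: ('z, diff_op) mono)"
  define F where "F = (\<lambda>w I. single (T w I) (lam ^ (card I - 1)))"
  define G where "G = (\<lambda>w. \<Sum>I\<in>Pow {..<length w} - {{}}. F w I)"
  have "rhs (diff_polygraph Z lam) (map (\<lambda>l. [l]) w) =
      (\<Sum>k = 1..length w. \<Sum>I | I \<subseteq> {..<length w} \<and> card I = k. F w I)"
    unfolding diff_polygraph_def F_def T_def polygraph1.simps length_map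
    by (intro sum.cong refl arg_cong2[of _ _ _ _ Poly_Mapping.single] arg_cong[of _ _ concat]) auto
  also have "\<dots> = (\<Sum>I\<in>(\<Union>k\<in>{1..length w}. {I. I \<subseteq> {..<length w} \<and> card I = k}). F w I)"
    by (rule sum.UNION_disjoint[symmetric]) auto
  also have "(\<Union>k\<in>{1..length w}. {I. I \<subseteq> {..<length w} \<and> card I = k}) = Pow {..<length w} - {{}}"
  proof -
    have "card I \<in> {1..length w}" if "I \<subseteq> {..<length w}" "I \<noteq> {}" for I
      using that card_mono[OF finite_lessThan that(1)] finite_subset[OF that(1) finite_lessThan]
      by (simp add: Suc_le_eq card_gt_0_iff)
    then show ?thesis by (auto; metis empty_iff)
  qed
  finally have "rhs (diff_polygraph Z lam) (map (\<lambda>l. [l]) w) = G w" unfolding G_def .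
  moreover have "G w = der lam w"
  proof (induction w rule: rev_induct)
    case Nil
    then show ?case by (simp add: G_def)
  next
    case (snoc l w)
    let ?n = "length w"
    have T0: "T (w @ [l]) I = T w I @ [l]" if "I \<subseteq> {..<?n}" for I
      using that by (auto simp: T_def nth_append intro!: arg_cong[of _ _ concat])
    have T1: "T (w @ [l]) (insert ?n I) = T w I @ dop [l]" if "I \<subseteq> {..<?n}" for I
      by (auto simp: T_def nth_append intro!: arg_cong[of _ _ concat])
    have Te: "T w {} = w" by (simp add: T_def map_nth)
    have F0: "F (w @ [l]) I = F w I * mon [l]" if "I \<in> Pow {..<?n} - {{}}" for I
      using that by (simp add: F_def T0 mult_single plus_list_def)
    have F1: "F (w @ [l]) (insert ?n I) = scale lam (F w I * mon (dop [l]))" if "I \<in> Pow {..<?n} - {{}}" for I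
    proof -
      have "finite I" "?n \<notin> I" using that finite_subset[of I "{..<?n}"] by auto
      then have "card (insert ?n I) - 1 = Suc (card I - 1)" using that by (simp add: card_gt_0_iff Suc_leI)
      then show ?thesis using that by (simp add: F_def T1 mult_single plus_list_def)
    qed
    have Fe: "F (w @ [l]) {?n} = mon w * mon (dop [l])"
      using T1[of "{}"] by (simp add: F_def Te mon_mult)
    have split: "Pow {..<length (w @ [l])} - {{}} =
        (Pow {..<?n} - {{}}) \<union> (insert {?n} (insert ?n ` (Pow {..<?n} - {{}})))"
      by (auto simp: lessThan_Suc Pow_insert)
    have inj: "inj_on (insert ?n) (Pow {..<?n} - {{}})"
    proof (rule inj_onI)
      fix I J assume "I \<in> Pow {..<?n} - {{}}" "J \<in> Pow {..<?n} - {{}}" and e: "insert ?n I = insert ?n J"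
      then have "?n \<notin> I" "?n \<notin> J" by auto
      then show "I = J" using e by (simp add: insert_ident)
    qed
    have ne: "{?n} \<notin> insert ?n ` (Pow {..<?n} - {{}})" by auto
    have s0: "sum (F (w @ [l])) (Pow {..<?n} - {{}}) = (\<Sum>I\<in>Pow {..<?n} - {{}}. F w I * mon [l])"
      by (rule sum.cong[OF refl F0])
    have s1: "sum (F (w @ [l]) \<circ> insert ?n) (Pow {..<?n} - {{}}) =
        (\<Sum>I\<in>Pow {..<?n} - {{}}. scale lam (F w I * mon (dop [l])))"
      by (rule sum.cong[OF refl]) (simp add: F1 del: scale_mult)
    have "G (w @ [l]) = sum (F (w @ [l])) (Pow {..<?n} - {{}}) +
        (F (w @ [l]) {?n} + sum (F (w @ [l])) (insert ?n ` (Pow {..<?n} - {{}})))"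
      unfolding G_def split
      by (subst sum.union_disjoint) (auto simp: sum.insert[OF _ ne])
    also have "\<dots> = G w * mon [l] + (mon w * mon (dop [l]) + scale lam (G w * mon (dop [l])))"
      unfolding sum.reindex[OF inj] G_def sum_distrib_right scale_sum s0 s1 Fe
      by (simp only: add_ac)
    also have "\<dots> = der lam (w @ [l])"
      unfolding der_append snoc der_letter by (simp add: add_ac)
    finally show ?case .
  qed
  ultimately show ?thesis by simp
qed

section \<open>Rewriting\<close>

lemma Union_set1_letter [simp]: "\<Union> (set1_letter ` set u) \<subseteq> Z \<longleftrightarrow> u \<in> omonoid Z"
  by (auto simp: omonoid_def)

text \<open>Contexts with one hole as functions on monomials.  The inductive form, without the extra generator for the
  hole, is the one over which inductions run.\<close>

inductive_set one_hole :: "'z set \<Rightarrow> (('z, 'w) mono \<Rightarrow> ('z, 'w) mono) set" for Z where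
  hole: "a \<in> omonoid Z \<Longrightarrow> b \<in> omonoid Z \<Longrightarrow> (\<lambda>v. a @ v @ b) \<in> one_hole Z"
| under: "a \<in> omonoid Z \<Longrightarrow> b \<in> omonoid Z \<Longrightarrow> f \<in> one_hole Z \<Longrightarrow> (\<lambda>v. a @ [Br \<tau> (f v)] @ b) \<in> one_hole Z"

lemma plug_simps [simp]:
  "plug [] v = []" "plug (q @ r) v = plug q v @ plug r v"
  "plug [Br \<tau> q] v = [Br \<tau> (plug q v)]" "plug [Atom None] v = v"
  by (simp_all add: plug_def)

lemma plug_Cons: "plug (l # q) v = plug_letter v l @ plug q v"
  by (simp add: plug_def)

abbreviation "with_hole Z \<equiv> omonoid (insert None (Some ` Z))"

lemma holes_simps [simp]:
  "holes [] = 0" "holes (q @ r) = holes q + holes r" "holes (l # q) = holes_letter l + holes q"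
  by (simp_all add: holes_def)

lemma plug_letter_no_hole:
  "holes_letter l = 0 \<Longrightarrow> set1_letter l \<subseteq> insert None (Some ` Z) \<Longrightarrow>
     plug_letter v l = plug_letter [] l \<and> plug_letter [] l \<in> omonoid Z"
proof (induction l)
  case (Atom y)
  then show ?case by (cases y) auto
next
  case (Br \<tau> q)
  have "concat (map (plug_letter v) q) = concat (map (plug_letter []) q) \<and>
      concat (map (plug_letter []) q) \<in> omonoid Z"
    using Br by (induction q) auto
  then show ?case unfolding plug_letter.simps omonoid_simps set1_Br by simp
qed

lemma plug_no_hole:
  "holes q = 0 \<Longrightarrow> q \<in> with_hole Z \<Longrightarrow> plug q v = plug q [] \<and> plug q [] \<in> omonoid Z"
proof (induction q)
  case (Cons l q)
  have "plug_letter v l = plug_letter [] l \<and> plug_letter [] l \<in> omonoid Z"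
    using Cons.prems by (intro plug_letter_no_hole) auto
  moreover have "plug q v = plug q [] \<and> plug q [] \<in> omonoid Z"
    using Cons by simp
  ultimately show ?case by (simp add: plug_Cons)
qed simp

text \<open>The letter that carries the hole is either the hole itself or a bracket around a smaller context.\<close>

lemma plug_one_hole: "q \<in> contexts Z \<Longrightarrow> plug q \<in> one_hole Z"
proof (induction q rule: measure_induct_rule[of "size_list size"])
  case (less q)
  have q: "holes q = 1" "q \<in> with_hole Z" using less.prems by (auto simp: contexts_def)
  then have "\<exists>x l y. q = x @ l # y \<and> holes_letter l = 1 \<and> holes x = 0 \<and> holes y = 0"
  proof (induction q)
    case (Cons l q)
    show ?case
    proof (cases "holes_letter l = 0")
      case True
      then obtain x l' y where "q = x @ l' # y" "holes_letter l' = 1" "holes x = 0" "holes y = 0"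
        using Cons by auto
      then show ?thesis using True by (intro exI[of _ "l # x"] exI[of _ l'] exI[of _ y]) simp
    next
      case False
      then show ?thesis using Cons.prems by (intro exI[of _ "[]"] exI[of _ l] exI[of _ q]) auto
    qed
  qed simp
  then obtain x l y where e: "q = x @ l # y" and l: "holes_letter l = 1" and h: "holes x = 0" "holes y = 0"
    by blast
  have m: "x \<in> with_hole Z" "y \<in> with_hole Z" "set1_letter l \<subseteq> insert None (Some ` Z)" using q e by auto
  define a b where "a = plug x []" and "b = plug y []"
  have a: "a \<in> omonoid Z" "\<And>v. plug x v = a" using plug_no_hole[OF h(1) m(1)] by (auto simp: a_def)
  have b: "b \<in> omonoid Z" "\<And>v. plug y v = b" using plug_no_hole[OF h(2) m(2)] by (auto simp: b_def)
  have p: "plug q = (\<lambda>v. a @ plug_letter v l @ b)" unfolding e by (rule ext) (simp add: plug_Cons a b)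
  show ?case
  proof (cases l)
    case (Atom z)
    then have "z = None" using l by (auto split: if_splits)
    then show ?thesis using one_hole.hole[OF a(1) b(1)] by (simp add: p Atom)
  next
    case (Br \<tau> r)
    have "r \<in> contexts Z" using l m(3) Br by (auto simp: contexts_def holes_def omonoid_def)
    then have "plug r \<in> one_hole Z" by (rule less.IH[rotated]) (simp add: e Br)
    moreover have "plug q = (\<lambda>v. a @ [Br \<tau> (plug r v)] @ b)"
      unfolding p Br by (simp add: plug_def)
    ultimately show ?thesis using one_hole.under[OF a(1) b(1)] by metis
  qed
qed

lemma plug_letter_Some: "plug_letter v (map_letter Some (\<lambda>w. w) l) = [l]"
proof (induction l)
  case (Br \<tau> u)
  then have "concat (map (plug_letter v) (map (map_letter Some (\<lambda>w. w)) u)) = u"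
    by (induction u) auto
  then show ?case by simp
qed simp

lemma plug_Some: "plug (map (map_letter Some (\<lambda>w. w)) u) v = u"
  by (induction u) (simp_all add: plug_Cons plug_letter_Some)

lemma holes_letter_Some: "holes_letter (map_letter Some (\<lambda>w. w) l) = 0"
  by (induction l) (auto simp: comp_def)

lemma holes_Some: "holes (map (map_letter Some (\<lambda>w. w)) u) = 0"
  by (induction u) (auto simp: holes_letter_Some)

lemma omonoid_Some: "u \<in> omonoid Z \<Longrightarrow> map (map_letter Some (\<lambda>w. w)) u \<in> with_hole Z"
  by (induction u) (auto simp: letter.set_map)

lemma one_hole_plug: "f \<in> one_hole Z \<Longrightarrow> \<exists>q\<in>contexts Z. f = plug q"
proof (induction rule: one_hole.induct)
  case (hole a b)
  let ?q = "map (map_letter Some (\<lambda>w. w)) a @ [Atom None] @ map (map_letter Some (\<lambda>w. w)) b"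
  have "?q \<in> contexts Z" using hole by (simp add: contexts_def holes_Some omonoid_Some)
  moreover have "(\<lambda>v. a @ v @ b) = plug ?q" by (rule ext) (simp add: plug_Some plug_Cons)
  ultimately show ?case by blast
next
  case (under a b f \<tau>)
  then obtain q where q: "q \<in> contexts Z" "f = plug q" by blast
  let ?q = "map (map_letter Some (\<lambda>w. w)) a @ [Br \<tau> q] @ map (map_letter Some (\<lambda>w. w)) b"
  have "q \<in> with_hole Z" "holes q = 1" using q(1) by (auto simp: contexts_def)
  moreover have "holes ?q = holes q" by (simp add: holes_Some) (simp add: holes_def)
  ultimately have "?q \<in> contexts Z"
    using under unfolding contexts_def omonoid_simps set1_Br by (simp add: omonoid_Some)
  moreover have "(\<lambda>v. a @ [Br \<tau> (f v)] @ b) = plug ?q"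
    by (rule ext, simp add: plug_Some q(2) plug_Cons) (simp add: plug_def)
  ultimately show ?case by blast
qed

section \<open>Rewriting steps of the differential rules\<close>

lemma in_carrier_iff [simp]: "p \<in> carrier (free_opalg Z) \<longleftrightarrow> keys p \<subseteq> omonoid Z"
  by (simp add: free_opalg_def)

lemma zgens_diff [simp]: "zgens (diff_polygraph Z lam) = Z"
  by (simp add: diff_polygraph_def)

lemma rules_diff: "rules (diff_polygraph Z lam) =
    (\<lambda>w. map (\<lambda>l. [l]) w) ` {w \<in> Dtheta_star Z. length w \<noteq> 1}"
proof
  have "map (\<lambda>l. [l]) w \<in> rules (diff_polygraph Z lam)" if "set w \<subseteq> Dletters Z" "length w \<noteq> 1" for w
  proof (cases "w = []")
    case False
    then have "2 \<le> length w" using that(2) by (cases w; cases "tl w") auto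
    then show ?thesis using that(1) by (auto simp: diff_polygraph_def Dtheta_eq intro!: imageI)
  qed (simp add: diff_polygraph_def)
  then show "(\<lambda>w. map (\<lambda>l. [l]) w) ` {w \<in> Dtheta_star Z. length w \<noteq> 1} \<subseteq> rules (diff_polygraph Z lam)"
    by (auto simp: Dtheta_star_iff)
next
  show "rules (diff_polygraph Z lam) \<subseteq> (\<lambda>w. map (\<lambda>l. [l]) w) ` {w \<in> Dtheta_star Z. length w \<noteq> 1}"
  proof
    fix us assume "us \<in> rules (diff_polygraph Z lam)"
    then have us: "set us \<subseteq> (\<lambda>l. [l]) ` Dletters Z" "length us \<noteq> 1"
      by (auto simp: diff_polygraph_def Dtheta_eq)
    have "\<exists>w. us = map (\<lambda>l. [l]) w \<and> w \<in> Dtheta_star Z" using us(1)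
    proof (induction us)
      case (Cons u us)
      then obtain w l where "us = map (\<lambda>l. [l]) w" "w \<in> Dtheta_star Z" "u = [l]" "l \<in> Dletters Z" by auto
      then show ?case by (intro exI[of _ "l # w"]) (simp add: Dtheta_star_iff)
    qed (simp add: Dtheta_star_iff)
    then show "us \<in> (\<lambda>w. map (\<lambda>l. [l]) w) ` {w \<in> Dtheta_star Z. length w \<noteq> 1}" using us(2) by auto
  qed
qed

lemma lhs_diff: "lhs (diff_polygraph Z lam) (map (\<lambda>l. [l]) w) = dop w"
  by (simp add: diff_polygraph_def)

text \<open>The form of rewriting steps that suits inductions over the context of the rewritten bracket.\<close>

lemma rstep_diff_iff:
  "rstep (diff_polygraph Z lam) a b \<longleftrightarrow> (\<exists>\<mu> f w c. \<mu> \<noteq> 0 \<and> f \<in> one_hole Z \<and> w \<in> Dtheta_star Z \<and>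
     length w \<noteq> 1 \<and> keys c \<subseteq> omonoid Z \<and> f (dop w) \<notin> keys c \<and>
     a = single (f (dop w)) \<mu> + c \<and> b = scale \<mu> (lin_ext f (der lam w)) + c)" (is "?L \<longleftrightarrow> ?R")
proof
  assume ?L
  then obtain \<mu> q \<alpha> c where h: "\<mu> \<noteq> 0" "q \<in> contexts Z" "\<alpha> \<in> rules (diff_polygraph Z lam)"
    "keys c \<subseteq> omonoid Z" "plug q (lhs (diff_polygraph Z lam) \<alpha>) \<notin> keys c"
    "a = scale \<mu> (mon (plug q (lhs (diff_polygraph Z lam) \<alpha>))) + c"
    "b = scale \<mu> (lin_ext (plug q) (rhs (diff_polygraph Z lam) \<alpha>)) + c"
    unfolding rstep_def by auto
  obtain w where w: "\<alpha> = map (\<lambda>l. [l]) w" "w \<in> Dtheta_star Z" "length w \<noteq> 1"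
    using h(3) unfolding rules_diff by blast
  show ?R using h(1,4-7) w(2,3) plug_one_hole[OF h(2)] unfolding w(1) lhs_diff rhs_der
    by (intro exI[of _ \<mu>] exI[of _ "plug q"] exI[of _ w] exI[of _ c]) simp
next
  assume ?R
  then obtain \<mu> f w c where h: "\<mu> \<noteq> 0" "f \<in> one_hole Z" "w \<in> Dtheta_star Z" "length w \<noteq> 1"
    "keys c \<subseteq> omonoid Z" "f (dop w) \<notin> keys c"
    "a = single (f (dop w)) \<mu> + c" "b = scale \<mu> (lin_ext f (der lam w)) + c" by blast
  obtain q where q: "q \<in> contexts Z" "f = plug q" using one_hole_plug[OF h(2)] by blast
  have "map (\<lambda>l. [l]) w \<in> rules (diff_polygraph Z lam)" unfolding rules_diff using h(3,4) by blast
  then show ?L unfolding rstep_def using h q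
    by (intro exI[of _ \<mu>] exI[of _ q] exI[of _ "map (\<lambda>l. [l]) w"] exI[of _ c]) (simp add: lhs_diff rhs_der)
qed

lemma one_hole_omonoid: "f \<in> one_hole Z \<Longrightarrow> v \<in> omonoid Z \<Longrightarrow> f v \<in> omonoid Z"
  by (induction rule: one_hole.induct) auto

lemma one_hole_normal: "f \<in> one_hole Z \<Longrightarrow> f v \<in> Dtheta_star Z' \<Longrightarrow> v \<in> Dtheta_star Z'"
  by (induction rule: one_hole.induct) (auto simp: Dtheta_star_iff)

text \<open>Among the brackets whose content is not a single letter, an innermost one has normal content, so it is
  the left-hand side of a rule.\<close>

lemma reducible_one_hole:
  fixes u :: "('z, diff_op) mono"
  assumes "u \<in> omonoid Z" "u \<notin> Dtheta_star Z"
  shows "\<exists>f\<in>one_hole Z. \<exists>w\<in>Dtheta_star Z. length w \<noteq> 1 \<and> u = f (dop w)"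
  using assms
proof (induction u rule: measure_induct_rule[of "size_list size"])
  case (less u)
  then obtain l where l: "l \<in> set u" "l \<notin> Dletters Z" by (auto simp: Dtheta_star_iff)
  then obtain x y where u: "u = x @ l # y" by (meson split_list)
  have m: "x \<in> omonoid Z" "y \<in> omonoid Z" "set1_letter l \<subseteq> Z" using less.prems u by auto
  then obtain v where v: "l = Br Diff v" using l by (cases l) (auto intro: diff_op.exhaust)
  have vZ: "v \<in> omonoid Z" using m v by simp
  show ?case
  proof (cases "v \<in> Dtheta_star Z")
    case True
    have "length v \<noteq> 1"
    proof
      assume "length v = 1"
      then obtain l' where "v = [l']" by (auto simp: length_Suc_conv)
      then show False using l True v by (auto simp: Dtheta_star_iff)
    qed
    with v u have "length v \<noteq> 1 \<and> u = x @ dop v @ y" by simp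
    then show ?thesis
      by - (rule bexI[OF _ one_hole.hole[OF m(1,2)]], rule bexI[OF _ True])
  next
    case False
    have "size_list size v < size_list size u" by (simp add: u v)
    from less.IH[OF this vZ False] obtain f w where f: "f \<in> one_hole Z" "w \<in> Dtheta_star Z" "length w \<noteq> 1" "v = f (dop w)"
      by blast
    then have "length w \<noteq> 1 \<and> u = x @ [Br Diff (f (dop w))] @ y" by (simp add: u v)
    then show ?thesis
      by - (rule bexI[OF _ one_hole.under[OF m(1,2) f(1), of Diff]], rule bexI[OF _ f(2)])
  qed
qed

lemma normal_form_diff_iff:
  "normal_form (diff_polygraph Z lam) p \<longleftrightarrow> keys p \<subseteq> Dtheta_star Z"
proof
  assume n: "normal_form (diff_polygraph Z lam) p"
  show "keys p \<subseteq> Dtheta_star Z"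
  proof (rule ccontr)
    assume "\<not> keys p \<subseteq> Dtheta_star Z"
    then obtain u where u: "u \<in> keys p" "u \<notin> Dtheta_star Z" by blast
    have pZ: "keys p \<subseteq> omonoid Z" using n by (simp add: normal_form_def)
    then obtain f w where f: "f \<in> one_hole Z" "w \<in> Dtheta_star Z" "length w \<noteq> 1" "u = f (dop w)"
      using reducible_one_hole[of u Z] u by blast
    let ?c = "p - single u (lookup p u)"
    have "keys ?c \<subseteq> keys p - {u}" by (auto simp: in_keys_iff lookup_minus lookup_single when_def split: if_splits)
    then have "keys ?c \<subseteq> omonoid Z" "u \<notin> keys ?c" using pZ by auto
    moreover have "p = single u (lookup p u) + ?c" by simp
    moreover have "lookup p u \<noteq> 0" using u by (simp add: in_keys_iff)
    ultimately have "\<exists>b. rstep (diff_polygraph Z lam) p b"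
      unfolding rstep_diff_iff using f by blast
    then show False using n by (auto simp: normal_form_def)
  qed
next
  assume k: "keys p \<subseteq> Dtheta_star Z"
  have False if r: "rstep (diff_polygraph Z lam) p b" for b
  proof -
    obtain \<mu> f w c where h: "\<mu> \<noteq> 0" "f \<in> one_hole Z" "w \<in> Dtheta_star Z" "length w \<noteq> 1"
      "f (dop w) \<notin> keys c" "p = single (f (dop w)) \<mu> + c" using r unfolding rstep_diff_iff by blast
    have "f (dop w) \<in> keys p" using h by (simp add: in_keys_iff lookup_add)
    then have "dop w \<in> Dtheta_star Z" using k one_hole_normal[OF h(2)] by blast
    then show False using h(4) by (auto simp: Dtheta_star_iff)
  qed
  then show "normal_form (diff_polygraph Z lam) p"
    using k Dtheta_star_omonoid by (auto simp: normal_form_def)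
qed

lemma lin_ext_hole:
  fixes r :: "('k::field, 'z, 'w) opoly"
  shows "lin_ext (\<lambda>v. a @ v @ b) r = mon a * r * mon b"
    and "lin_ext (\<lambda>v. a @ [Br \<tau> (f v)] @ b) r = mon a * brk \<tau> (lin_ext f r) * mon b"
proof -
  have m: "mon (a @ v @ b) = (mon a * mon v * mon b :: ('k, 'z, 'w) opoly)" for v by (simp add: mon_mult)
  have add: "mon a * (p + q) * mon b = mon a * p * mon b + mon a * q * mon b" for p q :: "('k, 'z, 'w) opoly"
    by (simp only: distrib_left distrib_right)
  have s: "mon a * single v c * mon b = (scale c (mon a * mon v * mon b) :: ('k, 'z, 'w) opoly)" for v and c :: 'k
    by (simp only: single_as_scale[of v c] scale_mult)
  show "lin_ext (\<lambda>v. a @ v @ b) r = mon a * r * mon b"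
    unfolding lin_ext_linx m
  proof (induction r rule: poly_mapping_induct)
    case (single v c)
    show ?case unfolding linx_single by (rule s[symmetric])
  qed (simp_all only: linx_add linx_zero add mult_zero_right mult_zero_left)
  have "mon (a @ [Br \<tau> (f v)] @ b) = (mon a * brk \<tau> (mon (f v)) * mon b :: ('k, 'z, 'w) opoly)" for v
    by (simp add: mon_mult brk_linx)
  then show "lin_ext (\<lambda>v. a @ [Br \<tau> (f v)] @ b) r = mon a * brk \<tau> (lin_ext f r) * mon b"
    unfolding lin_ext_linx brk_linx
    by (induction r rule: poly_mapping_induct) (simp_all only: linx_add linx_single linx_scale linx_zero add scale_mult mult_zero_right mult_zero_left)
qed

text \<open>The normal form of \<open>f w\<close> depends on \<open>w\<close> only through the normal form of \<open>w\<close>, and it does so linearly.\<close>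

lemma nrm_one_hole:
  assumes "f \<in> one_hole Z" "nrm lam r = nrm_mono lam w"
  shows "nrm lam (lin_ext f r) = nrm_mono lam (f w)"
  using assms
proof (induction rule: one_hole.induct)
  case (hole a b)
  then show ?case by (simp add: lin_ext_hole(1) mult.assoc)
next
  case (under a b f \<tau>)
  then show ?case unfolding lin_ext_hole(2) nrm_mono_simps by (simp add: mult.assoc)
qed

lemma nrm_rstep: "rstep (diff_polygraph Z lam) a b \<Longrightarrow> nrm lam a = nrm lam b"
proof -
  assume "rstep (diff_polygraph Z lam) a b"
  then obtain \<mu> f w c where h: "f \<in> one_hole Z" "w \<in> Dtheta_star Z"
    "a = single (f (dop w)) \<mu> + c" "b = scale \<mu> (lin_ext f (der lam w)) + c"
    unfolding rstep_diff_iff by blast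
  have "nrm lam (der lam w) = nrm_mono lam (dop w)"
    using h(2) keys_der[of _ lam w Z] by (subst nrm_normal[of _ Z]) (auto simp: nrm_mono_normal)
  from nrm_one_hole[OF h(1) this] show ?thesis by (simp add: h)
qed

text \<open>Products become sums and \<open>D\<close> becomes squaring.  Letters of \<open>D\<^sup>\<theta>(Z)\<close> have weight one, so that
  \<open>D(u\<^sub>1\<dots>u\<^sub>n)\<close> has weight \<open>n\<^sup>2\<close> while each monomial on the other side of its rule has weight \<open>n\<close>.\<close>

primrec wt_letter :: "('z, 'w) letter \<Rightarrow> nat" where
  "wt_letter (Atom x) = 1"
| "wt_letter (Br \<tau> u) = (sum_list (map wt_letter u))\<^sup>2"

definition wt :: "('z, 'w) mono \<Rightarrow> nat" where
  "wt u = sum_list (map wt_letter u)"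

lemma wt_simps [simp]: "wt (u @ v) = wt u + wt v" "wt [Br \<tau> u] = (wt u)\<^sup>2"
  by (simp_all add: wt_def)

lemma wt_Dletters: "l \<in> Dletters Z \<Longrightarrow> wt_letter l = 1"
  by (induction l) auto

lemma wt_normal: "u \<in> Dtheta_star Z \<Longrightarrow> wt u = length u"
  by (induction u) (auto simp: Dtheta_star_iff wt_def wt_Dletters)

text \<open>For the empty word the weights would be equal, but then \<open>der\<close> has no monomial at all.\<close>

lemma wt_der:
  assumes "w \<in> Dtheta_star Z" "length w \<noteq> 1" "v \<in> keys (der lam w)"
  shows "wt v < wt (dop w)"
proof -
  have v: "v \<in> Dtheta_star Z" "length v = length w" using keys_der assms by blast+
  have "w \<noteq> []" using assms(3) by auto
  then have "1 < length w" using assms(2) by (cases w) auto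
  then have "length w * 1 < length w * length w" by (intro mult_strict_left_mono) auto
  then show ?thesis using v assms(1) by (simp add: wt_normal power2_eq_square)
qed

lemma wt_one_hole: "f \<in> one_hole Z \<Longrightarrow> wt v < wt w \<Longrightarrow> wt (f v) < wt (f w)"
  by (induction rule: one_hole.induct) (simp_all only: wt_simps power_strict_mono add_less_cancel_left add_less_cancel_right zero_le zero_less_numeral)

text \<open>A step replaces a monomial by finitely many monomials of smaller weight, which decreases the multiset
  of the weights even if monomials merge or cancel.\<close>

definition wts :: "('k::zero, 'z, 'w) opoly \<Rightarrow> nat multiset" where
  "wts p = image_mset wt (mset_set (keys p))"

lemma mset_set_Un: "finite A \<Longrightarrow> finite B \<Longrightarrow> mset_set (A \<union> B) \<subseteq># mset_set A + mset_set B"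
  by (rule mset_subset_eqI) (simp add: count_mset_set')

lemma keys_scale_add: "keys (scale \<mu> p + c) \<subseteq> keys p \<union> keys c" for \<mu> :: "'k::field"
  using Poly_Mapping.keys_add[of "scale \<mu> p" c] keys_scale[of \<mu> p] by blast

lemma wts_rstep:
  assumes "rstep (diff_polygraph Z lam) a b"
  shows "wts b < wts a"
proof -
  obtain \<mu> f w c where h: "\<mu> \<noteq> 0" "f \<in> one_hole Z" "w \<in> Dtheta_star Z" "length w \<noteq> 1"
    "f (dop w) \<notin> keys c"
    "a = single (f (dop w)) \<mu> + c" "b = scale \<mu> (lin_ext f (der lam w)) + c"
    using assms unfolding rstep_diff_iff by blast
  let ?K = "f ` keys (der lam w)"
  have "keys b \<subseteq> keys (lin_ext f (der lam w)) \<union> keys c"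
    unfolding h(7) by (rule keys_scale_add)
  moreover have "keys (lin_ext f (der lam w)) \<subseteq> ?K"
    using keys_linx[of "\<lambda>u. mon (f u)" "der lam w"] unfolding lin_ext_linx by auto
  ultimately have b: "keys b \<subseteq> keys c \<union> ?K" by blast
  have "keys a = insert (f (dop w)) (keys c)"
    using h(1,5) unfolding h(6) by (auto simp: in_keys_iff lookup_add lookup_single when_def split: if_splits)
  then have a: "wts a = wts c + {# wt (f (dop w)) #}" using h(5) by (simp add: wts_def)
  have "mset_set (keys b) \<subseteq># mset_set (keys c) + mset_set ?K"
    by (rule subset_mset.order_trans[OF subset_imp_msubset_mset_set[OF b] mset_set_Un]) simp_all
  then have "wts b \<subseteq># wts c + image_mset wt (mset_set ?K)"
    unfolding wts_def image_mset_union[symmetric] by (rule image_mset_subseteq_mono)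
  then have "wts b \<le> wts c + image_mset wt (mset_set ?K)" by (rule subset_eq_imp_le_multiset)
  also have "image_mset wt (mset_set ?K) < {# wt (f (dop w)) #}"
    by (rule ex_gt_imp_less_multiset) (use wt_one_hole[OF h(2) wt_der[OF h(3,4)]] in auto)
  then have "wts c + image_mset wt (mset_set ?K) < wts a" unfolding a by simp
  finally show ?thesis .
qed

lemma rstep_carrier:
  assumes "rstep (diff_polygraph Z lam) a b"
  shows "keys b \<subseteq> omonoid Z"
proof -
  obtain \<mu> f w c where h: "f \<in> one_hole Z" "w \<in> Dtheta_star Z" "keys c \<subseteq> omonoid Z"
    "b = scale \<mu> (lin_ext f (der lam w)) + c"
    using assms unfolding rstep_diff_iff by blast
  have "keys (der lam w) \<subseteq> omonoid Z" using keys_der[OF _ h(2)] Dtheta_star_omonoid by blast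
  then have "keys (lin_ext f (der lam w)) \<subseteq> omonoid Z"
    using keys_linx[of "\<lambda>u. mon (f u)" "der lam w"] one_hole_omonoid[OF h(1)] unfolding lin_ext_linx by fastforce
  then show ?thesis unfolding h(4) using h(3) keys_scale_add[of \<mu> "lin_ext f (der lam w)" c] by blast
qed

lemma normal_form_exists:
  "keys a \<subseteq> omonoid Z \<Longrightarrow> \<exists>b. (rstep (diff_polygraph Z lam))\<^sup>*\<^sup>* a b \<and> normal_form (diff_polygraph Z lam) b"
proof (induction a rule: measure_induct_rule[of wts])
  case (less a)
  show ?case
  proof (cases "normal_form (diff_polygraph Z lam) a")
    case False
    then obtain b where "rstep (diff_polygraph Z lam) a b" using less.prems by (auto simp: normal_form_def)
    then show ?thesis using less.IH[OF wts_rstep rstep_carrier] by (meson converse_rtranclp_into_rtranclp)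
  qed blast
qed

text \<open>No confluence argument is needed: \<open>nrm\<close> is invariant under rewriting and fixes normal elements, so any
  normal form that is reached equals \<open>nrm lam a\<close>.\<close>

lemma nf_diff:
  assumes "keys a \<subseteq> omonoid Z"
  shows "nf (diff_polygraph Z lam) a = nrm lam a"
proof -
  have inv: "nrm lam a = nrm lam b" if "(rstep (diff_polygraph Z lam))\<^sup>*\<^sup>* a b" for b
    using that by induction (auto dest: nrm_rstep)
  have u: "b = nrm lam a" if "(rstep (diff_polygraph Z lam))\<^sup>*\<^sup>* a b" "normal_form (diff_polygraph Z lam) b" for b
    using inv[OF that(1)] nrm_normal[of b Z lam] that(2) by (simp add: normal_form_diff_iff)
  obtain b where "(rstep (diff_polygraph Z lam))\<^sup>*\<^sup>* a b" "normal_form (diff_polygraph Z lam) b"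
    using normal_form_exists[OF assms] by blast
  then show ?thesis unfolding nf_def using u by (intro the_equality) blast+
qed

lemma Nf_diff: "Nf (diff_polygraph Z lam) = Dtheta_star Z"
  using Dtheta_star_omonoid by (auto simp: Nf_def normal_form_diff_iff)

section \<open>The generators\<close>

lemma sq_heads_diff: "sq_heads (diff_polygraph Z lam) = (\<lambda>l. [l]) ` Dletters Z"
proof -
  have "u \<in> sq_heads (diff_polygraph Z lam) \<longleftrightarrow> u \<in> (\<lambda>l. [l]) ` Dletters Z" for u
    by (cases u; cases "hd u") (auto simp: sq_heads_def Nf_diff Dtheta_star_iff)
  then show ?thesis by blast
qed

lemma reducible_diff: "reducible_monos (diff_polygraph Z lam) = omonoid Z - Dtheta_star Z"
  by (simp add: reducible_monos_def Nf_diff)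

lemma min_reducible_dop:
  "w \<in> Dtheta_star Z \<Longrightarrow> min_reducible (diff_polygraph Z lam) (dop w) \<longleftrightarrow> length w \<noteq> 1"
  using Dtheta_star_omonoid[of Z]
  by (auto simp: min_reducible_def reducible_diff Nf_diff Dtheta_star_iff strict_prefix_def length_Suc_conv prefix_Cons
      split: list.splits)

text \<open>Case (a) of the definition does not occur, since a product of two normal monomials is normal.\<close>

lemma sq_gens_1_diff:
  "sq_gens (diff_polygraph Z lam) 1 = (\<lambda>w. [[], dop w]) ` {w \<in> Dtheta_star Z. length w \<noteq> 1}"
proof -
  have "\<not> min_reducible (diff_polygraph Z lam) (u @ v)" if "u \<in> sq_heads (diff_polygraph Z lam)" "v \<in> Dtheta_star Z" for u v
    using that by (auto simp: min_reducible_def reducible_diff sq_heads_diff Dtheta_star_iff)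
  then have "sq_gens (diff_polygraph Z lam) 1 = {[[], [Br \<tau> u]] | \<tau> u. u \<in> Dtheta_star Z \<and> min_reducible (diff_polygraph Z lam) [Br \<tau> u]}"
    by (auto simp: sq_gens_def Nf_diff)
  also have "\<dots> = (\<lambda>w. [[], dop w]) ` {w \<in> Dtheta_star Z. length w \<noteq> 1}"
  proof -
    have "\<tau> = Diff" for \<tau> by (cases \<tau>)
    then have "(\<exists>\<tau> u. us = [[], [Br \<tau> u]] \<and> u \<in> Dtheta_star Z \<and> min_reducible (diff_polygraph Z lam) [Br \<tau> u]) \<longleftrightarrow>
        (\<exists>u. us = [[], dop u] \<and> u \<in> Dtheta_star Z \<and> length u \<noteq> 1)" for us
      using min_reducible_dop[of _ Z lam] by metis
    then show ?thesis by auto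
  qed
  finally show ?thesis .
qed

lemma sq_gens_ge2_diff:
  assumes "2 \<le> n"
  shows "sq_gens (diff_polygraph Z lam) n = {}"
proof -
  have False if us: "us ! 0 \<in> sq_heads (diff_polygraph Z lam)" "us ! 1 \<in> Dtheta_star Z"
    "min_reducible (diff_polygraph Z lam) (us ! 0 @ us ! 1)" for us
    using us by (auto simp: min_reducible_def reducible_diff sq_heads_diff Dtheta_star_iff)
  then show ?thesis using assms by (fastforce simp: sq_gens_def Nf_diff)
qed

lemma sq_gens_0: "sq_gens X 0 = {}"
  by (simp add: sq_gens_def)

text \<open>A word of length other than one is empty or a product of two nonempty words.\<close>

lemma sq_gens_1_products:
  "sq_gens (diff_polygraph Z lam) 1 = {[[], dop []]} \<union>
     {[[], dop (u @ v)] | u v. u \<in> Dtheta_star Z - {[]} \<and> v \<in> Dtheta_star Z - {[]}}"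
proof -
  have "w \<in> Dtheta_star Z \<and> length w \<noteq> 1 \<longleftrightarrow>
      w = [] \<or> (\<exists>u v. w = u @ v \<and> u \<in> Dtheta_star Z - {[]} \<and> v \<in> Dtheta_star Z - {[]})" for w
  proof (cases w)
    case (Cons l v)
    show ?thesis
    proof
      assume "w \<in> Dtheta_star Z \<and> length w \<noteq> 1"
      then show "w = [] \<or> (\<exists>u v. w = u @ v \<and> u \<in> Dtheta_star Z - {[]} \<and> v \<in> Dtheta_star Z - {[]})"
        using Cons by (intro disjI2 exI[of _ "[l]"] exI[of _ v]) (auto simp: Dtheta_star_iff)
    next
      assume "w = [] \<or> (\<exists>u v. w = u @ v \<and> u \<in> Dtheta_star Z - {[]} \<and> v \<in> Dtheta_star Z - {[]})"
      then obtain u v where "w = u @ v" "u \<in> Dtheta_star Z" "u \<noteq> []" "v \<in> Dtheta_star Z" "v \<noteq> []" using Cons by auto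
      then show "w \<in> Dtheta_star Z \<and> length w \<noteq> 1" by (cases u; cases v) (auto simp: Dtheta_star_iff)
    qed
  qed (simp add: Dtheta_star_iff)
  then show ?thesis unfolding sq_gens_1_diff by (auto 0 3)
qed

section \<open>Homomorphisms and quotients of operated algebras\<close>

lemma op_homD:
  assumes "f \<in> op_hom M N"
  shows "x \<in> carrier M \<Longrightarrow> f x \<in> carrier N"
    "x \<in> carrier M \<Longrightarrow> y \<in> carrier M \<Longrightarrow> f (x \<otimes>\<^bsub>M\<^esub> y) = f x \<otimes>\<^bsub>N\<^esub> f y"
    "x \<in> carrier M \<Longrightarrow> y \<in> carrier M \<Longrightarrow> f (x \<oplus>\<^bsub>M\<^esub> y) = f x \<oplus>\<^bsub>N\<^esub> f y"
    "f \<one>\<^bsub>M\<^esub> = \<one>\<^bsub>N\<^esub>" "x \<in> carrier M \<Longrightarrow> f (c \<odot>\<^bsub>M\<^esub> x) = c \<odot>\<^bsub>N\<^esub> f x"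
    "x \<in> carrier M \<Longrightarrow> f (oper M \<tau> x) = oper N \<tau> (f x)"
  using assms unfolding op_hom_def linear_hom_def by (auto simp: ring_hom_def)

lemma operated_algebraD:
  assumes "operated_algebra M"
  shows "ring M" "x \<in> carrier M \<Longrightarrow> c \<odot>\<^bsub>M\<^esub> x \<in> carrier M"
    "x \<in> carrier M \<Longrightarrow> y \<in> carrier M \<Longrightarrow> c \<odot>\<^bsub>M\<^esub> (x \<oplus>\<^bsub>M\<^esub> y) = c \<odot>\<^bsub>M\<^esub> x \<oplus>\<^bsub>M\<^esub> c \<odot>\<^bsub>M\<^esub> y"
    "x \<in> carrier M \<Longrightarrow> (c + d) \<odot>\<^bsub>M\<^esub> x = c \<odot>\<^bsub>M\<^esub> x \<oplus>\<^bsub>M\<^esub> d \<odot>\<^bsub>M\<^esub> x"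
    "x \<in> carrier M \<Longrightarrow> (c * d) \<odot>\<^bsub>M\<^esub> x = c \<odot>\<^bsub>M\<^esub> (d \<odot>\<^bsub>M\<^esub> x)"
    "x \<in> carrier M \<Longrightarrow> 1 \<odot>\<^bsub>M\<^esub> x = x"
    "x \<in> carrier M \<Longrightarrow> y \<in> carrier M \<Longrightarrow> (c \<odot>\<^bsub>M\<^esub> x) \<otimes>\<^bsub>M\<^esub> y = c \<odot>\<^bsub>M\<^esub> (x \<otimes>\<^bsub>M\<^esub> y)"
    "x \<in> carrier M \<Longrightarrow> y \<in> carrier M \<Longrightarrow> x \<otimes>\<^bsub>M\<^esub> (c \<odot>\<^bsub>M\<^esub> y) = c \<odot>\<^bsub>M\<^esub> (x \<otimes>\<^bsub>M\<^esub> y)"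
    "x \<in> carrier M \<Longrightarrow> oper M \<tau> x \<in> carrier M"
    "x \<in> carrier M \<Longrightarrow> y \<in> carrier M \<Longrightarrow> oper M \<tau> (x \<oplus>\<^bsub>M\<^esub> y) = oper M \<tau> x \<oplus>\<^bsub>M\<^esub> oper M \<tau> y"
    "x \<in> carrier M \<Longrightarrow> oper M \<tau> (c \<odot>\<^bsub>M\<^esub> x) = c \<odot>\<^bsub>M\<^esub> oper M \<tau> x"
  using assms unfolding operated_algebra_def linear_hom_def by auto

lemma smult_zero:
  assumes "operated_algebra M" "x \<in> carrier M"
  shows "0 \<odot>\<^bsub>M\<^esub> x = \<zero>\<^bsub>M\<^esub>" "c \<odot>\<^bsub>M\<^esub> \<zero>\<^bsub>M\<^esub> = \<zero>\<^bsub>M\<^esub>"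
proof -
  note o = operated_algebraD[OF assms(1)]
  interpret ring M by (rule o(1))
  have "0 \<odot>\<^bsub>M\<^esub> x \<oplus>\<^bsub>M\<^esub> 0 \<odot>\<^bsub>M\<^esub> x = 0 \<odot>\<^bsub>M\<^esub> x" using o(4)[of x 0 0] assms(2) by simp
  then show "0 \<odot>\<^bsub>M\<^esub> x = \<zero>\<^bsub>M\<^esub>" using o(2)[OF assms(2)] by (metis add.r_cancel_one)
  have "c \<odot>\<^bsub>M\<^esub> \<zero>\<^bsub>M\<^esub> \<oplus>\<^bsub>M\<^esub> c \<odot>\<^bsub>M\<^esub> \<zero>\<^bsub>M\<^esub> = c \<odot>\<^bsub>M\<^esub> \<zero>\<^bsub>M\<^esub>" using o(3)[of "\<zero>\<^bsub>M\<^esub>" "\<zero>\<^bsub>M\<^esub>" c] by simp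
  then show "c \<odot>\<^bsub>M\<^esub> \<zero>\<^bsub>M\<^esub> = \<zero>\<^bsub>M\<^esub>" using o(2)[OF zero_closed] by (metis add.r_cancel_one)
qed

lemma minus_smult:
  assumes "operated_algebra M" "x \<in> carrier M"
  shows "\<ominus>\<^bsub>M\<^esub> x = (-1) \<odot>\<^bsub>M\<^esub> x"
proof -
  note o = operated_algebraD[OF assms(1)]
  interpret ring M by (rule o(1))
  have "(-1) \<odot>\<^bsub>M\<^esub> x \<oplus>\<^bsub>M\<^esub> x = \<zero>\<^bsub>M\<^esub>"
    using o(4)[of x "-1" 1] o(6)[of x] smult_zero(1)[OF assms] assms(2) by simp
  then show ?thesis using o(2)[OF assms(2)] assms(2) by (metis minus_equality)
qed

lemma op_hom_minus:
  assumes "operated_algebra M" "operated_algebra N" "f \<in> op_hom M N" "x \<in> carrier M" "y \<in> carrier M"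
  shows "f (x \<ominus>\<^bsub>M\<^esub> y) = f x \<ominus>\<^bsub>N\<^esub> f y" "f \<zero>\<^bsub>M\<^esub> = \<zero>\<^bsub>N\<^esub>"
proof -
  note o = operated_algebraD[OF assms(1)] and f = op_homD[OF assms(3)]
  show "f (x \<ominus>\<^bsub>M\<^esub> y) = f x \<ominus>\<^bsub>N\<^esub> f y"
    using assms(4,5) o(2) f(1,3,5) by (simp add: a_minus_def minus_smult[OF assms(1)] minus_smult[OF assms(2)])
  have "f (0 \<odot>\<^bsub>M\<^esub> x) = 0 \<odot>\<^bsub>N\<^esub> f x" using f(5) assms(4) by simp
  then show "f \<zero>\<^bsub>M\<^esub> = \<zero>\<^bsub>N\<^esub>" using smult_zero(1) assms f(1) by metis
qed

lemma op_ideal_vimage: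
  assumes "operated_algebra M" "operated_algebra N" "f \<in> op_hom M N" "op_ideal J N"
  shows "op_ideal {x \<in> carrier M. f x \<in> J} M"
proof -
  note o = operated_algebraD[OF assms(1)] and f = op_homD[OF assms(3)]
  interpret M: ring M by (rule o(1))
  interpret J: ideal J N using assms(4) by (simp add: op_ideal_def)
  have z: "f \<zero>\<^bsub>M\<^esub> = \<zero>\<^bsub>N\<^esub>" using op_hom_minus(2)[OF assms(1-3) M.zero_closed M.zero_closed] .
  have J: "x \<in> J \<Longrightarrow> c \<odot>\<^bsub>N\<^esub> x \<in> J" "x \<in> J \<Longrightarrow> oper N \<tau> x \<in> J" for x c \<tau>
    using assms(4) by (auto simp: op_ideal_def)
  have "ideal {x \<in> carrier M. f x \<in> J} M"
  proof (rule idealI[OF o(1)])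
    show "subgroup {x \<in> carrier M. f x \<in> J} (add_monoid M)"
    proof (rule M.add.subgroupI)
      show "{x \<in> carrier M. f x \<in> J} \<noteq> {}" using z by auto
    next
      fix a assume a: "a \<in> {x \<in> carrier M. f x \<in> J}"
      then have "f (\<ominus>\<^bsub>M\<^esub> a) = (-1) \<odot>\<^bsub>N\<^esub> f a" using f(5) by (simp add: minus_smult[OF assms(1)])
      then show "\<ominus>\<^bsub>M\<^esub> a \<in> {x \<in> carrier M. f x \<in> J}" using a J(1) by auto
    qed (use f in auto)
  qed (use f J.I_l_closed J.I_r_closed in auto)
  then show ?thesis using J f o(2,9) by (simp add: op_ideal_def)
qed

lemma gen_op_ideal_least: "op_ideal J M \<Longrightarrow> R \<subseteq> J \<Longrightarrow> gen_op_ideal M R \<subseteq> J"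
  by (auto simp: gen_op_ideal_def)

lemma op_ideal_carrier: "operated_algebra M \<Longrightarrow> op_ideal (carrier M) M"
  using ring.oneideal[OF operated_algebraD(1)] operated_algebraD(2,9) by (fastforce simp: op_ideal_def)

lemma gen_op_ideal_ideal:
  assumes "operated_algebra M" "R \<subseteq> carrier M"
  shows "op_ideal (gen_op_ideal M R) M" "R \<subseteq> gen_op_ideal M R"
proof -
  let ?S = "{I. op_ideal I M \<and> R \<subseteq> I}"
  have ne: "?S \<noteq> {}" using op_ideal_carrier[OF assms(1)] assms(2) by blast
  have "ideal (\<Inter>?S) M"
    by (rule ring.i_Intersect[OF operated_algebraD(1)[OF assms(1)] _ ne]) (simp add: op_ideal_def)
  then show "op_ideal (gen_op_ideal M R) M" by (auto simp: op_ideal_def gen_op_ideal_def)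
  show "R \<subseteq> gen_op_ideal M R" by (auto simp: gen_op_ideal_def)
qed

locale op_quotient =
  fixes M :: "('k::field, 'c, 'w) opalg" and I :: "'c set"
  assumes alg: "operated_algebra M" and idl: "op_ideal I M"
begin

sublocale ideal I M
  using idl by (simp add: op_ideal_def)

lemmas o = operated_algebraD[OF alg]

lemma coset_eq_iff:
  "x \<in> carrier M \<Longrightarrow> y \<in> carrier M \<Longrightarrow> I +>\<^bsub>M\<^esub> x = I +>\<^bsub>M\<^esub> y \<longleftrightarrow> x \<ominus>\<^bsub>M\<^esub> y \<in> I"
  using quotient_eq_iff_same_a_r_cos[OF is_ideal] by blast

lemma coset_carrier: "X \<in> carrier (op_quot M I) \<longleftrightarrow> (\<exists>x\<in>carrier M. X = I +>\<^bsub>M\<^esub> x)"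
  by (auto simp: op_quot_def FactRing_def A_RCOSETS_def')

lemma coset_member: "x \<in> carrier M \<Longrightarrow> y \<in> I +>\<^bsub>M\<^esub> x \<longleftrightarrow> y \<in> carrier M \<and> y \<ominus>\<^bsub>M\<^esub> x \<in> I"
  using a_elemrcos_carrier[of x y] a_rcos_module[of x y] by (auto simp: a_minus_def)

lemma coset_UN:
  assumes "x \<in> carrier M" "\<And>y. y \<in> carrier M \<Longrightarrow> y \<ominus>\<^bsub>M\<^esub> x \<in> I \<Longrightarrow> F y = F x"
  shows "(\<Union>y\<in>I +>\<^bsub>M\<^esub> x. F y) = F x"
proof -
  have "x \<in> I +>\<^bsub>M\<^esub> x" using assms(1) by (rule a_rcos_self)
  moreover have "\<And>y. y \<in> I +>\<^bsub>M\<^esub> x \<Longrightarrow> F y = F x" using assms coset_member by blast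
  ultimately show ?thesis by blast
qed

lemma minus_apply:
  assumes "x \<in> carrier M" "y \<in> carrier M"
  shows "c \<odot>\<^bsub>M\<^esub> x \<ominus>\<^bsub>M\<^esub> c \<odot>\<^bsub>M\<^esub> y = c \<odot>\<^bsub>M\<^esub> (x \<ominus>\<^bsub>M\<^esub> y)"
    "oper M \<tau> x \<ominus>\<^bsub>M\<^esub> oper M \<tau> y = oper M \<tau> (x \<ominus>\<^bsub>M\<^esub> y)"
  using assms o(2,3,9,10,11) o(5)[of y c "-1", symmetric] o(5)[of y "-1" c, symmetric]
  by (simp_all add: a_minus_def minus_smult[OF alg])

lemma coset_ops2:
  assumes "x \<in> carrier M" "y \<in> carrier M"
  shows "(I +>\<^bsub>M\<^esub> x) \<oplus>\<^bsub>op_quot M I\<^esub> (I +>\<^bsub>M\<^esub> y) = I +>\<^bsub>M\<^esub> (x \<oplus>\<^bsub>M\<^esub> y)"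
    "(I +>\<^bsub>M\<^esub> x) \<otimes>\<^bsub>op_quot M I\<^esub> (I +>\<^bsub>M\<^esub> y) = I +>\<^bsub>M\<^esub> (x \<otimes>\<^bsub>M\<^esub> y)"
  using a_rcos_sum rcoset_mult_add assms by (simp_all add: op_quot_def FactRing_def)

lemma coset_ops1:
  assumes "x \<in> carrier M"
  shows "c \<odot>\<^bsub>op_quot M I\<^esub> (I +>\<^bsub>M\<^esub> x) = I +>\<^bsub>M\<^esub> (c \<odot>\<^bsub>M\<^esub> x)"
    "oper (op_quot M I) \<tau> (I +>\<^bsub>M\<^esub> x) = I +>\<^bsub>M\<^esub> oper M \<tau> x"
proof -
  have i: "z \<in> I \<Longrightarrow> c \<odot>\<^bsub>M\<^esub> z \<in> I" "z \<in> I \<Longrightarrow> oper M \<tau> z \<in> I" for z c \<tau>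
    using idl by (auto simp: op_ideal_def)
  show "c \<odot>\<^bsub>op_quot M I\<^esub> (I +>\<^bsub>M\<^esub> x) = I +>\<^bsub>M\<^esub> (c \<odot>\<^bsub>M\<^esub> x)"
    unfolding op_quot_def opalg.simps module.simps
    by (rule coset_UN[OF assms(1)]) (simp add: coset_eq_iff o(2) assms minus_apply i)
  show "oper (op_quot M I) \<tau> (I +>\<^bsub>M\<^esub> x) = I +>\<^bsub>M\<^esub> oper M \<tau> x"
    unfolding op_quot_def opalg.simps module.simps
    by (rule coset_UN[OF assms(1)]) (simp add: coset_eq_iff o(9) assms minus_apply i)
qed

lemmas coset_ops = coset_ops1 coset_ops2

lemma coset_one: "\<one>\<^bsub>op_quot M I\<^esub> = I +>\<^bsub>M\<^esub> \<one>\<^bsub>M\<^esub>"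
  by (simp add: op_quot_def FactRing_def)

end

lemma op_iso_quot:
  assumes "op_quotient M I" "op_quotient N J" and f: "f \<in> op_hom M N"
    and bij: "bij_betw f (carrier M) (carrier N)"
    and IJ: "\<And>x. x \<in> carrier M \<Longrightarrow> x \<in> I \<longleftrightarrow> f x \<in> J"
  shows "op_iso (op_quot M I) (op_quot N J)"
proof -
  interpret M: op_quotient M I by fact
  interpret N: op_quotient N J by fact
  note fD = op_homD[OF f]
  have eq: "I +>\<^bsub>M\<^esub> x = I +>\<^bsub>M\<^esub> y \<longleftrightarrow> J +>\<^bsub>N\<^esub> f x = J +>\<^bsub>N\<^esub> f y" if "x \<in> carrier M" "y \<in> carrier M" for x y
    using that IJ[of "x \<ominus>\<^bsub>M\<^esub> y"] op_hom_minus(1)[OF M.alg N.alg f that] fD(1)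
    by (simp add: M.coset_eq_iff N.coset_eq_iff)
  define g where "g X = (\<Union>x\<in>X. J +>\<^bsub>N\<^esub> f x)" for X
  have g: "g (I +>\<^bsub>M\<^esub> x) = J +>\<^bsub>N\<^esub> f x" if "x \<in> carrier M" for x
    unfolding g_def using that by (rule M.coset_UN) (use that eq M.coset_eq_iff in blast)
  have N_coset: "J +>\<^bsub>N\<^esub> y \<in> carrier (op_quot N J)" if "y \<in> carrier N" for y
    using that N.coset_carrier by blast
  have "g \<in> op_hom (op_quot M I) (op_quot N J)"
    by (rule op_homI)
      (auto simp: M.coset_carrier M.coset_ops M.coset_one N.coset_ops N.coset_one
        g fD M.o(2,9) N_coset)
  moreover have "bij_betw g (carrier (op_quot M I)) (carrier (op_quot N J))"
  proof (rule bij_betwI')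
    fix X Y assume "X \<in> carrier (op_quot M I)" "Y \<in> carrier (op_quot M I)"
    then show "g X = g Y \<longleftrightarrow> X = Y" using eq g unfolding M.coset_carrier by metis
  next
    fix X assume "X \<in> carrier (op_quot M I)"
    then show "g X \<in> carrier (op_quot N J)" using g fD(1) by (auto simp: M.coset_carrier N.coset_carrier)
  next
    fix Y assume "Y \<in> carrier (op_quot N J)"
    then obtain y where y: "y \<in> carrier N" "Y = J +>\<^bsub>N\<^esub> y" by (auto simp: N.coset_carrier)
    then obtain x where "x \<in> carrier M" "y = f x" using bij by (auto simp: bij_betw_def)
    then show "\<exists>X\<in>carrier (op_quot M I). Y = g X" using y g by (metis M.coset_carrier)
  qed
  ultimately show ?thesis unfolding op_iso_def by blast
qed

section \<open>Linear maps into an operated algebra\<close>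

text \<open>The linear extension of a map into an operated algebra that is given by a carrier set.\<close>

definition lin_to :: "('k, 'c, 'w) opalg \<Rightarrow> ('a \<Rightarrow> 'c) \<Rightarrow> ('a \<Rightarrow>\<^sub>0 'k::field) \<Rightarrow> 'c" where
  "lin_to M h p = finsum M (\<lambda>u. lookup p u \<odot>\<^bsub>M\<^esub> h u) (keys p)"

locale linear_extension =
  fixes M :: "('k::field, 'c, 'w) opalg" and U :: "'a set" and h
  assumes alg: "operated_algebra M" and h: "\<And>u. u \<in> U \<Longrightarrow> h u \<in> carrier M"
begin

sublocale ring M
  by (rule operated_algebraD(1)[OF alg])

lemmas o = operated_algebraD[OF alg]

lemma superset:
  assumes "finite V" "V \<subseteq> U" "keys p \<subseteq> V"
  shows "lin_to M h p = finsum M (\<lambda>u. lookup p u \<odot>\<^bsub>M\<^esub> h u) V"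
  unfolding lin_to_def
  by (rule add.finprod_mono_neutral_cong_left) (use assms h o(2) in \<open>auto simp: in_keys_iff smult_zero[OF alg] subset_iff\<close>)

lemma closed: "keys p \<subseteq> U \<Longrightarrow> lin_to M h p \<in> carrier M"
  unfolding lin_to_def by (rule finsum_closed) (use h o(2) in auto)

lemma add_eq:
  assumes "keys p \<subseteq> U" "keys q \<subseteq> U"
  shows "lin_to M h (p + q) = lin_to M h p \<oplus>\<^bsub>M\<^esub> lin_to M h q"
proof -
  let ?V = "keys p \<union> keys q"
  have V: "finite ?V" "?V \<subseteq> U" "keys p \<subseteq> ?V" "keys q \<subseteq> ?V" "keys (p + q) \<subseteq> ?V"
    using assms Poly_Mapping.keys_add[of p q] by auto
  have "finsum M (\<lambda>u. lookup (p + q) u \<odot>\<^bsub>M\<^esub> h u) ?V =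
      finsum M (\<lambda>u. lookup p u \<odot>\<^bsub>M\<^esub> h u \<oplus>\<^bsub>M\<^esub> lookup q u \<odot>\<^bsub>M\<^esub> h u) ?V"
    by (rule finsum_cong') (use V(2) h o(2) in \<open>auto simp: lookup_add o(4)\<close>)
  also have "\<dots> = finsum M (\<lambda>u. lookup p u \<odot>\<^bsub>M\<^esub> h u) ?V \<oplus>\<^bsub>M\<^esub> finsum M (\<lambda>u. lookup q u \<odot>\<^bsub>M\<^esub> h u) ?V"
    by (rule finsum_addf) (use V(2) h o(2) in auto)
  finally show ?thesis
    unfolding superset[OF V(1,2,3)] superset[OF V(1,2,4)] superset[OF V(1,2,5)] .
qed

lemma single_eq: "u \<in> U \<Longrightarrow> lin_to M h (single u c) = c \<odot>\<^bsub>M\<^esub> h u"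
  using superset[of "{u}" "single u c"] h o(2) by simp

lemma zero_eq: "lin_to M h 0 = \<zero>\<^bsub>M\<^esub>"
  by (simp add: lin_to_def)

lemma scale_eq: "keys p \<subseteq> U \<Longrightarrow> lin_to M h (scale c p) = c \<odot>\<^bsub>M\<^esub> lin_to M h p"
proof (induction p rule: poly_mapping_support_induct)
  case zero
  then show ?case using smult_zero(2)[OF alg zero_closed] by (simp add: zero_eq)
next
  case (single u d)
  then show ?case using h by (simp add: single_eq o(5))
next
  case (add p q)
  have "keys (scale c p) \<subseteq> U" "keys (scale c q) \<subseteq> U"
    using add(1,2) keys_scale[of c p] keys_scale[of c q] by blast+
  then show ?case using add by (simp add: add_eq closed o(3))
qed

end

section \<open>Cells of dimension zero\<close>

primrec wf0 :: "'z set \<Rightarrow> ('k::zero, 'z, 'w, 'g) cexp \<Rightarrow> bool" where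
  "wf0 Z (Base p) \<longleftrightarrow> keys p \<subseteq> omonoid Z"
| "wf0 Z (Gen n g) \<longleftrightarrow> False"
| "wf0 Z (Idt a) \<longleftrightarrow> False"
| "wf0 Z (Sum a b) \<longleftrightarrow> wf0 Z a \<and> wf0 Z b"
| "wf0 Z (Scal c a) \<longleftrightarrow> wf0 Z a"
| "wf0 Z (Prod a b) \<longleftrightarrow> wf0 Z a \<and> wf0 Z b"
| "wf0 Z (Oper \<tau> a) \<longleftrightarrow> wf0 Z a"
| "wf0 Z (Comp k a b) \<longleftrightarrow> False"

text \<open>Evaluation of a \<open>0\<close>-cell expression in the free operated algebra.  The values on generators, identities
  and composites are dummies, as these are not \<open>0\<close>-cells.\<close>

primrec val0 :: "('k::field, 'z, 'w, 'g) cexp \<Rightarrow> ('k, 'z, 'w) opoly" where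
  "val0 (Base p) = p"
| "val0 (Gen n g) = 0"
| "val0 (Idt a) = 0"
| "val0 (Sum a b) = val0 a + val0 b"
| "val0 (Scal c a) = scale c (val0 a)"
| "val0 (Prod a b) = val0 a * val0 b"
| "val0 (Oper \<tau> a) = brk \<tau> (val0 a)"
| "val0 (Comp k a b) = 0"

lemma brk_simps [simp]:
  fixes p q :: "('k::field, 'z, 'w) opoly"
  shows "brk \<tau> (p + q) = brk \<tau> p + brk \<tau> q" "brk \<tau> (scale c p) = scale c (brk \<tau> p)"
    "brk \<tau> (0 :: ('k, 'z, 'w) opoly) = 0" "brk \<tau> (single u c) = (single [Br \<tau> u] c :: ('k, 'z, 'w) opoly)"
  by (simp_all add: brk_linx)

lemma carrier_closed:
  fixes p q :: "('k::field, 'z, 'w) opoly"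
  assumes "keys p \<subseteq> omonoid Z"
  shows "keys q \<subseteq> omonoid Z \<Longrightarrow> keys (p + q) \<subseteq> omonoid Z" "keys (scale c p) \<subseteq> omonoid Z"
    "keys q \<subseteq> omonoid Z \<Longrightarrow> keys (p * q) \<subseteq> omonoid Z" "keys (brk \<tau> p) \<subseteq> omonoid Z"
    "keys q \<subseteq> omonoid Z \<Longrightarrow> keys (p - q) \<subseteq> omonoid Z"
proof -
  show "keys q \<subseteq> omonoid Z \<Longrightarrow> keys (p + q) \<subseteq> omonoid Z" using assms Poly_Mapping.keys_add[of p q] by blast
  show "keys (scale c p) \<subseteq> omonoid Z" using assms keys_scale[of c p] by blast
  show "keys q \<subseteq> omonoid Z \<Longrightarrow> keys (p * q) \<subseteq> omonoid Z" using assms keys_mult_append[of p q] by fastforce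
  show "keys (brk \<tau> p) \<subseteq> omonoid Z"
    using assms keys_linx[of "\<lambda>u. mon [Br \<tau> u]" p] unfolding brk_linx by fastforce
  show "keys q \<subseteq> omonoid Z \<Longrightarrow> keys (p - q) \<subseteq> omonoid Z" using assms Poly_Mapping.keys_diff[of p q] by blast
qed

lemma zero_omonoid [simp]: "0 \<in> omonoid Z"
  by (simp add: zero_list_def)

lemma val0_carrier: "wf0 Z a \<Longrightarrow> keys (val0 a) \<subseteq> omonoid Z"
  by (induction a) (simp_all add: carrier_closed)

lemma ceq_0_imp:
  assumes "gens S 0 = {}"
  shows "ceq S n a b \<Longrightarrow> n = 0 \<Longrightarrow> wf0 (gens0 S) a \<and> wf0 (gens0 S) b \<and> val0 a = val0 b"
proof (induction rule: ceq.induct)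
  case (ax n a b)
  then have w: "wf0 (gens0 S) a" "wf0 (gens0 S) b" and "eq_axiom S 0 a b" by auto
  from this(3) have "val0 a = val0 b"
    by cases (use w in \<open>simp_all add: algebra_simps scale_add_left scale_neg\<close>)
  then show ?case using w by simp
qed (use assms in auto)

lemma ceq_0_Base: "wf0 (gens0 S) a \<Longrightarrow> ceq S 0 a (Base (val0 a))"
proof (induction a)
  case (Sum a b)
  have v: "keys (val0 a) \<subseteq> omonoid (gens0 S)" "keys (val0 b) \<subseteq> omonoid (gens0 S)"
    using Sum.prems by (simp_all add: val0_carrier)
  have "ceq S 0 (Sum a b) (Sum (Base (val0 a)) (Base (val0 b)))" using Sum by (simp add: ceq.sum)
  moreover have "ceq S 0 (Sum (Base (val0 a)) (Base (val0 b))) (Base (val0 (Sum a b)))"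
    unfolding val0.simps
    by (rule ceq.ax[OF eq_axiom.base_add]) (simp_all add: ceq.sum ceq.base v carrier_closed)
  ultimately show ?case by (rule ceq.trans)
next
  case (Scal c a)
  have v: "keys (val0 a) \<subseteq> omonoid (gens0 S)"
    using Scal.prems by (simp_all add: val0_carrier)
  have "ceq S 0 (Scal c a) (Scal c (Base (val0 a)))" using Scal by (simp add: ceq.scal)
  moreover have "ceq S 0 (Scal c (Base (val0 a))) (Base (val0 (Scal c a)))"
    unfolding val0.simps
    by (rule ceq.ax[OF eq_axiom.base_scal]) (simp_all add: ceq.scal ceq.base v carrier_closed)
  ultimately show ?case by (rule ceq.trans)
next
  case (Prod a b)
  have v: "keys (val0 a) \<subseteq> omonoid (gens0 S)" "keys (val0 b) \<subseteq> omonoid (gens0 S)"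
    using Prod.prems by (simp_all add: val0_carrier)
  have "ceq S 0 (Prod a b) (Prod (Base (val0 a)) (Base (val0 b)))" using Prod by (simp add: ceq.prod)
  moreover have "ceq S 0 (Prod (Base (val0 a)) (Base (val0 b))) (Base (val0 (Prod a b)))"
    unfolding val0.simps
    by (rule ceq.ax[OF eq_axiom.base_mult]) (simp_all add: ceq.prod ceq.base v carrier_closed)
  ultimately show ?case by (rule ceq.trans)
next
  case (Oper \<tau> a)
  have v: "keys (val0 a) \<subseteq> omonoid (gens0 S)"
    using Oper.prems by (simp_all add: val0_carrier)
  have "ceq S 0 (Oper \<tau> a) (Oper \<tau> (Base (val0 a)))" using Oper by (simp add: ceq.oper)
  moreover have "ceq S 0 (Oper \<tau> (Base (val0 a))) (Base (val0 (Oper \<tau> a)))"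
    unfolding val0.simps
    by (rule ceq.ax[OF eq_axiom.base_oper]) (simp_all add: ceq.oper ceq.base v carrier_closed)
  ultimately show ?case by (rule ceq.trans)
qed (simp_all add: ceq.base)

text \<open>The free \<open>0\<close>-algebra adds nothing to the free operated algebra: an expression can be evaluated step by
  step with the equations for \<open>Base\<close>.\<close>

lemma ceq_0_iff:
  assumes "gens S 0 = {}"
  shows "ceq S 0 a b \<longleftrightarrow> wf0 (gens0 S) a \<and> wf0 (gens0 S) b \<and> val0 a = val0 b"
  using ceq_0_imp[OF assms] ceq_0_Base[of S a] ceq_0_Base[of S b] by (metis ceq.sym ceq.trans)

text \<open>The \<open>0\<close>-cell \<open>pcell S p\<close>, described without reference to \<open>S\<close>, so that boundaries of generators can be
  compared between polygraphs.\<close>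

definition zcell :: "'z set \<Rightarrow> ('k::field, 'z, 'w) opoly \<Rightarrow> ('k, 'z, 'w, 'g) cexp set" where
  "zcell Z p = {e. wf0 Z e \<and> val0 e = p}"

lemma pcell_zcell:
  assumes "gens S 0 = {}" "keys p \<subseteq> omonoid (gens0 S)"
  shows "pcell S p = zcell (gens0 S) p"
  using assms by (auto simp: pcell_def ecls_def zcell_def ceq_0_iff)

lemma pcell_inj:
  assumes "gens S 0 = {}" "keys p \<subseteq> omonoid (gens0 S)" "pcell S p = pcell S q"
  shows "p = q"
proof -
  have "ceq S 0 (Base p) (Base p)" using assms(2) by (simp add: ceq.base)
  then have "ceq S 0 (Base p) (Base q)" using assms(3) unfolding pcell_def by (rule ecls_eqD)
  then show ?thesis using assms(1) by (simp add: ceq_0_iff)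
qed

lemma pcell_surj:
  assumes "gens S 0 = {}" "x \<in> carrier (free_cells S 0)"
  shows "\<exists>p. keys p \<subseteq> omonoid (gens0 S) \<and> x = pcell S p"
proof -
  obtain a where a: "ceq S 0 a a" "x = ecls S 0 a" using free_obtain[OF assms(2)] by blast
  then have w: "wf0 (gens0 S) a" using ceq_0_iff[OF assms(1)] by blast
  then have "x = pcell S (val0 a)" unfolding a(2) pcell_def by (rule ecls_eq[OF ceq_0_Base])
  then show ?thesis using val0_carrier[OF w] by blast
qed

lemma pcell_hom:
  fixes S :: "('k::field, 'z, 'w, 'g) polygraph"
  shows "pcell S \<in> op_hom (free_opalg (gens0 S)) (free_cells S 0)"
proof (rule op_homI)
  note b = ceq.base[unfolded in_carrier_iff]
  fix p q :: "('k::field, 'z, 'w) opoly" and c \<tau>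
  assume "p \<in> carrier (free_opalg (gens0 S))"
  then have p: "keys p \<subseteq> omonoid (gens0 S)" by simp
  show "pcell S p \<in> carrier (free_cells S 0)" unfolding pcell_def by (intro ecls_in b p)
  show "pcell S (c \<odot>\<^bsub>free_opalg (gens0 S)\<^esub> p) = c \<odot>\<^bsub>free_cells S 0\<^esub> pcell S p"
    unfolding pcell_def free_cells_ops1[OF b[OF p]]
    by (rule ecls_ax[symmetric])
      (simp_all add: free_opalg_def eq_axiom.base_scal b p carrier_closed ceq.scal)
  show "pcell S (oper (free_opalg (gens0 S)) \<tau> p) = oper (free_cells S 0) \<tau> (pcell S p)"
    unfolding pcell_def free_cells_ops1[OF b[OF p]]
    by (rule ecls_ax[symmetric])
      (simp_all add: free_opalg_def eq_axiom.base_oper b p carrier_closed ceq.oper)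
  assume "q \<in> carrier (free_opalg (gens0 S))"
  then have q: "keys q \<subseteq> omonoid (gens0 S)" by simp
  show "pcell S (p \<otimes>\<^bsub>free_opalg (gens0 S)\<^esub> q) = pcell S p \<otimes>\<^bsub>free_cells S 0\<^esub> pcell S q"
    unfolding pcell_def free_cells_ops2[OF b[OF p] b[OF q]]
    by (rule ecls_ax[symmetric])
      (simp_all add: free_opalg_def eq_axiom.base_mult b p q carrier_closed ceq.prod)
  show "pcell S (p \<oplus>\<^bsub>free_opalg (gens0 S)\<^esub> q) = pcell S p \<oplus>\<^bsub>free_cells S 0\<^esub> pcell S q"
    unfolding pcell_def free_cells_ops2[OF b[OF p] b[OF q]]
    by (rule ecls_ax[symmetric])
      (simp_all add: free_opalg_def eq_axiom.base_add b p q carrier_closed ceq.sum)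
next
  show "pcell S \<one>\<^bsub>free_opalg (gens0 S)\<^esub> = \<one>\<^bsub>free_cells S 0\<^esub>"
    by (simp add: pcell_def free_opalg_def free_cells_def)
qed

lemma free_opalg_operated: "operated_algebra (free_opalg Z :: ('k::field, ('k, 'z, 'w) opoly, 'w) opalg)"
proof -
  let ?M = "free_opalg Z :: ('k, ('k, 'z, 'w) opoly, 'w) opalg"
  have r: "ring ?M"
  proof (intro ringI abelian_groupI monoidI)
    fix x assume "x \<in> carrier ?M"
    then show "\<exists>y\<in>carrier ?M. y \<oplus>\<^bsub>?M\<^esub> x = \<zero>\<^bsub>?M\<^esub>"
      by (intro bexI[of _ "- x"]) (auto simp: free_opalg_def)
  qed (simp_all add: free_opalg_def carrier_closed mult.assoc distrib_left distrib_right add_ac)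
  show ?thesis unfolding operated_algebra_def linear_hom_def
    by (intro conjI allI ballI CollectI funcsetI r) (simp_all add: free_opalg_def carrier_closed scale_add_left)
qed

section \<open>Iterated identities in higher algebras\<close>

lemma up_up: "k \<le> m \<Longrightarrow> m \<le> n \<Longrightarrow> up f m n (up f k m a) = up f k n a"
  by (induction n) (auto simp: le_Suc_eq)

lemma up_self: "up f n n = (\<lambda>a. a)"
  by (rule ext) simp

lemma op_hom_id: "(\<lambda>x. x) \<in> op_hom M M"
  by (rule op_homI) auto

lemma op_hom_compose: "f \<in> op_hom M N \<Longrightarrow> g \<in> op_hom N K \<Longrightarrow> (\<lambda>x. g (f x)) \<in> op_hom M K"
  by (rule op_homI) (simp_all add: op_homD)

context higher_algebra
begin

lemma comp_laws1:
  assumes "k < n" "composable A n k a b"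
  shows "comp A n k a b \<in> carrier (cell A n)"
    "comp A n k (c \<odot>\<^bsub>cell A n\<^esub> a) (c \<odot>\<^bsub>cell A n\<^esub> b) = c \<odot>\<^bsub>cell A n\<^esub> comp A n k a b"
    "comp A n k (oper (cell A n) \<tau> a) (oper (cell A n) \<tau> b) = oper (cell A n) \<tau> (comp A n k a b)"
proof -
  have ab: "(a, b) \<in> carrier (composables A n k)" using assms(2) by (simp add: composables_def Let_def)
  note h = op_homD[OF comp_hom[OF assms(1)]]
  show "comp A n k a b \<in> carrier (cell A n)" using h(1)[OF ab] by simp
  show "comp A n k (c \<odot>\<^bsub>cell A n\<^esub> a) (c \<odot>\<^bsub>cell A n\<^esub> b) = c \<odot>\<^bsub>cell A n\<^esub> comp A n k a b"
    using h(5)[OF ab, of c] by (simp add: composables_def Let_def)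
  show "comp A n k (oper (cell A n) \<tau> a) (oper (cell A n) \<tau> b) = oper (cell A n) \<tau> (comp A n k a b)"
    using h(6)[OF ab, of \<tau>] by (simp add: composables_def Let_def)
qed

lemma comp_laws2:
  assumes "k < n" "composable A n k a b" "composable A n k a' b'"
  shows "comp A n k (a \<oplus>\<^bsub>cell A n\<^esub> a') (b \<oplus>\<^bsub>cell A n\<^esub> b') = comp A n k a b \<oplus>\<^bsub>cell A n\<^esub> comp A n k a' b'"
    "comp A n k (a \<otimes>\<^bsub>cell A n\<^esub> a') (b \<otimes>\<^bsub>cell A n\<^esub> b') = comp A n k a b \<otimes>\<^bsub>cell A n\<^esub> comp A n k a' b'"
proof -
  have ab: "(a, b) \<in> carrier (composables A n k)" "(a', b') \<in> carrier (composables A n k)"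
    using assms(2,3) by (simp_all add: composables_def Let_def)
  note h = op_homD[OF comp_hom[OF assms(1)]]
  show "comp A n k (a \<oplus>\<^bsub>cell A n\<^esub> a') (b \<oplus>\<^bsub>cell A n\<^esub> b') = comp A n k a b \<oplus>\<^bsub>cell A n\<^esub> comp A n k a' b'"
    using h(3)[OF ab] by (simp add: composables_def Let_def)
  show "comp A n k (a \<otimes>\<^bsub>cell A n\<^esub> a') (b \<otimes>\<^bsub>cell A n\<^esub> b') = comp A n k a b \<otimes>\<^bsub>cell A n\<^esub> comp A n k a' b'"
    using h(2)[OF ab] by (simp add: composables_def Let_def)
qed

lemma up_hom: "k \<le> n \<Longrightarrow> up (idc A) k n \<in> op_hom (cell A k) (cell A n)"
proof (induction n)
  case (Suc n)
  show ?case
  proof (cases "k = Suc n")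
    case False
    then have "k \<le> n" using Suc.prems by simp
    then show ?thesis using op_hom_compose[OF Suc.IH idc_hom] by simp
  qed (simp add: op_hom_id up_self)
qed (simp add: op_hom_id up_self)

lemma down_hom: "k \<le> n \<Longrightarrow> down (src A) k n \<in> op_hom (cell A n) (cell A k)"
  "k \<le> n \<Longrightarrow> down (tgt A) k n \<in> op_hom (cell A n) (cell A k)"
proof (induction n)
  case 0
  { case 1 then show ?case by (simp add: op_hom_id) next case 2 then show ?case by (simp add: op_hom_id) }
next
  case (Suc n)
  { case 1
    show ?case
    proof (cases "k = Suc n")
      case False
      then have "k \<le> n" using 1 by simp
      then show ?thesis using op_hom_compose[OF src_hom Suc.IH(1)] by simp
    qed (simp add: op_hom_id)
  next
    case 2
    show ?case
    proof (cases "k = Suc n")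
      case False
      then have "k \<le> n" using 2 by simp
      then show ?thesis using op_hom_compose[OF tgt_hom Suc.IH(2)] by simp
    qed (simp add: op_hom_id) }
qed

lemma down_up:
  assumes "a \<in> carrier (cell A m)" "k \<le> m" "m \<le> n"
  shows "down (src A) k n (up (idc A) m n a) = down (src A) k m a"
    "down (tgt A) k n (up (idc A) m n a) = down (tgt A) k m a"
  using assms(3)
proof (induction n)
  case (Suc n)
  { case 1 then show ?case using assms Suc.IH(1) op_homD(1)[OF up_hom assms(1)] src_idc by (cases "m = Suc n") auto
  next case 2 then show ?case using assms Suc.IH(2) op_homD(1)[OF up_hom assms(1)] tgt_idc by (cases "m = Suc n") auto }
qed simp_all

lemma up_comp:
  assumes "k < m" "m \<le> n" "composable A m k a b"
  shows "up (idc A) m n (comp A m k a b) = comp A n k (up (idc A) m n a) (up (idc A) m n b)"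
  using assms(2)
proof (induction n)
  case (Suc n)
  show ?case
  proof (cases "m = Suc n")
    case False
    then have mn: "m \<le> n" using Suc.prems by simp
    have "composable A n k (up (idc A) m n a) (up (idc A) m n b)"
      using assms(1,3) mn op_homD(1)[OF up_hom[OF mn]] by (simp add: down_up)
    then show ?thesis using Suc.IH[OF mn] idc_comp[of k n] assms(1) mn by simp
  qed simp
qed (use assms in simp)

text \<open>An iterated identity of an \<open>m\<close>-cell is its own composite in every direction from \<open>m\<close> on.\<close>

lemma comp_up_self:
  assumes "g \<in> carrier (cell A m)" "m \<le> j" "j < n"
  shows "comp A n j (up (idc A) m n g) (up (idc A) m n g) = up (idc A) m n g"
proof -
  have "up (idc A) m n g \<in> carrier (cell A n)" using op_homD(1)[OF up_hom assms(1)] assms by simp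
  from comp_idl[OF assms(3) this] show ?thesis
    using assms up_up[of m j n "idc A" g] down_up(1)[of "up (idc A) m j g" j j n] op_homD(1)[OF up_hom assms(1), of j]
    by (simp add: up_up)
qed

end

section \<open>Polygraphs without generators in high dimensions\<close>

lemma src_gcell:
  assumes "polygraph S" "g \<in> gens S (Suc m)"
  shows "src (free_alg S) m (gcell S (Suc m) g) = bsrc S (Suc m) g"
    "tgt (free_alg S) m (gcell S (Suc m) g) = btgt S (Suc m) g"
proof -
  have bc: "\<And>a b. ceq S (Suc m) a b \<Longrightarrow> bcong S (Suc m) a b" using bcong_glob[OF assms(1)] by blast
  have "\<forall>g\<in>gens S (Suc m). parallel (free_alg S) (Suc m - 1) (bsrc S (Suc m) g) (btgt S (Suc m) g)"
    using assms(1) unfolding polygraph_def by blast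
  then have c: "bsrc S (Suc m) g \<in> carrier (free_cells S m)" "btgt S (Suc m) g \<in> carrier (free_cells S m)"
    using assms(2) by (auto simp: parallel_def)
  show "src (free_alg S) m (gcell S (Suc m) g) = bsrc S (Suc m) g"
    "tgt (free_alg S) m (gcell S (Suc m) g) = btgt S (Suc m) g"
    using src_cls[OF bc ceq.gen[OF assms(2)]] SOME_cell[OF c(1)] SOME_cell[OF c(2)]
    by (simp_all add: gcell_def)
qed

text \<open>All operations preserve identities: composites in lower directions because identities are functorial,
  and the composite in the top direction because composable identities coincide.\<close>

lemma cells_identities:
  assumes P: "polygraph S" and "gens S (Suc m) = {}"
  shows "ceq S n a b \<Longrightarrow> n = Suc m \<Longrightarrow> ecls S n a \<in> idc (free_alg S) m ` carrier (free_cells S m)"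
proof (induction rule: ceq.induct)
  interpret higher_algebra "free_alg S" by (rule free_higher_algebra[OF P])
  note i = op_homD[OF idc_hom[of m], unfolded cell_free]
  note c = operated_algebraD[OF free_operated[of S m]]
  interpret ring "free_cells S m" by (rule c(1))
  {
    case (idt n a a')
    then have "ceq S m a a" using ceq_reflL by simp
    then show ?case using idc_cls ecls_in idt.prems by (metis Suc_inject image_eqI)
  next
    case (sum n a a' b b')
    then obtain f g where "f \<in> carrier (free_cells S m)" "ecls S n a = idc (free_alg S) m f"
      "g \<in> carrier (free_cells S m)" "ecls S n b = idc (free_alg S) m g" by auto
    then show ?case using i(3) free_cells_ops2(1)[OF ceq_reflL[OF sum.hyps(1)] ceq_reflL[OF sum.hyps(2)]] sum.prems
      by (metis a_closed image_eqI)
  next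
    case (scal n a a' d)
    then obtain f where "f \<in> carrier (free_cells S m)" "ecls S n a = idc (free_alg S) m f" by auto
    then show ?case using i(5) free_cells_ops1(1)[OF ceq_reflL[OF scal.hyps(1)]] scal.prems
      by (metis c(2) image_eqI)
  next
    case (prod n a a' b b')
    then obtain f g where "f \<in> carrier (free_cells S m)" "ecls S n a = idc (free_alg S) m f"
      "g \<in> carrier (free_cells S m)" "ecls S n b = idc (free_alg S) m g" by auto
    then show ?case using i(2) free_cells_ops2(2)[OF ceq_reflL[OF prod.hyps(1)] ceq_reflL[OF prod.hyps(2)]] prod.prems
      by (metis m_closed image_eqI)
  next
    case (oper n a a' \<tau>)
    then obtain f where "f \<in> carrier (free_cells S m)" "ecls S n a = idc (free_alg S) m f" by auto
    then show ?case using i(6) free_cells_ops1(2)[OF ceq_reflL[OF oper.hyps(1)]] oper.prems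
      by (metis c(9) image_eqI)
  next
    case (comp k n a a' b b')
    then obtain f g where f: "f \<in> carrier (free_cells S m)" "ecls S n a = idc (free_alg S) m f"
      and g: "g \<in> carrier (free_cells S m)" "ecls S n b = idc (free_alg S) m g" by auto
    have a: "ceq S n a a" and b: "ceq S n b b" using comp.hyps ceq_reflL by blast+
    have e: "ecls S n (Comp k a b) = higher_alg.comp (free_alg S) n k (idc (free_alg S) m f) (idc (free_alg S) m g)"
      using comp_cls[OF comp.hyps(1) a b comp.hyps(4)] f g by simp
    have "composable (free_alg S) n k (ecls S n a) (ecls S n b)"
      using comp.hyps(4) by (simp only: composable_cls[OF P comp.hyps(1) a b])
    then have "composable (free_alg S) n k (idc (free_alg S) m f) (idc (free_alg S) m g)"
      unfolding f(2) g(2) .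
    then have cc: "composable (free_alg S) (Suc m) k (idc (free_alg S) m f) (idc (free_alg S) m g)"
      unfolding comp.prems .
    show ?case
    proof (cases "k = m")
      case True
      then have "f = g" using cc f g tgt_idc src_idc by simp
      then have "higher_alg.comp (free_alg S) (Suc m) m (idc (free_alg S) m f) (idc (free_alg S) m g) = idc (free_alg S) m f"
        using comp_up_self[of f m m "Suc m"] f by simp
      then show ?thesis using e True f comp.prems by auto
    next
      case False
      then have km: "k < m" using comp by simp
      then have "composable (free_alg S) m k f g" using cc f g tgt_idc src_idc by simp
      then show ?thesis using e idc_comp[OF km] comp_laws1(1)[OF km] comp.prems by (metis cell_free image_eqI)
    qed
  next
    case (sym n a b)
    then show ?case using ecls_eq by metis
  }
qed (use assms in auto)

section \<open>The reduction cells\<close>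

text \<open>The cell from \<open>D(w)\<close> to its normal form for a normal word \<open>w\<close>.  If \<open>w\<close> is a single letter, \<open>D(w)\<close> is
  normal and an identity is needed.\<close>

definition base_cell :: "'z set \<Rightarrow> ('k::field, 'z, diff_op, ('z, diff_op) mono list) polygraph \<Rightarrow>
    ('z, diff_op) mono \<Rightarrow> ('k, 'z, diff_op, ('z, diff_op) mono list) cexp set" where
  "base_cell Z S w = (if w \<in> Dtheta_star Z \<and> length w \<noteq> 1 then gcell S (Suc 0) [[], dop w]
     else idc (free_alg S) 0 (pcell S (mon (dop w))))"

text \<open>The cell reducing a letter to its normal form: inside a bracket one first reduces the content and then
  the bracket around the resulting normal polynomial.\<close>

primrec red_letter :: "'z set \<Rightarrow> ('k::field, 'z, diff_op, ('z, diff_op) mono list) polygraph \<Rightarrow> 'k \<Rightarrow>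
    ('z, diff_op) letter \<Rightarrow> ('k, 'z, diff_op, ('z, diff_op) mono list) cexp set" where
  "red_letter Z S lam (Atom x) = idc (free_alg S) 0 (pcell S (mon [Atom x]))"
| "red_letter Z S lam (Br \<tau> u) = comp (free_alg S) (Suc 0) 0
     (oper (free_cells S (Suc 0)) \<tau>
       (foldr (\<otimes>\<^bsub>free_cells S (Suc 0)\<^esub>) (map (red_letter Z S lam) u) \<one>\<^bsub>free_cells S (Suc 0)\<^esub>))
     (lin_to (free_cells S (Suc 0)) (base_cell Z S) (nrm_mono lam u))"

definition red_mono where
  "red_mono Z S lam u =
     foldr (\<otimes>\<^bsub>free_cells S (Suc 0)\<^esub>) (map (red_letter Z S lam) u) \<one>\<^bsub>free_cells S (Suc 0)\<^esub>"

text \<open>The sources and targets required here are those which the contraction forces; the locale isolates them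
  so that the free algebra can be studied independently of how the polygraph is built.\<close>

locale diff_resolution =
  fixes Z :: "'z set" and lam :: "'k::field"
    and S :: "('k, 'z, diff_op, ('z, diff_op) mono list) polygraph"
  assumes polygraph: "polygraph S" and gens0: "gens0 S = Z"
    and gens: "gens S = sq_gens (diff_polygraph Z lam)"
    and bsrc: "w \<in> Dtheta_star Z \<Longrightarrow> length w \<noteq> 1 \<Longrightarrow> bsrc S (Suc 0) [[], dop w] = pcell S (mon (dop w))"
    and btgt: "w \<in> Dtheta_star Z \<Longrightarrow> length w \<noteq> 1 \<Longrightarrow> btgt S (Suc 0) [[], dop w] = pcell S (der lam w)"
begin

sublocale higher_algebra "free_alg S"
  by (rule free_higher_algebra[OF polygraph])

abbreviation "M0 \<equiv> free_cells S 0"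
abbreviation "M1 \<equiv> free_cells S (Suc 0)"
abbreviation "one_cell p \<equiv> idc (free_alg S) 0 (pcell S p)"
abbreviation star (infixl "\<star>" 65) where "f \<star> g \<equiv> comp (free_alg S) (Suc 0) 0 f g"
abbreviation "in_Z p \<equiv> keys p \<subseteq> omonoid Z"

lemma gens_0: "gens S 0 = {}"
  using gens sq_gens_0 by metis

lemmas pcell_injD = pcell_inj[OF gens_0, unfolded gens0]
lemmas pcell_surjD = pcell_surj[OF gens_0, unfolded gens0]

lemma pcell_ops:
  assumes "in_Z p"
  shows "pcell S p \<in> carrier M0" "c \<odot>\<^bsub>M0\<^esub> pcell S p = pcell S (scale c p)"
    "oper M0 \<tau> (pcell S p) = pcell S (brk \<tau> p)"
    "in_Z q \<Longrightarrow> pcell S p \<oplus>\<^bsub>M0\<^esub> pcell S q = pcell S (p + q)"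
    "in_Z q \<Longrightarrow> pcell S p \<otimes>\<^bsub>M0\<^esub> pcell S q = pcell S (p * q)"
  using op_homD[OF pcell_hom[of S]] assms by (simp_all add: gens0 free_opalg_def)

lemma pcell_one: "pcell S 1 = \<one>\<^bsub>M0\<^esub>"
  using op_homD(4)[OF pcell_hom[of S]] by (simp add: free_opalg_def)

text \<open>\<open>f\<close> is a \<open>1\<close>-cell \<open>p \<rightarrow> q\<close>, with the \<open>0\<close>-cells given by their unique polynomials.\<close>

definition arr where
  "arr f p q \<longleftrightarrow> in_Z p \<and> in_Z q \<and> f \<in> carrier M1 \<and> src (free_alg S) 0 f = pcell S p \<and> tgt (free_alg S) 0 f = pcell S q"

lemma arrD:
  assumes "arr f p q"
  shows "in_Z p" "in_Z q" "f \<in> carrier M1" "src (free_alg S) 0 f = pcell S p" "tgt (free_alg S) 0 f = pcell S q"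
  using assms by (auto simp: arr_def)

lemma arr_exists: "f \<in> carrier M1 \<Longrightarrow> \<exists>p q. arr f p q"
  using pcell_surjD[of "src (free_alg S) 0 f"] pcell_surjD[of "tgt (free_alg S) 0 f"]
    op_homD(1)[OF src_hom[of 0], of f] op_homD(1)[OF tgt_hom[of 0], of f] by (auto simp: arr_def)

lemma arr_unique: "arr f p q \<Longrightarrow> arr f p' q' \<Longrightarrow> p = p' \<and> q = q'"
  unfolding arr_def using pcell_injD by metis

lemmas src_ops = op_homD[OF src_hom[of 0], unfolded cell_free]
lemmas tgt_ops = op_homD[OF tgt_hom[of 0], unfolded cell_free]
lemmas idc_ops = op_homD[OF idc_hom[of 0], unfolded cell_free]
lemmas M1_op = operated_algebraD[OF free_operated[of S "Suc 0"]]

sublocale M1: ring M1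
  by (rule M1_op(1))

lemma arr_one_cell: "in_Z p \<Longrightarrow> arr (one_cell p) p p"
  using idc_ops(1) src_idc tgt_idc pcell_ops(1) by (simp add: arr_def)

lemma arr_add: "arr f p q \<Longrightarrow> arr f' p' q' \<Longrightarrow> arr (f \<oplus>\<^bsub>M1\<^esub> f') (p + p') (q + q')"
  by (simp add: arr_def src_ops tgt_ops pcell_ops carrier_closed)

lemma arr_mult: "arr f p q \<Longrightarrow> arr f' p' q' \<Longrightarrow> arr (f \<otimes>\<^bsub>M1\<^esub> f') (p * p') (q * q')"
  by (simp add: arr_def src_ops tgt_ops pcell_ops carrier_closed)

lemma arr_scale: "arr f p q \<Longrightarrow> arr (c \<odot>\<^bsub>M1\<^esub> f) (scale c p) (scale c q)"
  by (simp add: arr_def src_ops tgt_ops pcell_ops carrier_closed M1_op(2))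

lemma arr_oper: "arr f p q \<Longrightarrow> arr (oper M1 \<tau> f) (brk \<tau> p) (brk \<tau> q)"
  by (simp add: arr_def src_ops tgt_ops pcell_ops carrier_closed M1_op(9))

lemma arr_composable: "arr f p q \<Longrightarrow> arr g q r \<Longrightarrow> composable (free_alg S) (Suc 0) 0 f g"
  by (simp add: arr_def)

lemma arr_star: "arr f p q \<Longrightarrow> arr g q r \<Longrightarrow> arr (f \<star> g) p r"
  using src_comp_top[where n = 0 and a = f and b = g] tgt_comp_top[where n = 0 and a = f and b = g]
    comp_laws1(1)[where k = 0 and n = "Suc 0" and a = f and b = g] by (simp add: arr_def)

lemma star_laws:
  assumes "arr f p q" "arr g q r"
  shows "arr f' p' q' \<Longrightarrow> arr g' q' r' \<Longrightarrow> (f \<oplus>\<^bsub>M1\<^esub> f') \<star> (g \<oplus>\<^bsub>M1\<^esub> g') = (f \<star> g) \<oplus>\<^bsub>M1\<^esub> (f' \<star> g')"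
    "arr f' p' q' \<Longrightarrow> arr g' q' r' \<Longrightarrow> (f \<otimes>\<^bsub>M1\<^esub> f') \<star> (g \<otimes>\<^bsub>M1\<^esub> g') = (f \<star> g) \<otimes>\<^bsub>M1\<^esub> (f' \<star> g')"
    "(c \<odot>\<^bsub>M1\<^esub> f) \<star> (c \<odot>\<^bsub>M1\<^esub> g) = c \<odot>\<^bsub>M1\<^esub> (f \<star> g)"
    "oper M1 \<tau> f \<star> oper M1 \<tau> g = oper M1 \<tau> (f \<star> g)"
    "arr h r r' \<Longrightarrow> (f \<star> g) \<star> h = f \<star> (g \<star> h)"
    "one_cell p \<star> f = f" "f \<star> one_cell q = f"
proof -
  note fg = arr_composable[OF assms]
  show "arr f' p' q' \<Longrightarrow> arr g' q' r' \<Longrightarrow> (f \<oplus>\<^bsub>M1\<^esub> f') \<star> (g \<oplus>\<^bsub>M1\<^esub> g') = (f \<star> g) \<oplus>\<^bsub>M1\<^esub> (f' \<star> g')"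
    "arr f' p' q' \<Longrightarrow> arr g' q' r' \<Longrightarrow> (f \<otimes>\<^bsub>M1\<^esub> f') \<star> (g \<otimes>\<^bsub>M1\<^esub> g') = (f \<star> g) \<otimes>\<^bsub>M1\<^esub> (f' \<star> g')"
    using comp_laws2[OF zero_less_Suc fg arr_composable[of f' p' q' g' r']] by simp_all
  show "(c \<odot>\<^bsub>M1\<^esub> f) \<star> (c \<odot>\<^bsub>M1\<^esub> g) = c \<odot>\<^bsub>M1\<^esub> (f \<star> g)" "oper M1 \<tau> f \<star> oper M1 \<tau> g = oper M1 \<tau> (f \<star> g)"
    using comp_laws1(2,3)[OF zero_less_Suc fg] by simp_all
  show "arr h r r' \<Longrightarrow> (f \<star> g) \<star> h = f \<star> (g \<star> h)"
    using comp_assoc[OF zero_less_Suc fg arr_composable[OF assms(2)]] by blast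
  show "one_cell p \<star> f = f" "f \<star> one_cell q = f"
    using comp_idl[of 0 "Suc 0" f] comp_idr[of 0 "Suc 0" f] assms(1) by (simp_all add: arr_def)
qed

text \<open>Linearity of composition, applied to \<open>(f + 1\<^sub>q) \<star> (1\<^sub>q + g) = (f + 1\<^sub>q) \<star> (g + 1\<^sub>q)\<close>, expresses composition by
  addition.  This is what makes composition cancellable.\<close>

lemma star_add:
  assumes "arr f p q" "arr g q r"
  shows "(f \<star> g) \<oplus>\<^bsub>M1\<^esub> one_cell q = f \<oplus>\<^bsub>M1\<^esub> g"
proof -
  note q = arr_one_cell[OF arrD(2)[OF assms(1)]]
  \<comment> \<open>Interchange composition and addition in two ways; the arguments agree by commutativity.\<close>
  have "(f \<oplus>\<^bsub>M1\<^esub> one_cell q) \<star> (one_cell q \<oplus>\<^bsub>M1\<^esub> g) = f \<oplus>\<^bsub>M1\<^esub> g"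
    using star_laws(1)[OF assms(1) q q assms(2)] star_laws(6)[OF assms(2) arr_one_cell[OF arrD(2)[OF assms(2)]]]
      star_laws(7)[OF assms(1) q] by simp
  moreover have "(f \<oplus>\<^bsub>M1\<^esub> one_cell q) \<star> (g \<oplus>\<^bsub>M1\<^esub> one_cell q) = (f \<star> g) \<oplus>\<^bsub>M1\<^esub> one_cell q"
    using star_laws(1)[OF assms q q] star_laws(6)[OF q q] by simp
  moreover have "one_cell q \<oplus>\<^bsub>M1\<^esub> g = g \<oplus>\<^bsub>M1\<^esub> one_cell q"
    using arrD(3)[OF q] arrD(3)[OF assms(2)] by (rule M1.a_comm)
  ultimately show ?thesis by simp
qed

lemma star_cancel:
  assumes "arr f p q" "arr f' p' q" "arr g q r" "f \<star> g = f' \<star> g"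
  shows "f = f'"
  using star_add[OF assms(1,3)] star_add[OF assms(2,3)] assms(4) arrD(3)[OF assms(1)] arrD(3)[OF assms(2)]
    arrD(3)[OF assms(3)] by (metis M1.add.right_cancel)

subsection \<open>Generating cells\<close>

lemma dop_omonoid: "w \<in> Dtheta_star Z \<Longrightarrow> dop w \<in> omonoid Z"
  using Dtheta_star_omonoid by auto

lemma der_in_Z: "w \<in> Dtheta_star Z \<Longrightarrow> keys (der lam w) \<subseteq> Dtheta_star Z" "w \<in> Dtheta_star Z \<Longrightarrow> in_Z (der lam w)"
  using keys_der[of _ lam w Z] Dtheta_star_omonoid by blast+

lemma arr_base_cell: "w \<in> Dtheta_star Z \<Longrightarrow> arr (base_cell Z S w) (mon (dop w)) (der lam w)"
proof -
  assume w: "w \<in> Dtheta_star Z"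
  show ?thesis
  proof (cases "length w = 1")
    case True
    then obtain l where "w = [l]" by (auto simp: length_Suc_conv)
    then show ?thesis using arr_one_cell[of "mon (dop w)"] dop_omonoid[OF w] by (simp add: base_cell_def der_letter mon_mult)
  next
    case False
    have g: "[[], dop w] \<in> gens S (Suc 0)" using w False sq_gens_1_diff[of Z lam] unfolding gens by auto
    have "gcell S (Suc 0) [[], dop w] \<in> carrier M1" unfolding gcell_def by (rule ecls_in[OF ceq.gen[OF g]])
    then show ?thesis
      using src_gcell[OF polygraph g] bsrc[OF w False] btgt[OF w False] w False der_in_Z[OF w] dop_omonoid[OF w]
      by (simp add: base_cell_def arr_def)
  qed
qed

abbreviation "lin_base \<equiv> lin_to M1 (base_cell Z S)"

sublocale base: linear_extension M1 "Dtheta_star Z" "base_cell Z S"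
  by standard (use arr_base_cell arrD(3) free_operated in blast)+

lemma zero_cell: "one_cell 0 = \<zero>\<^bsub>M1\<^esub>"
proof -
  have "pcell S 0 = \<zero>\<^bsub>M0\<^esub>" by (simp add: pcell_def free_cells_def)
  moreover have "idc (free_alg S) 0 \<zero>\<^bsub>M0\<^esub> = \<zero>\<^bsub>M1\<^esub>"
    using op_hom_minus(2)[OF free_operated free_operated idc_hom[of 0, unfolded cell_free]] pcell_ops(1)[of 0] by simp
  ultimately show ?thesis by simp
qed

lemma arr_zero: "arr \<zero>\<^bsub>M1\<^esub> 0 0"
  using arr_one_cell[of 0] by (simp add: zero_cell)

lemma arr_lin_base: "keys p \<subseteq> Dtheta_star Z \<Longrightarrow> arr (lin_base p) (brk Diff p) (linx (der lam) p)"
proof (induction p rule: poly_mapping_support_induct)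
  case zero
  then show ?case using arr_zero by (simp add: base.zero_eq)
next
  case (single u c)
  then show ?case using arr_scale[OF arr_base_cell, of u c] by (simp add: base.single_eq)
next
  case (add p q)
  then show ?case by (simp add: base.add_eq arr_add)
qed

subsection \<open>Reduction of monomials and polynomials\<close>

abbreviation "rho_mono \<equiv> red_mono Z S lam"

lemma rho_mono_Nil: "rho_mono [] = \<one>\<^bsub>M1\<^esub>"
  by (simp add: red_mono_def)

lemma rho_mono_Cons: "rho_mono (l # u) = red_letter Z S lam l \<otimes>\<^bsub>M1\<^esub> rho_mono u"
  by (simp add: red_mono_def)

lemma rho_letter_Br: "red_letter Z S lam (Br \<tau> u) = oper M1 \<tau> (rho_mono u) \<star> lin_base (nrm_mono lam u)"
  by (simp add: red_mono_def)

lemma one_cell_1: "one_cell 1 = \<one>\<^bsub>M1\<^esub>"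
  using idc_ops(4) by (simp add: pcell_one)

lemma arr_one: "arr \<one>\<^bsub>M1\<^esub> 1 1"
  using arr_one_cell[of 1] by (simp add: one_cell_1)

lemma Diff_eq: "\<tau> = Diff"
  by (cases \<tau>)

lemma arr_rho_letter: "set1_letter l \<subseteq> Z \<Longrightarrow> arr (red_letter Z S lam l) (mon [l]) (nrm_letter lam l)"
proof (induction l)
  case (Atom x)
  then show ?case using arr_one_cell[of "mon [Atom x]"] by simp
next
  case (Br \<tau> u)
  have u: "u \<in> omonoid Z" using Br.prems by simp
  have "arr (rho_mono u) (mon u) (nrm_mono lam u)" using Br.IH u
  proof (induction u)
    case Nil
    then show ?case using arr_one by (simp add: rho_mono_Nil mon_Nil)
  next
    case (Cons l u)
    have "arr (red_letter Z S lam l) (mon [l]) (nrm_letter lam l)" using Cons.prems by simp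
    moreover have "arr (rho_mono u) (mon u) (nrm_mono lam u)" using Cons by simp
    ultimately have "arr (rho_mono (l # u)) (mon [l] * mon u) (nrm_letter lam l * nrm_mono lam u)"
      unfolding rho_mono_Cons by (rule arr_mult)
    then show ?case by (simp add: mon_mult nrm_mono_Cons)
  qed
  from arr_star[OF arr_oper[OF this] arr_lin_base[OF keys_nrm_mono[OF u], folded Diff_eq[of \<tau>]]]
  show ?case unfolding rho_letter_Br nrm_letter.simps by (simp add: nrm_mono_def)
qed

lemma arr_rho_mono: "u \<in> omonoid Z \<Longrightarrow> arr (rho_mono u) (mon u) (nrm_mono lam u)"
proof (induction u)
  case Nil
  then show ?case using arr_one by (simp add: rho_mono_Nil mon_Nil)
next
  case (Cons l u)
  have "arr (rho_mono (l # u)) (mon [l] * mon u) (nrm_letter lam l * nrm_mono lam u)"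
    unfolding rho_mono_Cons using Cons by (intro arr_mult arr_rho_letter) simp_all
  then show ?case by (simp add: mon_mult nrm_mono_Cons)
qed

text \<open>Reducing a product factor by factor already gives a normal polynomial, so no further step is needed.\<close>

lemma rho_mono_append:
  "u \<in> omonoid Z \<Longrightarrow> v \<in> omonoid Z \<Longrightarrow> rho_mono (u @ v) = rho_mono u \<otimes>\<^bsub>M1\<^esub> rho_mono v"
proof (induction u)
  case Nil
  then show ?case using arrD(3)[OF arr_rho_mono] by (simp add: rho_mono_Nil)
next
  case (Cons l u)
  then show ?case using arrD(3)[OF arr_rho_mono] arrD(3)[OF arr_rho_letter]
    by (simp add: rho_mono_Cons M1.m_assoc)
qed

abbreviation "rho \<equiv> lin_to M1 rho_mono"

sublocale rho: linear_extension M1 "omonoid Z" rho_mono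
  by standard (use arr_rho_mono arrD(3) free_operated in blast)+

lemma arr_rho: "in_Z p \<Longrightarrow> arr (rho p) p (nrm lam p)"
proof (induction p rule: poly_mapping_support_induct)
  case zero
  then show ?case using arr_zero by (simp add: rho.zero_eq)
next
  case (single u c)
  then show ?case using arr_scale[OF arr_rho_mono, of u c] by (simp add: rho.single_eq)
next
  case (add p q)
  then show ?case by (simp add: rho.add_eq arr_add)
qed

lemma rho_mult: "in_Z p \<Longrightarrow> in_Z q \<Longrightarrow> rho (p * q) = rho p \<otimes>\<^bsub>M1\<^esub> rho q"
proof (induction p rule: poly_mapping_support_induct)
  case zero
  then show ?case by (simp add: rho.zero_eq rho.closed)
next
  case (single u c)
  show ?case using single(2)
  proof (induction q rule: poly_mapping_support_induct)
    case zero
    then show ?case using single by (simp add: rho.zero_eq rho.closed)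
  next
    case (single v d)
    then show ?case using \<open>u \<in> omonoid Z\<close>
      by (simp add: mult_single plus_list_def rho.single_eq rho_mono_append rho.h M1_op mult.commute flip: M1_op(5))
  next
    case (add q q')
    then show ?case using single carrier_closed(3)[of "single u c" Z]
      by (simp add: distrib_left rho.add_eq M1.r_distr rho.closed)
  qed
next
  case (add p p')
  then show ?case by (simp add: distrib_right rho.add_eq M1.l_distr rho.closed carrier_closed)
qed

lemma rho_brk: "in_Z p \<Longrightarrow> rho (brk \<tau> p) = oper M1 \<tau> (rho p) \<star> lin_base (nrm lam p)"
proof (induction p rule: poly_mapping_support_induct)
  case zero
  have "\<zero>\<^bsub>M1\<^esub> \<star> \<zero>\<^bsub>M1\<^esub> = \<zero>\<^bsub>M1\<^esub>" using star_laws(6)[OF arr_zero arr_zero] by (simp add: zero_cell)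
  moreover have "oper M1 \<tau> \<zero>\<^bsub>M1\<^esub> = \<zero>\<^bsub>M1\<^esub>"
    using M1_op(11)[OF M1.zero_closed, of \<tau> 0] smult_zero[OF free_operated M1_op(9)] smult_zero[OF free_operated M1.zero_closed] by simp
  ultimately show ?case by (simp add: rho.zero_eq base.zero_eq)
next
  case (single u c)
  have k: "keys (nrm_mono lam u) \<subseteq> Dtheta_star Z" by (rule keys_nrm_mono[OF single])
  note a = arr_oper[OF arr_rho_mono[OF single], of \<tau>] and b = arr_lin_base[OF k, folded Diff_eq[of \<tau>]]
  have "rho_mono [Br \<tau> u] = oper M1 \<tau> (rho_mono u) \<star> lin_base (nrm_mono lam u)"
    using arrD(3)[OF arr_star[OF a b]] by (simp add: rho_mono_Cons rho_mono_Nil rho_letter_Br del: red_letter.simps)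
  then show ?case using star_laws(3)[OF a b, of c] single k
    by (simp add: rho.single_eq base.scale_eq M1_op(11) rho.h)
next
  case (add p q)
  have k: "keys (nrm lam p) \<subseteq> Dtheta_star Z" "keys (nrm lam q) \<subseteq> Dtheta_star Z" using add keys_nrm by blast+
  note a = arr_oper[OF arr_rho, of _ \<tau>] and b = arr_lin_base[folded Diff_eq[of \<tau>]]
  show ?case using star_laws(1)[OF a[OF add(1)] b[OF k(1)] a[OF add(2)] b[OF k(2)]] add k
    by (simp add: rho.add_eq base.add_eq M1_op(10) rho.closed carrier_closed)
qed

lemma rho_letter_normal: "l \<in> Dletters Z \<Longrightarrow> red_letter Z S lam l = one_cell (mon [l])"
proof (induction l)
  case (Br \<tau> u)
  then obtain l where u: "u = [l]" "l \<in> Dletters Z" by auto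
  have l: "[l] \<in> Dtheta_star Z" "in_Z (mon [l])" using u Dletters_gens by (auto simp: Dtheta_star_iff)
  have r: "rho_mono u = one_cell (mon [l])"
    using Br.IH[of l] u arrD(3)[OF arr_one_cell[OF l(2)]] by (simp add: rho_mono_Cons rho_mono_Nil)
  have n: "nrm_mono lam u = mon [l]" using nrm_mono_normal[OF l(1)] u by simp
  have o: "oper M1 \<tau> (one_cell (mon [l])) = one_cell (mon [Br \<tau> u])"
    using idc_ops(6)[OF pcell_ops(1)[OF l(2)], of \<tau>, symmetric] pcell_ops(3)[OF l(2), of \<tau>] u by simp
  have b: "lin_base (mon [l]) = one_cell (mon [Br \<tau> u])"
    using base.single_eq[OF l(1), of 1] base.h[OF l(1)] Diff_eq[of \<tau>] u by (simp add: M1_op(6) base_cell_def)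
  have "in_Z (mon [Br \<tau> u])" using l u by simp
  from arr_one_cell[OF this] show ?case unfolding rho_letter_Br r n o b by (rule star_laws(6)) (rule arr_one_cell, fact)
qed simp

text \<open>On normal polynomials every bracket contains a single letter, where \<open>base_cell\<close> is an identity.\<close>

lemma rho_normal: "keys p \<subseteq> Dtheta_star Z \<Longrightarrow> rho p = one_cell p"
proof (induction p rule: poly_mapping_support_induct)
  case zero
  then show ?case by (simp add: rho.zero_eq zero_cell)
next
  case (single u c)
  have "rho_mono u = one_cell (mon u)" using single
  proof (induction u)
    case Nil
    then show ?case by (simp add: rho_mono_Nil mon_Nil one_cell_1)
  next
    case (Cons l u)
    have l: "l \<in> Dletters Z" and u: "u \<in> Dtheta_star Z" using Cons.prems by (auto simp: Dtheta_star_iff)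
    have "in_Z (mon [l])" "in_Z (mon u)" using Dletters_gens[OF l] u Dtheta_star_omonoid by auto
    then have "one_cell (mon [l]) \<otimes>\<^bsub>M1\<^esub> one_cell (mon u) = one_cell (mon [l] * mon u)"
      by (simp add: idc_ops(2)[symmetric] pcell_ops del: mult_single)
    then show ?case using Cons.IH[OF u] rho_letter_normal[OF l] by (simp add: rho_mono_Cons mon_mult)
  qed
  moreover have "in_Z (mon u)" "u \<in> omonoid Z" using single Dtheta_star_omonoid by auto
  ultimately show ?case by (simp add: rho.single_eq idc_ops(5)[symmetric] pcell_ops)
next
  case (add p q)
  then have "in_Z p" "in_Z q" using Dtheta_star_omonoid by blast+
  then show ?case using add by (simp add: rho.add_eq idc_ops(3)[symmetric] pcell_ops)
qed

lemma rho_brk_normal: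
  assumes "keys p \<subseteq> Dtheta_star Z"
  shows "rho (brk \<tau> p) = lin_base p"
proof -
  have p: "in_Z p" using assms Dtheta_star_omonoid by blast
  have "oper M1 \<tau> (one_cell p) = one_cell (brk \<tau> p)"
    using idc_ops(6)[OF pcell_ops(1)[OF p], of \<tau>, symmetric] pcell_ops(3)[OF p, of \<tau>] by simp
  then show ?thesis
    using rho_brk[OF p, of \<tau>] rho_normal[OF assms] nrm_normal[OF assms, of lam]
      star_laws(6)[OF arr_lin_base[OF assms] arr_one_cell] arrD(2)[OF arr_lin_base[OF assms]] Diff_eq[of \<tau>] by simp
qed

subsection \<open>Parallel cells of dimension one are equal\<close>

text \<open>The property to be shown of all \<open>1\<close>-cells; each operation is checked to preserve it.\<close>

definition reduced where
  "reduced f \<longleftrightarrow> (\<exists>p q. arr f p q \<and> f \<star> rho q = rho p)"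

lemma reducedI: "arr f p q \<Longrightarrow> f \<star> rho q = rho p \<Longrightarrow> reduced f"
  by (auto simp: reduced_def)

lemma reduced_nrm: "arr f p q \<Longrightarrow> f \<star> rho q = rho p \<Longrightarrow> nrm lam p = nrm lam q"
proof -
  assume a: "arr f p q" and e: "f \<star> rho q = rho p"
  have "arr (rho p) p (nrm lam q)" using arr_star[OF a arr_rho[OF arrD(2)[OF a]]] e by simp
  from arr_unique[OF this arr_rho[OF arrD(1)[OF a]]] show ?thesis by simp
qed

lemma reduced_one_cell: "in_Z p \<Longrightarrow> reduced (one_cell p)"
  using reducedI[OF arr_one_cell] star_laws(6)[OF arr_rho arr_one_cell] arrD(2)[OF arr_rho] by metis

lemma reduced_add: "reduced f \<Longrightarrow> reduced g \<Longrightarrow> reduced (f \<oplus>\<^bsub>M1\<^esub> g)"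
proof -
  assume "reduced f" "reduced g"
  then obtain p q p' q' where f: "arr f p q" "f \<star> rho q = rho p" and g: "arr g p' q'" "g \<star> rho q' = rho p'"
    by (auto simp: reduced_def)
  show ?thesis using star_laws(1)[OF f(1) arr_rho g(1) arr_rho] f g arrD(1,2)[OF f(1)] arrD(1,2)[OF g(1)]
    by (intro reducedI[OF arr_add[OF f(1) g(1)]]) (simp add: rho.add_eq)
qed

lemma reduced_mult: "reduced f \<Longrightarrow> reduced g \<Longrightarrow> reduced (f \<otimes>\<^bsub>M1\<^esub> g)"
proof -
  assume "reduced f" "reduced g"
  then obtain p q p' q' where f: "arr f p q" "f \<star> rho q = rho p" and g: "arr g p' q'" "g \<star> rho q' = rho p'"
    by (auto simp: reduced_def)
  show ?thesis using star_laws(2)[OF f(1) arr_rho g(1) arr_rho] f g arrD(1,2)[OF f(1)] arrD(1,2)[OF g(1)]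
    by (intro reducedI[OF arr_mult[OF f(1) g(1)]]) (simp add: rho_mult)
qed

lemma reduced_smult: "reduced f \<Longrightarrow> reduced (c \<odot>\<^bsub>M1\<^esub> f)"
proof -
  assume "reduced f"
  then obtain p q where f: "arr f p q" "f \<star> rho q = rho p" by (auto simp: reduced_def)
  show ?thesis using star_laws(3)[OF f(1) arr_rho, of c] f arrD(1,2)[OF f(1)]
    by (intro reducedI[OF arr_scale[OF f(1)]]) (simp add: rho.scale_eq)
qed

text \<open>Reducing \<open>D(q)\<close> factors through \<open>D(\<rho>\<^sub>q)\<close>, which composes with \<open>D(f)\<close> to \<open>D(\<rho>\<^sub>p)\<close>; the remaining factor
  depends only on the common normal form of \<open>p\<close> and \<open>q\<close>.\<close>

lemma reduced_oper: "reduced f \<Longrightarrow> reduced (oper M1 \<tau> f)"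
proof -
  assume "reduced f"
  then obtain p q where f: "arr f p q" "f \<star> rho q = rho p" by (auto simp: reduced_def)
  note Z = arrD(1,2)[OF f(1)]
  note b = arr_lin_base[OF keys_nrm[OF Z(2), of lam], folded Diff_eq[of \<tau>]]
  have "oper M1 \<tau> f \<star> rho (brk \<tau> q) = (oper M1 \<tau> f \<star> oper M1 \<tau> (rho q)) \<star> lin_base (nrm lam q)"
    using star_laws(5)[OF arr_oper[OF f(1)] arr_oper[OF arr_rho[OF Z(2)]] b] by (simp add: rho_brk[OF Z(2)])
  also have "\<dots> = oper M1 \<tau> (rho p) \<star> lin_base (nrm lam p)"
    using star_laws(4)[OF f(1) arr_rho[OF Z(2)], of \<tau>] f(2) reduced_nrm[OF f] by simp
  also have "\<dots> = rho (brk \<tau> p)" by (simp add: rho_brk[OF Z(1)])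
  finally show ?thesis by (rule reducedI[OF arr_oper[OF f(1)]])
qed

lemma reduced_star: "reduced f \<Longrightarrow> reduced g \<Longrightarrow> tgt (free_alg S) 0 f = src (free_alg S) 0 g \<Longrightarrow> reduced (f \<star> g)"
proof -
  assume "reduced f" "reduced g" and t: "tgt (free_alg S) 0 f = src (free_alg S) 0 g"
  then obtain p q q' r where f: "arr f p q" "f \<star> rho q = rho p" and g': "arr g q' r" "g \<star> rho r = rho q'"
    by (auto simp: reduced_def)
  have "q = q'" using t f g' pcell_injD by (simp add: arr_def)
  then have g: "arr g q r" "g \<star> rho r = rho q" using g' by auto
  show ?thesis using star_laws(5)[OF f(1) g(1) arr_rho] f g arrD(2)[OF g(1)]
    by (intro reducedI[OF arr_star[OF f(1) g(1)]]) simp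
qed

text \<open>The target of a generator is normal, and its source \<open>D(w)\<close> is reduced by the generator itself.\<close>

lemma reduced_gen: "g \<in> gens S (Suc 0) \<Longrightarrow> reduced (gcell S (Suc 0) g)"
proof -
  assume "g \<in> gens S (Suc 0)"
  then obtain w where w: "w \<in> Dtheta_star Z" "length w \<noteq> 1" "g = [[], dop w]"
    using sq_gens_1_diff[of Z lam] unfolding gens by auto
  have b: "base_cell Z S w = gcell S (Suc 0) g" using w by (simp add: base_cell_def)
  have a: "arr (gcell S (Suc 0) g) (mon (dop w)) (der lam w)" using arr_base_cell[OF w(1)] b by simp
  have "gcell S (Suc 0) g \<star> rho (der lam w) = gcell S (Suc 0) g"
    unfolding rho_normal[OF der_in_Z(1)[OF w(1)]] by (rule star_laws(7)[OF a arr_rho[OF arrD(2)[OF a]]])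
  also have "\<dots> = rho (mon (dop w))"
    using rho_brk_normal[of "mon w" Diff] w base.single_eq[OF w(1), of 1] base.h[OF w(1)] b by (simp add: M1_op(6))
  finally show ?thesis by (rule reducedI[OF a])
qed

lemma ecls_reduced: "ceq S n a b \<Longrightarrow> n = Suc 0 \<Longrightarrow> reduced (ecls S n a)"
proof (induction rule: ceq.induct)
  case (gen g n)
  then show ?case using reduced_gen by (simp add: gcell_def)
next
  case (idt n a a')
  then have a: "ceq S 0 a a" using ceq_reflL by simp
  obtain p where "in_Z p" "ecls S 0 a = pcell S p" using pcell_surjD[OF ecls_in[OF a]] by blast
  then show ?case using idc_cls[OF a] reduced_one_cell idt.prems by (metis Suc_inject)
next
  case (sum n a a' b b')
  then show ?case using free_cells_ops2(1)[OF ceq_reflL[OF sum.hyps(1)] ceq_reflL[OF sum.hyps(2)]] reduced_add by metis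
next
  case (scal n a a' c)
  then show ?case using free_cells_ops1(1)[OF ceq_reflL[OF scal.hyps(1)]] reduced_smult by metis
next
  case (prod n a a' b b')
  then show ?case using free_cells_ops2(2)[OF ceq_reflL[OF prod.hyps(1)] ceq_reflL[OF prod.hyps(2)]] reduced_mult by metis
next
  case (oper n a a' \<tau>)
  then show ?case using free_cells_ops1(2)[OF ceq_reflL[OF oper.hyps(1)]] reduced_oper by metis
next
  case (comp k n a a' b b')
  have n: "n = Suc 0" and k: "k = 0" using comp.hyps(1) comp.prems by simp_all
  have a: "ceq S (Suc 0) a a" and b: "ceq S (Suc 0) b b" using comp.hyps(2,3) n ceq_reflL by blast+
  have d: "ceq S 0 (down (etgt S) 0 (Suc 0) a) (down (esrc S) 0 (Suc 0) b)" using comp.hyps(4) n k by simp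
  have c: "composable (free_alg S) (Suc 0) 0 (ecls S (Suc 0) a) (ecls S (Suc 0) b)"
    using d by (simp only: composable_cls[OF polygraph zero_less_Suc a b])
  then have "tgt (free_alg S) 0 (ecls S (Suc 0) a) = src (free_alg S) 0 (ecls S (Suc 0) b)" by simp
  moreover have "reduced (ecls S (Suc 0) a)" "reduced (ecls S (Suc 0) b)" using comp.IH n by simp_all
  ultimately have "reduced (ecls S (Suc 0) a \<star> ecls S (Suc 0) b)" by (intro reduced_star)
  then show ?case unfolding n k comp_cls[OF zero_less_Suc a b d] .
next
  case (sym n a b)
  then show ?case using ecls_eq by metis
qed auto

lemma star_rho: "arr f p q \<Longrightarrow> f \<star> rho q = rho p"
proof -
  assume f: "arr f p q"
  obtain a where "ceq S (Suc 0) a a" "f = ecls S (Suc 0) a" using free_obtain[OF arrD(3)[OF f]] by blast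
  then have "reduced f" using ecls_reduced by blast
  then show ?thesis using arr_unique[OF f] by (auto simp: reduced_def)
qed

lemma arr_parallel_eq: "arr f p q \<Longrightarrow> arr g p q \<Longrightarrow> f = g"
  using star_cancel[OF _ _ arr_rho] star_rho arrD(2) by metis

end

section \<open>The ideal of the differential relations\<close>

definition nrm_kernel :: "'z set \<Rightarrow> 'k \<Rightarrow> ('k::field, 'z, diff_op) opoly set" where
  "nrm_kernel Z lam = {p. keys p \<subseteq> omonoid Z \<and> nrm lam p = 0}"

lemma free_opalg_sel [simp]:
  "monoid.mult (free_opalg Z) = (*)" "add (free_opalg Z) = (+)" "one (free_opalg Z) = 1" "zero (free_opalg Z) = 0"
  "smult (free_opalg Z) = scale" "oper (free_opalg Z) = brk"
  by (simp_all add: free_opalg_def)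

lemma free_opalg_minus:
  fixes p q :: "('k::field, 'z, 'w) opoly"
  assumes "keys q \<subseteq> omonoid Z"
  shows "\<ominus>\<^bsub>free_opalg Z :: ('k, ('k, 'z, 'w) opoly, 'w) opalg\<^esub> q = - q"
    "p \<ominus>\<^bsub>free_opalg Z :: ('k, ('k, 'z, 'w) opoly, 'w) opalg\<^esub> q = p - q"
proof -
  show m: "\<ominus>\<^bsub>free_opalg Z :: ('k, ('k, 'z, 'w) opoly, 'w) opalg\<^esub> q = - q"
    using minus_smult[OF free_opalg_operated[of Z], of q] assms by (simp add: scale_neg)
  show "p \<ominus>\<^bsub>free_opalg Z :: ('k, ('k, 'z, 'w) opoly, 'w) opalg\<^esub> q = p - q"
    unfolding a_minus_def m by simp
qed

lemma nrm_one: "nrm lam 1 = 1"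
  using linx_single[of "nrm_mono lam" "[]" 1] by (simp add: mon_Nil)

lemma op_ideal_nrm_kernel:
  fixes lam :: "'k::field" and Z :: "'z set"
  shows "op_ideal (nrm_kernel Z lam) (free_opalg Z)"
proof -
  interpret ring "free_opalg Z :: ('k, ('k, 'z, diff_op) opoly, diff_op) opalg"
    by (rule operated_algebraD(1)[OF free_opalg_operated])
  have "ideal (nrm_kernel Z lam) (free_opalg Z)"
  proof (rule idealI[OF operated_algebraD(1)[OF free_opalg_operated]])
    show "subgroup (nrm_kernel Z lam) (add_monoid (free_opalg Z))"
    proof (rule add.subgroupI)
      fix a assume a: "a \<in> nrm_kernel Z lam"
      then have "\<ominus>\<^bsub>free_opalg Z\<^esub> a = scale (-1) a" by (simp add: nrm_kernel_def free_opalg_minus scale_neg)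
      then show "\<ominus>\<^bsub>free_opalg Z\<^esub> a \<in> nrm_kernel Z lam" using a by (simp add: nrm_kernel_def carrier_closed)
    next
      show "nrm_kernel Z lam \<noteq> {}" by (auto simp: nrm_kernel_def intro: exI[of _ 0])
    qed (auto simp: nrm_kernel_def intro: subsetD[OF carrier_closed(1)])
  qed (simp_all add: nrm_kernel_def carrier_closed)
  then show ?thesis by (simp add: op_ideal_def nrm_kernel_def carrier_closed)
qed

text \<open>An operated ideal that contains the relations \<open>D(w) = der w\<close> contains \<open>p - nrm p\<close> for every \<open>p\<close>, by
  induction over brackets and letters.\<close>

lemma nrm_kernel_least:
  fixes lam :: "'k::field" and Z :: "'z set"
  assumes J: "op_ideal J (free_opalg Z)"
    and rel: "\<And>w. w \<in> Dtheta_star Z \<Longrightarrow> length w \<noteq> 1 \<Longrightarrow> mon (dop w) - der lam w \<in> J"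
  shows "nrm_kernel Z lam \<subseteq> J"
proof -
  interpret ideal J "free_opalg Z :: ('k, ('k, 'z, diff_op) opoly, diff_op) opalg"
    using J by (simp add: op_ideal_def)
  have z: "0 \<in> J" and a: "p \<in> J \<Longrightarrow> q \<in> J \<Longrightarrow> p + q \<in> J" for p q
    using zero_closed additive_subgroup.zero_closed[OF additive_subgroup_axioms] additive_subgroup.a_closed[OF additive_subgroup_axioms] by auto
  have m: "p \<in> J \<Longrightarrow> keys q \<subseteq> omonoid Z \<Longrightarrow> p * q \<in> J" "p \<in> J \<Longrightarrow> keys q \<subseteq> omonoid Z \<Longrightarrow> q * p \<in> J" for p q
    using I_r_closed[of p q] I_l_closed[of p q] by simp_all
  have s: "p \<in> J \<Longrightarrow> scale c p \<in> J" "p \<in> J \<Longrightarrow> brk \<tau> p \<in> J" for p c \<tau>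
    using J by (auto simp: op_ideal_def)
  have rel': "mon (dop w) - der lam w \<in> J" if "w \<in> Dtheta_star Z" for w
  proof (cases "length w = 1")
    case True
    then obtain l where "w = [l]" by (auto simp: length_Suc_conv)
    then show ?thesis by (simp add: der_letter mon_mult z)
  qed (use rel that in blast)
  have brk: "brk \<tau> r - linx (der lam) r \<in> J" if "keys r \<subseteq> Dtheta_star Z" for r \<tau> using that
  proof (induction r rule: poly_mapping_support_induct)
    case zero
    then show ?case by (simp add: z)
  next
    case (single u c)
    have "brk \<tau> (single u c) - linx (der lam) (single u c) = scale c (mon (dop u) - der lam u)"
      using diff_op.exhaust[of \<tau> "\<tau> = Diff"] by (simp add: scale_diff)
    then show ?case using s(1)[OF rel'[OF single], of c] by (simp only:)
  next
    case (add p q)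
    have "brk \<tau> (p + q) - linx (der lam) (p + q) = (brk \<tau> p - linx (der lam) p) + (brk \<tau> q - linx (der lam) q)" by simp
    then show ?case using a[OF add(3,4)] by (simp only:)
  qed
  have cons: "mon (l # u) - nrm_letter lam l * nrm_mono lam u \<in> J"
    if "mon [l] - nrm_letter lam l \<in> J" "mon u - nrm_mono lam u \<in> J" "set1_letter l \<subseteq> Z" "u \<in> omonoid Z" for l u
  proof -
    have n: "keys (nrm_letter lam l) \<subseteq> omonoid Z" "keys (mon u :: ('k, 'z, diff_op) opoly) \<subseteq> omonoid Z"
      using keys_nrm_letter[OF that(3), of lam] Dtheta_star_omonoid that(4) by (blast, simp)
    \<comment> \<open>A difference of products is a combination of the differences of the factors.\<close>
    have "mon (l # u) - nrm_letter lam l * nrm_mono lam u =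
        (mon [l] - nrm_letter lam l) * mon u + nrm_letter lam l * (mon u - nrm_mono lam u)"
      by (simp add: left_diff_distrib right_diff_distrib mon_mult)
    then show ?thesis using a[OF m(1)[OF that(1) n(2)] m(2)[OF that(2) n(1)]] by simp
  qed
  have letter: "mon [l] - nrm_letter lam l \<in> J" if "set1_letter l \<subseteq> Z" for l using that
  proof (induction l)
    case (Br \<tau> u)
    have u: "u \<in> omonoid Z" using Br.prems by simp
    have uJ: "mon u - nrm_mono lam u \<in> J" using Br.IH u
    proof (induction u)
      case (Cons l u)
      have "mon [l] - nrm_letter lam l \<in> J" "mon u - nrm_mono lam u \<in> J" using Cons by simp_all
      then show ?case using cons Cons.prems(2) by (simp add: nrm_mono_Cons)
    qed (simp add: mon_Nil z)
    have e: "mon [Br \<tau> u] - nrm_letter lam (Br \<tau> u) =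
        brk \<tau> (mon u - nrm_mono lam u) + (brk \<tau> (nrm_mono lam u) - linx (der lam) (nrm_mono lam u))"
      using linx_minus[of "\<lambda>u. mon [Br \<tau> u]" "mon u" "nrm_mono lam u"] by (simp add: brk_linx nrm_mono_def)
    show ?case unfolding e by (rule a[OF s(2)[OF uJ] brk[OF keys_nrm_mono[OF u]]])
  qed (simp add: z)
  have mono: "mon u - nrm_mono lam u \<in> J" if "u \<in> omonoid Z" for u using that
  proof (induction u)
    case (Cons l u)
    then show ?case using cons letter by (simp add: nrm_mono_Cons)
  qed (simp add: mon_Nil z)
  have poly: "p - nrm lam p \<in> J" if "keys p \<subseteq> omonoid Z" for p using that
  proof (induction p rule: poly_mapping_support_induct)
    case zero
    then show ?case by (simp add: z)
  next
    case (single u c)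
    have "single u c - nrm lam (single u c) = scale c (mon u - nrm_mono lam u)"
      by (simp add: scale_diff)
    then show ?case using s(1)[OF mono[OF single], of c] by (simp only:)
  next
    case (add p q)
    have "(p + q) - nrm lam (p + q) = (p - nrm lam p) + (q - nrm lam q)" by simp
    then show ?case using a[OF add(3,4)] by (simp only:)
  qed
  show ?thesis using poly by (fastforce simp: nrm_kernel_def)
qed

text \<open>The relations \<open>D(w) = der w\<close> follow from the differential relations letter by letter, just as \<open>der\<close> is
  defined.\<close>

lemma diff_ideal_eq:
  fixes lam :: "'k::field" and Z :: "'z set"
  shows "gen_op_ideal (free_opalg Z) (diff_rels Z lam) = nrm_kernel Z lam"
proof
  let ?J = "gen_op_ideal (free_opalg Z) (diff_rels Z lam)"
  have R: "diff_rels Z lam \<subseteq> nrm_kernel Z lam"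
  proof
    fix r assume "r \<in> diff_rels Z lam"
    then consider a b where "keys a \<subseteq> omonoid Z" "keys b \<subseteq> omonoid Z"
        "r = brk Diff (a * b) - (brk Diff a * b + a * brk Diff b + scale lam (brk Diff a * brk Diff b))"
      | "r = brk Diff 1" by (auto simp: diff_rels_def Let_def)
    then show "r \<in> nrm_kernel Z lam"
    proof cases
      case 1
      have "keys r \<subseteq> omonoid Z" unfolding 1(3) by (intro carrier_closed 1(1,2))
      moreover have "nrm lam r = 0" unfolding 1(3) by (simp add: linx_minus linx_der_mult)
      ultimately show ?thesis by (simp add: nrm_kernel_def)
    next
      case 2
      have "linx (der lam) 1 = (0 :: ('k, 'z, diff_op) opoly)" by (simp flip: mon_Nil)
      then show ?thesis by (simp add: 2 nrm_kernel_def carrier_closed nrm_one)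
    qed
  qed
  then show "?J \<subseteq> nrm_kernel Z lam" by (rule gen_op_ideal_least[OF op_ideal_nrm_kernel])
  have "diff_rels Z lam \<subseteq> carrier (free_opalg Z)" using R by (auto simp: nrm_kernel_def)
  note J = gen_op_ideal_ideal[OF free_opalg_operated this]
  interpret ideal ?J "free_opalg Z :: ('k, ('k, 'z, diff_op) opoly, diff_op) opalg"
    using J(1) by (simp add: op_ideal_def)
  have a: "p \<in> ?J \<Longrightarrow> q \<in> ?J \<Longrightarrow> p + q \<in> ?J" for p q
    using additive_subgroup.a_closed[OF additive_subgroup_axioms] by auto
  have m: "p \<in> ?J \<Longrightarrow> keys q \<subseteq> omonoid Z \<Longrightarrow> q * p \<in> ?J" for p q
    using I_l_closed[of p q] by simp
  have s: "p \<in> ?J \<Longrightarrow> scale c p \<in> ?J" for p c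
    using J(1) by (auto simp: op_ideal_def)
  have "mon (dop w) - der lam w \<in> ?J" if "w \<in> Dtheta_star Z" for w using that
  proof (induction w)
    case Nil
    have "brk Diff 1 \<in> ?J" using J(2) by (auto simp: diff_rels_def Let_def)
    moreover have "brk Diff (1 :: ('k, 'z, diff_op) opoly) = mon (dop [])" by (simp flip: mon_Nil)
    ultimately show ?case by simp
  next
    case (Cons l w)
    let ?l = "mon [l] :: ('k, 'z, diff_op) opoly" and ?w = "mon w :: ('k, 'z, diff_op) opoly"
    have w: "w \<in> Dtheta_star Z" using Cons.prems by (simp add: Dtheta_star_iff)
    have "l # w \<in> omonoid Z" using Cons.prems Dtheta_star_omonoid by blast
    then have lw: "keys ?l \<subseteq> omonoid Z" "keys ?w \<subseteq> omonoid Z" by simp_all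
    have "brk Diff (?l * ?w) - (brk Diff ?l * ?w + ?l * brk Diff ?w + scale lam (brk Diff ?l * brk Diff ?w)) \<in> diff_rels Z lam"
      unfolding diff_rels_def Let_def using lw in_carrier_iff by blast
    then have r: "brk Diff (?l * ?w) - (brk Diff ?l * ?w + ?l * brk Diff ?w + scale lam (brk Diff ?l * brk Diff ?w)) \<in> ?J"
      using J(2) by blast
    let ?d = "mon (dop w) - der lam w"
    have d: "?d \<in> ?J" by (rule Cons.IH[OF w])
    have dl: "keys (mon (dop [l]) :: ('k, 'z, diff_op) opoly) \<subseteq> omonoid Z" using lw by simp
    have D: "brk Diff (?l * ?w) = mon (dop (l # w))" "brk Diff ?l = mon (dop [l])" "brk Diff ?w = mon (dop w)"
      by (simp_all add: mon_mult)
    have "mon (dop (l # w)) - der lam (l # w) =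
        (brk Diff (?l * ?w) - (brk Diff ?l * ?w + ?l * brk Diff ?w + scale lam (brk Diff ?l * brk Diff ?w)))
        + (?l * ?d + scale lam (mon (dop [l]) * ?d))"
      unfolding D der.simps by (simp add: right_diff_distrib scale_diff)
    then show ?case using a[OF r a[OF m[OF d lw(1)] s[OF m[OF d dl], of lam]]] by (simp only:)
  qed
  then show "nrm_kernel Z lam \<subseteq> ?J" by (intro nrm_kernel_least J(1))
qed

section \<open>The contraction\<close>

context diff_resolution
begin

definition pval :: "('k, 'z, diff_op, ('z, diff_op) mono list) cexp set \<Rightarrow> ('k, 'z, diff_op) opoly" where
  "pval c = (THE p. in_Z p \<and> c = pcell S p)"

lemma pval_pcell [simp]: "in_Z p \<Longrightarrow> pval (pcell S p) = p"
  unfolding pval_def using pcell_injD by (intro the_equality) auto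

lemma pcell_pval: "c \<in> carrier M0 \<Longrightarrow> in_Z (pval c) \<and> pcell S (pval c) = c"
  using pcell_surjD[of c] by auto

lemma pval_hom: "pval \<in> op_hom M0 (free_opalg Z)"
proof (rule op_homI)
  fix x y c \<tau> assume "x \<in> carrier M0"
  then obtain p where p: "in_Z p" "x = pcell S p" using pcell_surjD by blast
  show "pval x \<in> carrier (free_opalg Z)" "pval (c \<odot>\<^bsub>M0\<^esub> x) = c \<odot>\<^bsub>free_opalg Z\<^esub> pval x"
    "pval (oper M0 \<tau> x) = oper (free_opalg Z) \<tau> (pval x)"
    using p by (simp_all add: pcell_ops carrier_closed)
  assume "y \<in> carrier M0"
  then obtain q where q: "in_Z q" "y = pcell S q" using pcell_surjD by blast
  show "pval (x \<otimes>\<^bsub>M0\<^esub> y) = pval x \<otimes>\<^bsub>free_opalg Z\<^esub> pval y" "pval (x \<oplus>\<^bsub>M0\<^esub> y) = pval x \<oplus>\<^bsub>free_opalg Z\<^esub> pval y"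
    using p q by (simp_all add: pcell_ops carrier_closed)
next
  show "pval \<one>\<^bsub>M0\<^esub> = \<one>\<^bsub>free_opalg Z\<^esub>" using pval_pcell[of 1] by (simp add: pcell_one)
qed

lemma pval_bij: "bij_betw pval (carrier M0) (carrier (free_opalg Z))"
  by (rule bij_betw_byWitness[where f' = "pcell S"]) (auto simp: pcell_pval pcell_ops dest: pcell_pval)

abbreviation "rels \<equiv> {bsrc S 1 g \<ominus>\<^bsub>M0\<^esub> btgt S 1 g | g. g \<in> gens S 1}"

lemma rels_eq: "rels = {pcell S (mon (dop w) - der lam w) | w. w \<in> Dtheta_star Z \<and> length w \<noteq> 1}"
proof -
  have "bsrc S 1 [[], dop w] \<ominus>\<^bsub>M0\<^esub> btgt S 1 [[], dop w] = pcell S (mon (dop w) - der lam w)"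
    if w: "w \<in> Dtheta_star Z" "length w \<noteq> 1" for w
  proof -
    have Z: "in_Z (mon (dop w))" "in_Z (der lam w)" using dop_omonoid der_in_Z(2) w by simp_all
    have "pcell S (mon (dop w) - der lam w) = pcell S (mon (dop w)) \<ominus>\<^bsub>M0\<^esub> pcell S (der lam w)"
      using op_hom_minus(1)[OF free_opalg_operated free_operated pcell_hom[of S, unfolded gens0], of "mon (dop w)" "der lam w"] Z
      by (simp add: free_opalg_minus)
    then show ?thesis using bsrc btgt w by simp
  qed
  then show ?thesis unfolding gens sq_gens_1_diff by auto
qed

lemma pres_ideal_eq: "pres_ideal S = {c \<in> carrier M0. pval c \<in> nrm_kernel Z lam}"
proof
  have k: "mon (dop w) - der lam w \<in> nrm_kernel Z lam" if "w \<in> Dtheta_star Z" for w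
    using nrm_normal[OF der_in_Z(1)[OF that], of lam] nrm_mono_normal[OF that, of lam] dop_omonoid[OF that] der_in_Z(2)[OF that]
    by (simp add: nrm_kernel_def linx_minus carrier_closed)
  have R: "rels \<subseteq> {c \<in> carrier M0. pval c \<in> nrm_kernel Z lam}"
    unfolding rels_eq using k pval_pcell pcell_ops(1) unfolding nrm_kernel_def by fastforce
  show "pres_ideal S \<subseteq> {c \<in> carrier M0. pval c \<in> nrm_kernel Z lam}"
    unfolding pres_ideal_def
    by (rule gen_op_ideal_least[OF op_ideal_vimage[OF free_operated free_opalg_operated pval_hom op_ideal_nrm_kernel] R])
  have "rels \<subseteq> carrier M0" using R by blast
  note J = gen_op_ideal_ideal[OF free_operated this, folded pres_ideal_def]
  have "nrm_kernel Z lam \<subseteq> {p \<in> carrier (free_opalg Z). pcell S p \<in> pres_ideal S}"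
    by (rule nrm_kernel_least[OF op_ideal_vimage[OF free_opalg_operated free_operated pcell_hom[of S, unfolded gens0] J(1)]])
      (use J(2) rels_eq dop_omonoid der_in_Z(2) in \<open>auto simp: carrier_closed intro!: subsetD[OF carrier_closed(5)]\<close>)
  then show "{c \<in> carrier M0. pval c \<in> nrm_kernel Z lam} \<subseteq> pres_ideal S"
    using pcell_pval by fastforce
qed

sublocale quot: op_quotient M0 "pres_ideal S"
proof
  show "operated_algebra M0" by (rule free_operated)
  show "op_ideal (pres_ideal S) M0" unfolding pres_ideal_eq
    by (rule op_ideal_vimage[OF free_operated free_opalg_operated pval_hom op_ideal_nrm_kernel])
qed

lemma presented_iso: "op_iso (presented S) (free_diff_alg Z lam)"
  unfolding presented_def free_diff_alg_def diff_ideal_eq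
proof (rule op_iso_quot[OF quot.op_quotient_axioms _ pval_hom pval_bij])
  show "op_quotient (free_opalg Z) (nrm_kernel Z lam)"
    by standard (rule free_opalg_operated, rule op_ideal_nrm_kernel)
next
  fix x assume "x \<in> carrier M0"
  then show "x \<in> pres_ideal S \<longleftrightarrow> pval x \<in> nrm_kernel Z lam" unfolding pres_ideal_eq by blast
qed

lemma coset_nrm:
  assumes "x \<in> carrier M0" "y \<in> carrier M0"
  shows "pres_ideal S +>\<^bsub>M0\<^esub> x = pres_ideal S +>\<^bsub>M0\<^esub> y \<longleftrightarrow> nrm lam (pval x) = nrm lam (pval y)"
proof -
  have Z: "in_Z (pval x)" "in_Z (pval y)" using assms pcell_pval by auto
  have "pval (x \<ominus>\<^bsub>M0\<^esub> y) = pval x - pval y"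
    using op_hom_minus(1)[OF free_operated free_opalg_operated pval_hom assms] Z by (simp add: free_opalg_minus)
  moreover have "x \<ominus>\<^bsub>M0\<^esub> y \<in> carrier M0" using assms by (rule quot.minus_closed)
  moreover have "pval x - pval y \<in> nrm_kernel Z lam \<longleftrightarrow> nrm lam (pval x) = nrm lam (pval y)"
    using carrier_closed(5)[OF Z] by (simp add: nrm_kernel_def linx_minus)
  ultimately have "x \<ominus>\<^bsub>M0\<^esub> y \<in> pres_ideal S \<longleftrightarrow> nrm lam (pval x) = nrm lam (pval y)"
    unfolding pres_ideal_eq mem_Collect_eq by metis
  then show ?thesis using quot.coset_eq_iff assms by simp
qed

text \<open>All elements of a coset have the same normal form by \<open>coset_nrm\<close>, so the choice of a representative does
  not matter.\<close>

definition iota where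
  "iota n x = up (idc (free_alg S)) 0 n (pcell S (nrm lam (pval (SOME c. c \<in> x))))"

lemma iota_coset:
  assumes "c \<in> carrier M0"
  shows "iota n (pres_ideal S +>\<^bsub>M0\<^esub> c) = up (idc (free_alg S)) 0 n (pcell S (nrm lam (pval c)))"
proof -
  let ?d = "SOME d. d \<in> pres_ideal S +>\<^bsub>M0\<^esub> c"
  have "?d \<in> pres_ideal S +>\<^bsub>M0\<^esub> c" by (rule someI[of _ c]) (rule quot.a_rcos_self[OF assms])
  then have "?d \<in> carrier M0" "?d \<ominus>\<^bsub>M0\<^esub> c \<in> pres_ideal S" using quot.coset_member[OF assms] by blast+
  then have "nrm lam (pval ?d) = nrm lam (pval c)" using coset_nrm assms quot.coset_eq_iff by blast
  then show ?thesis by (simp add: iota_def)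
qed

lemma nrm_in_Z: "in_Z p \<Longrightarrow> in_Z (nrm lam p)"
  using keys_nrm Dtheta_star_omonoid by blast

lemma iota_pcell:
  assumes "in_Z p"
  shows "iota n (proj S 0 (pcell S p)) = up (idc (free_alg S)) 0 n (pcell S (nrm lam p))"
  using iota_coset[of "pcell S p" n] assms by (simp add: proj_def pcell_ops)

lemma presented_obtain:
  assumes "x \<in> carrier (presented S)"
  obtains p where "in_Z p" "x = pres_ideal S +>\<^bsub>M0\<^esub> pcell S p"
  using assms quot.coset_carrier pcell_surjD unfolding presented_def by metis

lemmas up_ops = op_homD[OF up_hom, unfolded cell_free]
lemmas down_ops = op_homD[OF down_hom(1), unfolded cell_free]

lemma unital_section_iota: "unital_section S iota"
proof -
  have i: "iota n (pres_ideal S +>\<^bsub>M0\<^esub> pcell S p) = up (idc (free_alg S)) 0 n (pcell S (nrm lam p))" if "in_Z p" for n p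
    using iota_coset[of "pcell S p" n] that by (simp add: pcell_ops)
  have lin: "iota n \<in> linear_hom (presented S) (free_cells S n)" for n
    unfolding linear_hom_def
  proof (intro CollectI conjI ballI allI funcsetI)
    fix x y c assume "x \<in> carrier (presented S)"
    then obtain p where p: "in_Z p" "x = pres_ideal S +>\<^bsub>M0\<^esub> pcell S p" by (rule presented_obtain)
    show "iota n x \<in> carrier (free_cells S n)"
      using p by (simp add: i up_ops pcell_ops nrm_in_Z)
    show "iota n (c \<odot>\<^bsub>presented S\<^esub> x) = c \<odot>\<^bsub>free_cells S n\<^esub> iota n x"
      using p unfolding presented_def
      by (simp add: quot.coset_ops1 pcell_ops carrier_closed i up_ops(5)[symmetric] nrm_in_Z)
    assume "y \<in> carrier (presented S)"
    then obtain q where q: "in_Z q" "y = pres_ideal S +>\<^bsub>M0\<^esub> pcell S q" by (rule presented_obtain)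
    show "iota n (x \<oplus>\<^bsub>presented S\<^esub> y) = iota n x \<oplus>\<^bsub>free_cells S n\<^esub> iota n y"
      using p q unfolding presented_def
      by (simp add: quot.coset_ops2 pcell_ops carrier_closed i up_ops(3)[symmetric] nrm_in_Z)
  qed
  have one: "iota n \<one>\<^bsub>presented S\<^esub> = \<one>\<^bsub>free_cells S n\<^esub>" for n
    using i[of 1 n] up_ops(4)[of 0 n] by (simp add: presented_def quot.coset_one pcell_one[symmetric] nrm_one)
  have pr: "proj S n (iota n x) = x \<and> src (free_alg S) n (iota (Suc n) x) = iota n x \<and>
      tgt (free_alg S) n (iota (Suc n) x) = iota n x \<and> iota (Suc n) x = idc (free_alg S) n (iota n x)"
    if x: "x \<in> carrier (presented S)" for n x
  proof -
    obtain p where p: "in_Z p" "x = pres_ideal S +>\<^bsub>M0\<^esub> pcell S p" using x by (rule presented_obtain)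
    have c: "pcell S (nrm lam p) \<in> carrier M0" using p nrm_in_Z by (simp add: pcell_ops)
    then have u: "iota n x \<in> carrier (free_cells S n)" using p by (simp add: i up_ops)
    have "down (src (free_alg S)) 0 n (iota n x) = pcell S (nrm lam p)"
      using down_up(1)[of "pcell S (nrm lam p)" 0 0 n] c p by (simp add: i)
    then have "proj S n (iota n x) = pres_ideal S +>\<^bsub>M0\<^esub> pcell S (nrm lam p)" by (simp add: proj_def)
    also have "\<dots> = x" unfolding p(2)
      using coset_nrm[OF c pcell_ops(1)[OF p(1)]] p(1) nrm_in_Z nrm_nrm[of p Z lam] by simp
    finally have "proj S n (iota n x) = x" .
    moreover have "iota (Suc n) x = idc (free_alg S) n (iota n x)" using p by (simp add: i)
    ultimately show ?thesis using u src_idc tgt_idc by simp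
  qed
  show ?thesis unfolding unital_section_def Let_def cell_free using lin one pr by blast
qed

text \<open>In positive dimension \<open>\<sigma>\<^sub>a\<close> has to be an identity, and its source starts with \<open>a \<star>\<^sub>0 \<sigma>\<^bsub>t\<^sub>0(a)\<^esub>\<close>, which is \<open>\<rho>\<close> of the
  \<open>0\<close>-source of \<open>a\<close> by \<open>star_rho\<close>.\<close>

definition sig where
  "sig n a = up (idc (free_alg S)) (Suc 0) (Suc n) (rho (pval (down (src (free_alg S)) 0 n a)))"

lemma high_cell: "Suc 0 \<le> n \<Longrightarrow> a \<in> carrier (free_cells S n) \<Longrightarrow> \<exists>f\<in>carrier M1. a = up (idc (free_alg S)) (Suc 0) n f"
proof (induction n arbitrary: a)
  case (Suc n)
  show ?case
  proof (cases "n = 0")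
    case False
    have "gens S (Suc n) = {}" using False sq_gens_ge2_diff[of "Suc n"] unfolding gens by simp
    moreover obtain e where "ceq S (Suc n) e e" "a = ecls S (Suc n) e" using free_obtain[OF Suc.prems(2)] .
    ultimately have "a \<in> idc (free_alg S) n ` carrier (free_cells S n)"
      using cells_identities[OF polygraph] by blast
    then obtain b where "b \<in> carrier (free_cells S n)" "a = idc (free_alg S) n b" by blast
    then show ?thesis using Suc.IH[of b] False by fastforce
  qed (use Suc.prems in auto)
qed simp

lemma rho_cell: "in_Z p \<Longrightarrow> rho p \<in> carrier M1"
  using arrD(3)[OF arr_rho] .

lemma sig_pcell: "in_Z p \<Longrightarrow> sig 0 (pcell S p) = rho p"
  by (simp add: sig_def)

lemma sig_up:
  assumes "arr f p q" "Suc 0 \<le> n"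
  shows "sig n (up (idc (free_alg S)) (Suc 0) n f) = up (idc (free_alg S)) (Suc 0) (Suc n) (rho p)"
  using down_up(1)[of f "Suc 0" 0 n] arrD[OF assms(1)] assms(2) by (simp add: sig_def)

text \<open>The first composition yields \<open>\<rho>\<^sub>p\<close>; all later ones compose iterated identities of \<open>\<rho>\<^sub>p\<close>.\<close>

lemma contr_src_sig:
  assumes f: "arr f p q" and "Suc j \<le> n"
  shows "contr_src (free_alg S) sig n (Suc j) (up (idc (free_alg S)) (Suc 0) n f) = up (idc (free_alg S)) (Suc 0) n (rho p)"
  using assms(2)
proof (induction j)
  case 0
  have "down (tgt (free_alg S)) 0 n (up (idc (free_alg S)) (Suc 0) n f) = pcell S q"
    using down_up(2)[of f "Suc 0" 0 n] arrD[OF f] 0 by simp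
  then have "contr_src (free_alg S) sig n (Suc 0) (up (idc (free_alg S)) (Suc 0) n f) =
      comp (free_alg S) n 0 (up (idc (free_alg S)) (Suc 0) n f) (up (idc (free_alg S)) (Suc 0) n (rho q))"
    using arrD(2)[OF f] by (simp add: sig_pcell)
  also have "\<dots> = up (idc (free_alg S)) (Suc 0) n (f \<star> rho q)"
    using up_comp[OF zero_less_Suc 0 arr_composable[OF f arr_rho[OF arrD(2)[OF f]]]] by simp
  finally show ?case by (simp only: star_rho[OF f])
next
  case (Suc j)
  have "down (tgt (free_alg S)) (Suc j) n (up (idc (free_alg S)) (Suc 0) n f) = up (idc (free_alg S)) (Suc 0) (Suc j) f"
  proof -
    have "up (idc (free_alg S)) (Suc 0) n f = up (idc (free_alg S)) (Suc j) n (up (idc (free_alg S)) (Suc 0) (Suc j) f)"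
      using Suc.prems by (simp add: up_up del: up.simps)
    then show ?thesis
      using down_up(2)[of "up (idc (free_alg S)) (Suc 0) (Suc j) f" "Suc j" "Suc j" n] Suc.prems arrD(3)[OF f]
      by (simp add: up_ops del: up.simps down.simps)
  qed
  then have "sig (Suc j) (down (tgt (free_alg S)) (Suc j) n (up (idc (free_alg S)) (Suc 0) n f)) =
      up (idc (free_alg S)) (Suc 0) (Suc (Suc j)) (rho p)" using sig_up[OF f, of "Suc j"] by simp
  then show ?case
    using Suc.IH Suc.prems comp_up_self[of "rho p" "Suc 0" "Suc j" n] rho_cell[OF arrD(1)[OF f]]
    unfolding contr_src.simps(2)[of _ _ _ "Suc j"] by (simp add: up_up del: up.simps contr_src.simps)
qed

lemma contr_tgt_sig:
  assumes f: "arr f p q" and "Suc j \<le> n"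
  shows "contr_tgt (free_alg S) sig n (Suc j) (up (idc (free_alg S)) (Suc 0) n f)
     (up (idc (free_alg S)) 0 n (pcell S (nrm lam p))) = up (idc (free_alg S)) (Suc 0) n (rho p)"
  using assms(2)
proof (induction j)
  case 0
  note r = arr_rho[OF arrD(1)[OF f]]
  have "down (src (free_alg S)) 0 n (up (idc (free_alg S)) (Suc 0) n f) = pcell S p"
    using down_up(1)[of f "Suc 0" 0 n] arrD[OF f] 0 by simp
  then have "contr_tgt (free_alg S) sig n (Suc 0) (up (idc (free_alg S)) (Suc 0) n f)
     (up (idc (free_alg S)) 0 n (pcell S (nrm lam p))) =
      comp (free_alg S) n 0 (up (idc (free_alg S)) (Suc 0) n (rho p)) (up (idc (free_alg S)) (Suc 0) n (one_cell (nrm lam p)))"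
    using arrD(1)[OF f] 0 up_up[of 0 "Suc 0" n "idc (free_alg S)" "pcell S (nrm lam p)"] by (simp add: sig_pcell)
  also have "\<dots> = up (idc (free_alg S)) (Suc 0) n (rho p \<star> one_cell (nrm lam p))"
    using up_comp[OF zero_less_Suc 0 arr_composable[OF r arr_one_cell[OF arrD(2)[OF r]]]] by simp
  finally show ?case by (simp only: star_laws(7)[OF r arr_one_cell[OF arrD(2)[OF r]]])
next
  case (Suc j)
  have "down (src (free_alg S)) (Suc j) n (up (idc (free_alg S)) (Suc 0) n f) = up (idc (free_alg S)) (Suc 0) (Suc j) f"
  proof -
    have "up (idc (free_alg S)) (Suc 0) n f = up (idc (free_alg S)) (Suc j) n (up (idc (free_alg S)) (Suc 0) (Suc j) f)"
      using Suc.prems by (simp add: up_up del: up.simps)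
    then show ?thesis
      using down_up(1)[of "up (idc (free_alg S)) (Suc 0) (Suc j) f" "Suc j" "Suc j" n] Suc.prems arrD(3)[OF f]
      by (simp add: up_ops del: up.simps down.simps)
  qed
  then have "sig (Suc j) (down (src (free_alg S)) (Suc j) n (up (idc (free_alg S)) (Suc 0) n f)) =
      up (idc (free_alg S)) (Suc 0) (Suc (Suc j)) (rho p)" using sig_up[OF f, of "Suc j"] by simp
  then show ?case
    using Suc.IH Suc.prems comp_up_self[of "rho p" "Suc 0" "Suc j" n] rho_cell[OF arrD(1)[OF f]]
    unfolding contr_tgt.simps(2)[of _ _ _ "Suc j"] by (simp add: up_up del: up.simps contr_tgt.simps)
qed

lemma contraction_sig: "contraction S iota sig"
proof -
  let ?A = "free_alg S"
  have lin: "sig n \<in> linear_hom (free_cells S n) (free_cells S (Suc n))" for n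
    unfolding linear_hom_def
  proof (intro CollectI conjI ballI allI funcsetI)
    fix x y c assume x: "x \<in> carrier (free_cells S n)"
    have px: "in_Z (pval (down (src ?A) 0 n x))" using down_ops(1)[OF _ x, of 0] pcell_pval by simp
    show "sig n x \<in> carrier (free_cells S (Suc n))"
      unfolding sig_def using rho_cell[OF px] by (intro up_ops(1)) simp_all
    show "sig n (c \<odot>\<^bsub>free_cells S n\<^esub> x) = c \<odot>\<^bsub>free_cells S (Suc n)\<^esub> sig n x"
      unfolding sig_def using rho_cell[OF px] px down_ops(1)[OF _ x, of 0] down_ops(5)[OF _ x, of 0 c]
        op_homD(5)[OF pval_hom, of "down (src ?A) 0 n x" c] up_ops(5)[of "Suc 0" "Suc n" _ c]
      by (simp add: rho.scale_eq del: up.simps)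
    assume y: "y \<in> carrier (free_cells S n)"
    have py: "in_Z (pval (down (src ?A) 0 n y))" using down_ops(1)[OF _ y, of 0] pcell_pval by simp
    show "sig n (x \<oplus>\<^bsub>free_cells S n\<^esub> y) = sig n x \<oplus>\<^bsub>free_cells S (Suc n)\<^esub> sig n y"
      unfolding sig_def using rho_cell[OF px] rho_cell[OF py] px py down_ops(1)[OF _ x, of 0] down_ops(1)[OF _ y, of 0]
        down_ops(3)[OF _ x y, of 0] op_homD(3)[OF pval_hom, of "down (src ?A) 0 n x" "down (src ?A) 0 n y"]
        up_ops(3)[of "Suc 0" "Suc n"]
      by (simp add: rho.add_eq del: up.simps)
  qed
  have cell: "src ?A n (sig n a) = contr_src ?A sig n n a \<and>
        tgt ?A n (sig n a) = contr_tgt ?A sig n n a (iota n (proj S n a)) \<and>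
        sig (Suc n) (idc ?A n a) = idc ?A (Suc n) (sig n a) \<and>
        sig (Suc n) (sig n a) = idc ?A (Suc n) (sig n a)"
    if a: "a \<in> carrier (free_cells S n)" for n a
  proof (cases n)
    case 0
    obtain p where p: "in_Z p" "a = pcell S p" using pcell_surjD a 0 by blast
    note r = arrD[OF arr_rho[OF p(1)]]
    have "sig (Suc 0) (rho p) = up (idc ?A) (Suc 0) (Suc (Suc 0)) (rho p)"
      "sig (Suc 0) (idc ?A 0 a) = up (idc ?A) (Suc 0) (Suc (Suc 0)) (rho p)"
      using sig_up[OF arr_rho[OF p(1)], of "Suc 0"] sig_up[OF arr_one_cell[OF p(1)], of "Suc 0"] p by simp_all
    then show ?thesis using r p iota_pcell[OF p(1), of 0] by (simp add: 0 sig_pcell)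
  next
    case (Suc m)
    then have n: "Suc 0 \<le> n" by simp
    obtain f where "f \<in> carrier M1" and af: "a = up (idc ?A) (Suc 0) n f" using high_cell[OF n a] by blast
    then obtain p q where f: "arr f p q" using arr_exists by blast
    let ?r = "up (idc ?A) (Suc 0) n (rho p)"
    have s: "sig n a = idc ?A n ?r" unfolding af sig_up[OF f n] using n by simp
    have rc: "rho p \<in> carrier M1" using rho_cell arrD(1)[OF f] by blast
    then have c: "?r \<in> carrier (free_cells S n)" using n by (intro up_ops(1))
    have d: "down (src ?A) 0 n a = pcell S p"
      using down_up(1)[of f "Suc 0" 0 n] arrD[OF f] n by (simp add: af)
    have pr: "proj S n a = proj S 0 (pcell S p)" by (simp add: proj_def d)
    have 1: "contr_src ?A sig n n a = ?r" using contr_src_sig[OF f, of m n] unfolding af Suc by simp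
    have 2: "contr_tgt ?A sig n n a (iota n (proj S n a)) = ?r"
      using contr_tgt_sig[OF f, of m n] unfolding pr iota_pcell[OF arrD(1)[OF f]] unfolding af Suc by simp
    have 3: "sig (Suc n) (idc ?A n a) = idc ?A (Suc n) (sig n a)"
      using sig_up[OF f, of "Suc n"] n unfolding s unfolding af by simp
    have 4: "sig (Suc n) (sig n a) = idc ?A (Suc n) (sig n a)"
      using sig_up[OF arr_rho[OF arrD(1)[OF f]], of "Suc n"] n unfolding s by simp
    show ?thesis using 1 2 3 4 s src_idc tgt_idc c by simp
  qed
  have norm: "sig n (iota n x) = idc ?A n (iota n x)" if x: "x \<in> carrier (presented S)" for n x
  proof -
    obtain p where p: "in_Z p" "x = pres_ideal S +>\<^bsub>M0\<^esub> pcell S p" using x by (rule presented_obtain)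
    let ?c = "pcell S (nrm lam p)"
    have c: "?c \<in> carrier M0" using p nrm_in_Z by (simp add: pcell_ops)
    have i: "iota n x = up (idc ?A) 0 n ?c" using iota_coset[of "pcell S p" n] p by (simp add: pcell_ops)
    have "down (src ?A) 0 n (iota n x) = ?c" using down_up(1)[of ?c 0 0 n] c by (simp add: i)
    then have "sig n (iota n x) = up (idc ?A) (Suc 0) (Suc n) (one_cell (nrm lam p))"
      using rho_normal[OF keys_nrm[OF p(1), of lam]] nrm_in_Z[OF p(1)] by (simp add: sig_def)
    also have "\<dots> = up (idc ?A) 0 (Suc n) ?c" using up_up[of 0 "Suc 0" "Suc n" "idc ?A" ?c] by simp
    finally show ?thesis by (simp add: i)
  qed
  show ?thesis unfolding contraction_def Let_def cell_free using lin cell norm by blast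
qed

text \<open>Both equations are images of equations between \<open>1\<close>-cells under iterated identities.  The first is the
  interchange law for \<open>\<rho>\<^bsub>pq\<^esub> = \<rho>\<^sub>p\<rho>\<^sub>q\<close>, the second is \<open>rho_brk\<close> multiplied by \<open>\<rho>\<^sub>v\<close>.\<close>

lemma right_bracketed_sig: "right_bracketed S iota sig"
proof -
  let ?A = "free_alg S"
  have up0: "up (idc ?A) 0 (Suc n) x = up (idc ?A) (Suc 0) (Suc n) (idc ?A 0 x)" for n x
    using up_up[of 0 "Suc 0" "Suc n" "idc ?A" x] by simp
  have src0: "\<exists>p. in_Z p \<and> down (src ?A) 0 n f = pcell S p" if "f \<in> carrier (free_cells S n)" for n f
    using pcell_surjD[OF down_ops(1)[OF _ that]] by simp
  have d0: "down (src ?A) 0 n (up (idc ?A) 0 n x) = x" if "x \<in> carrier M0" for n x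
    using down_up(1)[of x 0 0 n] that by simp
  have one: "sig n (f \<otimes>\<^bsub>free_cells S n\<^esub> g) =
      higher_alg.comp ?A (Suc n) 0 (up (idc ?A) 0 (Suc n) (down (src ?A) 0 n f) \<otimes>\<^bsub>free_cells S (Suc n)\<^esub> sig n g)
        (sig n (f \<otimes>\<^bsub>free_cells S n\<^esub> up (idc ?A) 0 n (iota 0 (proj S 0 (down (src ?A) 0 n g)))))"
    if f: "f \<in> carrier (free_cells S n)" and g: "g \<in> carrier (free_cells S n)" for n f g
  proof -
    obtain p q where p: "in_Z p" "down (src ?A) 0 n f = pcell S p" and q: "in_Z q" "down (src ?A) 0 n g = pcell S q"
      using src0[OF f] src0[OF g] by blast
    let ?b = "pcell S (nrm lam q)"
    have nq: "in_Z (nrm lam q)" by (rule nrm_in_Z[OF q(1)])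
    have b: "up (idc ?A) 0 n ?b \<in> carrier (free_cells S n)" using nq by (simp add: up_ops pcell_ops)
    have i: "iota 0 (proj S 0 (pcell S q)) = ?b" using iota_pcell[OF q(1), of 0] by simp
    have l: "sig n (f \<otimes>\<^bsub>free_cells S n\<^esub> g) = up (idc ?A) (Suc 0) (Suc n) (rho (p * q))"
      unfolding sig_def down_ops(2)[OF le0 f g] using p q by (simp add: pcell_ops carrier_closed)
    have r: "sig n (f \<otimes>\<^bsub>free_cells S n\<^esub> up (idc ?A) 0 n ?b) = up (idc ?A) (Suc 0) (Suc n) (rho (p * nrm lam q))"
      unfolding sig_def down_ops(2)[OF le0 f b] using p nq by (simp add: d0 pcell_ops carrier_closed)
    have g': "sig n g = up (idc ?A) (Suc 0) (Suc n) (rho q)" using q by (simp add: sig_def)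
    note rp = arr_rho[OF p(1)] and rq = arr_rho[OF q(1)] and op = arr_one_cell[OF p(1)] and on = arr_one_cell[OF nq]
    \<comment> \<open>Reduce the right factor first, then the left one.\<close>
    have "(one_cell p \<otimes>\<^bsub>M1\<^esub> rho q) \<star> (rho p \<otimes>\<^bsub>M1\<^esub> one_cell (nrm lam q)) = rho p \<otimes>\<^bsub>M1\<^esub> rho q"
      using star_laws(2)[OF op rp rq on] star_laws(6)[OF rp arr_one_cell[OF nrm_in_Z[OF p(1)]]] star_laws(7)[OF rq on] by simp
    then have e: "(one_cell p \<otimes>\<^bsub>M1\<^esub> rho q) \<star> rho (p * nrm lam q) = rho (p * q)"
      using rho_mult[OF p(1) nq] rho_mult[OF p(1) q(1)] rho_normal[OF keys_nrm[OF q(1), of lam]] by simp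
    have cmp: "composable ?A (Suc 0) 0 (one_cell p \<otimes>\<^bsub>M1\<^esub> rho q) (rho (p * nrm lam q))"
      by (rule arr_composable[OF arr_mult[OF op rq] arr_rho[OF carrier_closed(3)[OF p(1) nq]]])
    have s1: "Suc 0 \<le> Suc n" by simp
    show ?thesis
      unfolding l p(2) q(2) i r g' up0
        up_ops(2)[OF s1 arrD(3)[OF op] arrD(3)[OF rq], symmetric]
        up_comp[OF zero_less_Suc s1 cmp, symmetric] e ..
  qed
  have two: "sig n (oper (free_cells S n) \<tau> h \<otimes>\<^bsub>free_cells S n\<^esub> up (idc ?A) 0 n (pcell S (mon v))) =
      higher_alg.comp ?A (Suc n) 0
        (oper (free_cells S (Suc n)) \<tau> (sig n h) \<otimes>\<^bsub>free_cells S (Suc n)\<^esub> up (idc ?A) 0 (Suc n) (pcell S (mon v)))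
        (up (idc ?A) 1 (Suc n) (sig 0 (oper M0 \<tau> (iota 0 (proj S 0 (down (src ?A) 0 n h))) \<otimes>\<^bsub>M0\<^esub> pcell S (mon v))))"
    if h: "h \<in> carrier (free_cells S n)" and v: "v \<in> omonoid Z" for n \<tau> h v
  proof -
    obtain p where p: "in_Z p" "down (src ?A) 0 n h = pcell S p" using src0[OF h] by blast
    have vZ: "in_Z (mon v)" using v by simp
    have vc: "up (idc ?A) 0 n (pcell S (mon v)) \<in> carrier (free_cells S n)" using vZ by (simp add: up_ops pcell_ops(1))
    have hc: "oper (free_cells S n) \<tau> h \<in> carrier (free_cells S n)" using operated_algebraD(9)[OF free_operated h] .
    have np: "in_Z (nrm lam p)" by (rule nrm_in_Z[OF p(1)])
    have bp: "in_Z (brk \<tau> p)" "in_Z (brk \<tau> (nrm lam p))" using p(1) np by (simp_all add: carrier_closed)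
    have i: "iota 0 (proj S 0 (pcell S p)) = pcell S (nrm lam p)" using iota_pcell[OF p(1), of 0] by simp
    have l: "sig n (oper (free_cells S n) \<tau> h \<otimes>\<^bsub>free_cells S n\<^esub> up (idc ?A) 0 n (pcell S (mon v))) =
        up (idc ?A) (Suc 0) (Suc n) (rho (brk \<tau> p * mon v))"
      unfolding sig_def down_ops(2)[OF le0 hc vc] down_ops(6)[OF le0 h] p(2) d0[OF pcell_ops(1)[OF vZ]]
        pcell_ops(3)[OF p(1)] pcell_ops(5)[OF bp(1) vZ] pval_pcell[OF carrier_closed(3)[OF bp(1) vZ]] ..
    have r: "sig 0 (oper M0 \<tau> (pcell S (nrm lam p)) \<otimes>\<^bsub>M0\<^esub> pcell S (mon v)) = rho (brk \<tau> (nrm lam p) * mon v)"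
      unfolding pcell_ops(3)[OF np] pcell_ops(5)[OF bp(2) vZ] by (rule sig_pcell[OF carrier_closed(3)[OF bp(2) vZ]])
    have h': "sig n h = up (idc ?A) (Suc 0) (Suc n) (rho p)" using p by (simp add: sig_def)
    note rp = arr_rho[OF p(1)] and rv = arr_rho[OF vZ] and ov = arr_one_cell[OF vZ]
    note orp = arr_oper[OF rp, of \<tau>]
    note lb = arr_lin_base[OF keys_nrm[OF p(1), of lam], folded Diff_eq[of \<tau>]]
    have nb: "rho (brk \<tau> (nrm lam p)) = lin_base (nrm lam p)" by (rule rho_brk_normal[OF keys_nrm[OF p(1)]])
    \<comment> \<open>Reduce inside the bracket first, then the bracket itself and \<open>v\<close> simultaneously.\<close>
    have "(oper M1 \<tau> (rho p) \<otimes>\<^bsub>M1\<^esub> one_cell (mon v)) \<star> (lin_base (nrm lam p) \<otimes>\<^bsub>M1\<^esub> rho (mon v)) =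
        rho (brk \<tau> p) \<otimes>\<^bsub>M1\<^esub> rho (mon v)"
      using star_laws(2)[OF orp lb ov rv] star_laws(6)[OF rv arr_one_cell[OF nrm_in_Z[OF vZ]]] rho_brk[OF p(1), of \<tau>] by simp
    then have e: "(oper M1 \<tau> (rho p) \<otimes>\<^bsub>M1\<^esub> one_cell (mon v)) \<star> rho (brk \<tau> (nrm lam p) * mon v) = rho (brk \<tau> p * mon v)"
      unfolding rho_mult[OF bp(1) vZ] rho_mult[OF bp(2) vZ] nb .
    have cmp: "composable ?A (Suc 0) 0 (oper M1 \<tau> (rho p) \<otimes>\<^bsub>M1\<^esub> one_cell (mon v)) (rho (brk \<tau> (nrm lam p) * mon v))"
      by (rule arr_composable[OF arr_mult[OF orp ov] arr_rho[OF carrier_closed(3)[OF bp(2) vZ]]])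
    have s1: "Suc 0 \<le> Suc n" by simp
    show ?thesis
      unfolding l p(2) i r h' up0 One_nat_def
        up_ops(6)[OF s1 arrD(3)[OF rp], symmetric]
        up_ops(2)[OF s1 arrD(3)[OF orp] arrD(3)[OF ov], symmetric]
        up_comp[OF zero_less_Suc s1 cmp, symmetric] e ..
  qed
  show ?thesis unfolding right_bracketed_def Let_def cell_free gens0
  proof (intro conjI allI ballI)
    fix n f g assume f: "f \<in> carrier (free_cells S n)" and g: "g \<in> carrier (free_cells S n)"
    from one[OF f g] show "sig n (f \<otimes>\<^bsub>free_cells S n\<^esub> g) =
      higher_alg.comp ?A (Suc n) 0 (up (idc ?A) 0 (Suc n) (down (src ?A) 0 n f) \<otimes>\<^bsub>free_cells S (Suc n)\<^esub> sig n g)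
        (sig n (f \<otimes>\<^bsub>free_cells S n\<^esub> up (idc ?A) 0 n (iota 0 (proj S 0 (down (src ?A) 0 n g)))))" .
  next
    fix n \<tau> h and v :: "('z, diff_op) mono"
    assume h: "h \<in> carrier (free_cells S n)" and v: "v \<in> omonoid Z"
    from two[OF h v] show "sig n (oper (free_cells S n) \<tau> h \<otimes>\<^bsub>free_cells S n\<^esub> up (idc ?A) 0 n (pcell S (mon v))) =
      higher_alg.comp ?A (Suc n) 0
        (oper (free_cells S (Suc n)) \<tau> (sig n h) \<otimes>\<^bsub>free_cells S (Suc n)\<^esub> up (idc ?A) 0 (Suc n) (pcell S (mon v)))
        (up (idc ?A) 1 (Suc n) (sig 0 (oper M0 \<tau> (iota 0 (proj S 0 (down (src ?A) 0 n h))) \<otimes>\<^bsub>M0\<^esub> pcell S (mon v))))" .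
  qed
qed

text \<open>The conditions on \<open>\<sigma>\<close> for tuples that extend to a longer tuple are vacuous, since no tuple extends.\<close>

lemma sq_structure_S: "sq_structure (diff_polygraph Z lam) S"
proof -
  let ?X = "diff_polygraph Z lam"
  have io: "iota 0 (proj S 0 (pcell S (mon u))) = pcell S (nf ?X (mon u))" if "u \<in> omonoid Z" for u
    using iota_pcell[of "mon u" 0] that by (simp add: nf_diff)
  have sg: "sig n (rmult S n (sq_cell S us) v) = gcell S (Suc n) (us @ [v])"
      if "if n = 0 then \<exists>u\<in>sq_heads ?X. us = [u] else us \<in> sq_gens ?X n" "us @ [v] \<in> sq_gens ?X (Suc n)" for n us v
  proof (cases n)
    case 0
    then show ?thesis using that sq_gens_1_diff[of Z lam] by (auto simp: sq_heads_diff)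
  next
    case (Suc m)
    then show ?thesis using that(2) sq_gens_ge2_diff[of "Suc n" Z lam] by simp
  qed
  have si: "sig n (rmult S n (sq_cell S us) v) = idc (free_alg S) n (rmult S n (sq_cell S us) v)"
    if us: "if n = 0 then \<exists>u\<in>sq_heads ?X. us = [u] else us \<in> sq_gens ?X n"
      and v: "v \<in> Dtheta_star Z" and l: "last us @ v \<in> Dtheta_star Z" for n us v
  proof -
    have "n = 0"
    proof (rule ccontr)
      assume "n \<noteq> 0"
      then have "us \<in> sq_gens ?X n" using us by simp
      then have "n = 1" using sq_gens_ge2_diff[of n Z lam] \<open>n \<noteq> 0\<close> by (cases "2 \<le> n") auto
      then obtain w where "us = [[], dop w]" "length w \<noteq> 1" using \<open>us \<in> sq_gens ?X n\<close> sq_gens_1_diff[of Z lam] by auto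
      then show False using l by (auto simp: Dtheta_star_iff)
    qed
    then obtain u where u: "us = [u]" using us by auto
    have uv: "u \<in> Dtheta_star Z" "u @ v \<in> Dtheta_star Z" using l u by (auto simp: Dtheta_star_iff)
    have Z: "in_Z (mon u)" "in_Z (mon v)" "in_Z (mon (u @ v))" using uv v Dtheta_star_omonoid by auto
    have "rmult S 0 (sq_cell S us) v = pcell S (mon (u @ v))"
      using pcell_ops(5)[OF Z(1,2)] by (simp add: rmult_def sq_cell_def u mon_mult)
    moreover have "rho (mon (u @ v)) = one_cell (mon (u @ v))" by (rule rho_normal) (use uv in simp)
    ultimately show ?thesis using \<open>n = 0\<close> sig_pcell[OF Z(3)] by simp
  qed
  have br: "sig 0 (pcell S (mon [Br \<tau> u])) = gcell S 1 [[], [Br \<tau> u]] \<and>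
      sig 1 (rmult S 1 (gcell S 1 [[], [Br \<tau> u]]) v) = idc (free_alg S) 1 (rmult S 1 (gcell S 1 [[], [Br \<tau> u]]) v)"
    if u: "u \<in> Dtheta_star Z" and r: "[Br \<tau> u] \<in> reducible_monos ?X" and v: "v \<in> Dtheta_star Z" for \<tau> u v
  proof -
    have t: "[Br \<tau> u] = dop u" by (cases \<tau>) simp
    have len: "length u \<noteq> 1"
    proof
      assume "length u = 1"
      then obtain l where "u = [l]" by (auto simp: length_Suc_conv)
      then show False using u r by (auto simp: reducible_diff Dtheta_star_iff)
    qed
    have b: "base_cell Z S u = gcell S (Suc 0) [[], dop u]" using u len by (simp add: base_cell_def)
    note a = arr_base_cell[OF u, unfolded b]
    have Z: "in_Z (mon (dop u))" "in_Z (mon v)" using dop_omonoid[OF u] v Dtheta_star_omonoid by auto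
    have ru: "rho (mon (dop u)) = gcell S (Suc 0) [[], dop u]"
      using rho_brk_normal[of "mon u" Diff] u base.single_eq[OF u, of 1] base.h[OF u] b by (simp add: M1_op(6))
    have rv: "rho (mon v) = one_cell (mon v)" by (rule rho_normal) (use v in simp)
    let ?f = "gcell S (Suc 0) [[], dop u] \<otimes>\<^bsub>M1\<^esub> one_cell (mon v)"
    have rm: "rmult S (Suc 0) (gcell S (Suc 0) [[], dop u]) v = ?f" by (simp add: rmult_def)
    have "rho (mon (dop u) * mon v) = ?f" using rho_mult[OF Z] ru rv by simp
    then have "sig (Suc 0) ?f = idc (free_alg S) (Suc 0) ?f"
      using sig_up[OF arr_mult[OF a arr_one_cell[OF Z(2)]], of "Suc 0"] by simp
    then show ?thesis using sig_pcell[OF Z(1)] ru rm t by simp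
  qed
  have gen: "\<forall>n us. \<forall>v\<in>Dtheta_star Z.
      (if n = 0 then \<exists>u\<in>sq_heads ?X. us = [u] else us \<in> sq_gens ?X n) \<longrightarrow>
        (us @ [v] \<in> sq_gens ?X (Suc n) \<longrightarrow> sig n (rmult S n (sq_cell S us) v) = gcell S (Suc n) (us @ [v])) \<and>
        (last us @ v \<in> Dtheta_star Z \<longrightarrow>
          sig n (rmult S n (sq_cell S us) v) = idc (free_alg S) n (rmult S n (sq_cell S us) v))"
    by (intro allI ballI impI conjI) (rule sg, assumption+, rule si, assumption+)
  have brk: "\<forall>\<tau>. \<forall>u\<in>Dtheta_star Z. [Br \<tau> u] \<in> reducible_monos ?X \<longrightarrow>
      sig 0 (pcell S (mon [Br \<tau> u])) = gcell S 1 [[], [Br \<tau> u]] \<and>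
      (\<forall>v\<in>Dtheta_star Z. sig 1 (rmult S 1 (gcell S 1 [[], [Br \<tau> u]]) v) =
        idc (free_alg S) 1 (rmult S 1 (gcell S 1 [[], [Br \<tau> u]]) v))"
  proof (intro allI ballI impI conjI)
    fix \<tau> u assume a: "u \<in> Dtheta_star Z" "[Br \<tau> u] \<in> reducible_monos ?X"
    have e: "[] \<in> Dtheta_star Z" by (simp add: Dtheta_star_iff)
    show "sig 0 (pcell S (mon [Br \<tau> u])) = gcell S 1 [[], [Br \<tau> u]]" by (rule br[OF a e, THEN conjunct1])
    fix v assume v: "v \<in> Dtheta_star Z"
    show "sig 1 (rmult S 1 (gcell S 1 [[], [Br \<tau> u]]) v) =
        idc (free_alg S) 1 (rmult S 1 (gcell S 1 [[], [Br \<tau> u]]) v)" by (rule br[OF a v, THEN conjunct2])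
  qed
  show ?thesis unfolding sq_structure_def gens0 zgens_diff Nf_diff
    by (intro conjI exI[of _ iota] exI[of _ sig] polygraph refl gens unital_section_iota contraction_sig
        right_bracketed_sig gen brk ballI io)
qed

lemma polygraphic_resolution_S: "polygraphic_resolution S (free_diff_alg Z lam)"
proof -
  have "\<exists>h\<in>carrier (cell (free_alg S) (Suc n)). src (free_alg S) n h = f \<and> tgt (free_alg S) n h = g"
    if n: "1 \<le> n" and par: "parallel (free_alg S) n f g" for n f g
  proof -
    have fg: "f \<in> carrier (free_cells S n)" "g \<in> carrier (free_cells S n)" using par by (simp_all add: parallel_def)
    obtain m where m: "n = Suc m" using n by (cases n) auto
    have st: "src (free_alg S) m f = src (free_alg S) m g" "tgt (free_alg S) m f = tgt (free_alg S) m g"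
      using par m by (simp_all add: parallel_def)
    have "f = g"
    proof (cases m)
      case 0
      obtain p q where "arr f p q" using arr_exists fg m 0 by blast
      moreover have "arr g p q" using \<open>arr f p q\<close> fg st m 0 by (simp add: arr_def)
      ultimately show ?thesis by (rule arr_parallel_eq)
    next
      case (Suc l)
      have n1: "Suc 0 \<le> n" using n by simp
      obtain f' where f': "f' \<in> carrier M1" "f = up (idc (free_alg S)) (Suc 0) n f'"
        using high_cell[OF n1 fg(1)] by blast
      obtain g' where g': "g' \<in> carrier M1" "g = up (idc (free_alg S)) (Suc 0) n g'"
        using high_cell[OF n1 fg(2)] by blast
      have "up (idc (free_alg S)) (Suc 0) m f' = up (idc (free_alg S)) (Suc 0) m g'"
        using st(1) f' g' m Suc src_idc up_ops(1)[of "Suc 0" m] by simp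
      then show ?thesis using f' g' m Suc by simp
    qed
    then show ?thesis using fg idc_hom[of n] src_idc tgt_idc op_homD(1)[OF idc_hom[of n]]
      by (intro bexI[of _ "idc (free_alg S) n f"]) simp_all
  qed
  then show ?thesis unfolding polygraphic_resolution_def using polygraph presented_iso by blast
qed

end

section \<open>Existence and uniqueness of the polygraph\<close>

text \<open>The boundaries are given by \<open>zcell\<close>, since \<open>pcell\<close> would refer to the polygraph under construction.\<close>

definition diff_resolution_polygraph :: "'z set \<Rightarrow> 'k::field \<Rightarrow>
    ('k, 'z, diff_op, ('z, diff_op) mono list) polygraph" where
  "diff_resolution_polygraph Z lam =
     \<lparr>gens0 = Z, gens = sq_gens (diff_polygraph Z lam),
      bsrc = (\<lambda>n. restrict (\<lambda>g. zcell Z (mon (g ! 1))) (sq_gens (diff_polygraph Z lam) n)),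
      btgt = (\<lambda>n. restrict (\<lambda>g. zcell Z (nrm_mono lam (g ! 1))) (sq_gens (diff_polygraph Z lam) n))\<rparr>"

lemma diff_resolution_polygraph_simps [simp]:
  "gens0 (diff_resolution_polygraph Z lam) = Z"
  "gens (diff_resolution_polygraph Z lam) = sq_gens (diff_polygraph Z lam)"
  by (simp_all add: diff_resolution_polygraph_def)

lemma sq_gens_diff_cases:
  assumes "g \<in> sq_gens (diff_polygraph Z lam) n"
  obtains w where "n = Suc 0" "g = [[], dop w]" "w \<in> Dtheta_star Z" "length w \<noteq> 1"
proof -
  have n: "n = 1" using assms sq_gens_0[of "diff_polygraph Z lam"] sq_gens_ge2_diff[of n Z lam]
    by (cases "n = 0"; cases "2 \<le> n") auto
  then show thesis using that assms sq_gens_1_diff[of Z lam] by auto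
qed

lemma nrm_mono_dop: "w \<in> Dtheta_star Z \<Longrightarrow> nrm_mono lam (dop w) = der lam w"
  by (simp add: nrm_mono_normal)

lemma diff_resolution_exists: "diff_resolution Z lam (diff_resolution_polygraph Z lam)"
proof -
  let ?S = "diff_resolution_polygraph Z lam"
  have g0: "gens ?S 0 = {}" by (simp add: sq_gens_0)
  have b: "bsrc ?S (Suc 0) [[], dop w] = pcell ?S (mon (dop w)) \<and> btgt ?S (Suc 0) [[], dop w] = pcell ?S (der lam w) \<and>
      keys (mon (dop w) :: ('b, 'a, diff_op) opoly) \<subseteq> omonoid Z \<and> keys (der lam w) \<subseteq> omonoid Z"
    if w: "w \<in> Dtheta_star Z" "length w \<noteq> 1" for w
  proof -
    have g: "[[], dop w] \<in> sq_gens (diff_polygraph Z lam) (Suc 0)" using sq_gens_1_diff[of Z lam] w by auto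
    have Z: "dop w \<in> omonoid Z" "keys (der lam w) \<subseteq> omonoid Z"
      using w Dtheta_star_omonoid keys_der[of _ lam w Z] by auto
    then show ?thesis using g nrm_mono_dop[OF w(1), of lam] pcell_zcell[OF g0, of "mon (dop w)"] pcell_zcell[OF g0, of "der lam w"]
      by (simp add: diff_resolution_polygraph_def)
  qed
  have c: "pcell ?S p \<in> carrier (free_cells ?S 0)" if "keys p \<subseteq> omonoid Z" for p
    using op_homD(1)[OF pcell_hom[of ?S]] that by simp
  have "polygraph ?S" unfolding polygraph_def
  proof (intro conjI allI ballI g0)
    fix n
    show "bsrc ?S n \<in> extensional (gens ?S n)" "btgt ?S n \<in> extensional (gens ?S n)"
      by (simp_all add: diff_resolution_polygraph_def)
    fix g assume "g \<in> gens ?S n"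
    then obtain w where "n = Suc 0" "g = [[], dop w]" "w \<in> Dtheta_star Z" "length w \<noteq> 1"
      by (auto elim: sq_gens_diff_cases)
    then show "parallel (free_alg ?S) (n - 1) (bsrc ?S n g) (btgt ?S n g)"
      using b[of w] c by (simp add: parallel_def)
  qed
  with b show ?thesis by (intro diff_resolution.intro) simp_all
qed

text \<open>The generator \<open>\<epsilon>|D(w)\<close> is the value of \<open>\<sigma>\<close> at \<open>D(w)\<close>, whose source is \<open>D(w)\<close> and whose target is the
  normal form of \<open>D(w)\<close>.\<close>

lemma sq_structure_unique:
  fixes lam :: "'k::field" and S :: "('k, 'z, diff_op, ('z, diff_op) mono list) polygraph"
  assumes "sq_structure (diff_polygraph Z lam) S"
  shows "S = diff_resolution_polygraph Z lam"
proof -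
  let ?X = "diff_polygraph Z lam" and ?A = "free_alg S"
  have P: "polygraph S" and g: "gens0 S = Z" "gens S = sq_gens ?X"
    using assms unfolding sq_structure_def by simp_all
  obtain \<iota> \<sigma> where io': "\<forall>u\<in>omonoid Z. \<iota> 0 (proj S 0 (pcell S (mon u))) = pcell S (nf ?X (mon u))"
    and co: "contraction S \<iota> \<sigma>"
    and br': "\<forall>\<tau>. \<forall>u\<in>Dtheta_star Z. [Br \<tau> u] \<in> reducible_monos ?X \<longrightarrow>
      \<sigma> 0 (pcell S (mon [Br \<tau> u])) = gcell S 1 [[], [Br \<tau> u]] \<and>
      (\<forall>v\<in>Dtheta_star Z. \<sigma> 1 (rmult S 1 (gcell S 1 [[], [Br \<tau> u]]) v) =
        idc ?A 1 (rmult S 1 (gcell S 1 [[], [Br \<tau> u]]) v))"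
    using assms unfolding sq_structure_def zgens_diff Nf_diff by (elim conjE exE) (rule that; assumption)
  note io = bspec[OF io'] and br = br'[rule_format, THEN conjunct1]
  have g0: "gens S 0 = {}" using P by (simp add: polygraph_def)
  have b: "bsrc S (Suc 0) [[], dop w] = zcell Z (mon (dop w)) \<and> btgt S (Suc 0) [[], dop w] = zcell Z (der lam w)"
    if w: "w \<in> Dtheta_star Z" "length w \<noteq> 1" for w
  proof -
    let ?a = "pcell S (mon (dop w))"
    have Z: "dop w \<in> omonoid Z" "keys (der lam w) \<subseteq> omonoid Z"
      using w Dtheta_star_omonoid keys_der[of _ lam w Z] by auto
    have gw: "[[], dop w] \<in> gens S (Suc 0)" using sq_gens_1_diff[of Z lam] w g by auto
    have "dop w \<in> reducible_monos ?X" using w Z(1) by (auto simp: reducible_diff Dtheta_star_iff)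
    then have s: "\<sigma> 0 ?a = gcell S (Suc 0) [[], dop w]" using br[OF w(1), of Diff] by simp
    have "?a \<in> carrier (cell ?A 0)" using op_homD(1)[OF pcell_hom[of S], of "mon (dop w)"] Z(1) g by simp
    then have "src ?A 0 (\<sigma> 0 ?a) = ?a" "tgt ?A 0 (\<sigma> 0 ?a) = \<iota> 0 (proj S 0 ?a)"
      using co unfolding contraction_def Let_def by simp_all
    then show ?thesis
      unfolding s src_gcell[OF P gw] io[OF Z(1)]
      using pcell_zcell[OF g0, of "mon (dop w)"] pcell_zcell[OF g0, of "der lam w"] Z g nrm_mono_dop[OF w(1), of lam]
      by (simp add: nf_diff)
  qed
  have extn: "bsrc S n \<in> extensional (sq_gens ?X n)" "btgt S n \<in> extensional (sq_gens ?X n)" for n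
    using P g by (simp_all add: polygraph_def)
  have "bsrc S n x = bsrc (diff_resolution_polygraph Z lam) n x \<and> btgt S n x = btgt (diff_resolution_polygraph Z lam) n x" for n x
  proof (cases "x \<in> sq_gens ?X n")
    case True
    then obtain w where w: "n = Suc 0" "x = [[], dop w]" "w \<in> Dtheta_star Z" "length w \<noteq> 1" by (rule sq_gens_diff_cases)
    then show ?thesis using b[OF w(3,4)] True nrm_mono_dop[OF w(3), of lam] by (simp add: diff_resolution_polygraph_def)
  next
    case False
    then show ?thesis using extn[of n] by (simp add: diff_resolution_polygraph_def extensional_def)
  qed
  then have "bsrc S = bsrc (diff_resolution_polygraph Z lam)" "btgt S = btgt (diff_resolution_polygraph Z lam)"
    by (simp_all add: fun_eq_iff)
  then show ?thesis using g by (intro polygraph.equality) simp_all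
qed

lemma Sq_diff: "Sq (diff_polygraph Z lam) = diff_resolution_polygraph Z lam"
  unfolding Sq_def
  by (rule the_equality) (rule diff_resolution.sq_structure_S[OF diff_resolution_exists], rule sq_structure_unique)

theorem theorem6p2p3:
  fixes Z :: "'z set" and lam :: "'k::field_char_0"
  shows "polygraphic_resolution (Sq (diff_polygraph Z lam)) (free_diff_alg Z lam) \<and>
    gens0 (Sq (diff_polygraph Z lam)) = Z \<and>
    gens (Sq (diff_polygraph Z lam)) 1 =
      {[[], dop []]} \<union>
      {[[], dop (u @ v)] | u v. u \<in> Dtheta_star Z - {[]} \<and> v \<in> Dtheta_star Z - {[]}} \<and>
    (\<forall>n\<ge>2. gens (Sq (diff_polygraph Z lam)) n = {})"
  unfolding Sq_diff diff_resolution_polygraph_simps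
  using diff_resolution.polygraphic_resolution_S[OF diff_resolution_exists]
    sq_gens_1_products[of Z lam] sq_gens_ge2_diff[of _ Z lam] by blast

end
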